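(* Let $\mathbb{P}=\{\sigma_1,\dots,\sigma_s\}$ be a simplicial complement with corresponding simplicial complex $K_{\mathbb{P}}$. The $\mathbf{k}[\mathbf{x}]$-module map $$\varphi:(\Lambda^{*,*}[\mathbb{P}]\otimes_{\mathbf{k}}\Lambda^{*,*}[\mathbb{P}])\otimes_{\mathbf{k}}\mathbf{k}[\mathbf{x}]\longrightarrow\Lambda^{*,*}[\mathbb{P}]\otimes_{\mathbf{k}}\mathbf{k}[\mathbf{x}],\qquad \mathbf{u}\times\mathbf{v}=\mathbf{u}\cdot\mathbf{v}\otimes\frac{\mathbf{x}_{S_{\mathbf{u}}}\cdot\mathbf{x}_{S_{\mathbf{v}}}}{\mathbf{x}_{S_{\mathbf{u}\cdot\mathbf{v}}}}$$ (for generators $\mathbf{u},\mathbf{v}$ of $\Lambda^{*,*}[\mathbb{P}]$, and $\mathbf{u}\times\mathbf{v}=0$ if $\mathbf{u}\cdot\mathbf{v}=0$) is a chain map. Consequently, the algebra structure on $H_{*,*}(\Lambda^{*,*}[\mathbb{P}],d)\cong\mathrm{Tor}^{\mathbf{k}[\mathbf{x}]}_{*,*}(\mathbf{k}(K_{\mathbb{P}}),\mathbf{k})$ is given by $$[c]\times[c']=[c\cdot c']\cdot\delta_{\sigma,\sigma'}$$ for $[c]\in H_{q,\sigma}(\Lambda^{*,\sigma}[\mathbb{P}],d)$ and $[c']\in H_{j,\sigma'}(\Lambda^{*,\sigma'}[\mathbb{P}],d)$, where $c\cdot c'$ is the product of $c$ and $c'$ in the exterior algebra $\Lambda^{*,*}[\mathbb{P}]$,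 and $\delta_{\sigma,\sigma'}=1$ if $\sigma\cap\sigma'=\emptyset$, $\delta_{\sigma,\sigma'}=0$ if $\sigma\cap\sigma'\neq\emptyset$ (so that the product is $0$ in the latter case).
   Context: $\mathbf{k}$ is a principal ideal domain, $[m]=\{1,\dots,m\}$, $\mathbf{k}[\mathbf{x}]=\mathbf{k}[x_1,\dots,x_m]$ with its $\mathbb{N}^m$-grading; $\mathbf{k}$ is a $\mathbf{k}[\mathbf{x}]$-algebra via $x_i\mapsto 0$. For $\sigma\subset[m]$, $\mathbf{x}_\sigma=\prod_{i\in\sigma}x_i$, $\mathbf{x}_\emptyset=1$. A simplicial complement is a finite sequence $\mathbb{P}=\{\sigma_1,\dots,\sigma_s\}$ of subsets of $[m]$. $K_{\mathbb{P}}$ is the abstract simplicial complex on $[m]$ whose non-faces are exactly the subsets of $[m]$ containing some $\sigma_i$; $\mathbf{k}(K_{\mathbb{P}})=\mathbf{k}[\mathbf{x}]/\langle\mathbf{x}_{\sigma_1},\dots,\mathbf{x}_{\sigma_s}\rangle$ is its Stanley–Reisner face ring. $\Lambda[\mathbb{P}]$ is the exterior algebra over $\mathbf{k}$ on formal generators $\sigma_1,\dots,\sigma_s$ (distinct even if some subsets coincide), with $\mathbf{k}$-module generators $\mathbf{u}=\sigma_{k_1}\cdots\sigma_{k_q}$, $k_1<\dots<k_q$ (including $1$), total subset $S_{\mathbf{u}}=\sigma_{k_1}\cup\dots\cup\sigma_{k_q}$ ($S_1=\emptyset$), bidegree $(q,S_{\mathbf{u}})$, and $\partial_i(\mathbf{u})=\sigma_{k_1}\cdots\widehat\sigma_{k_i}\cdots\sigma_{k_q}$.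 When $\mathbf{u}\cdot\mathbf{v}\neq 0$, $S_{\mathbf{u}\cdot\mathbf{v}}=S_{\mathbf{u}}\cup S_{\mathbf{v}}$. $\Lambda^{*,\sigma}[\mathbb{P}]$ is the submodule spanned by generators with total subset $\sigma$. The Taylor resolution of $\mathbf{k}(K_{\mathbb{P}})$ is $R=\Lambda^{*,*}[\mathbb{P}]\otimes_{\mathbf{k}}\mathbf{k}[\mathbf{x}]$ with $\widetilde d(\mathbf{u}\otimes\mathbf{x}^{\mathbf{a}})=\sum_i(-1)^i\partial_i(\mathbf{u})\otimes\mathbf{x}_{S_{\mathbf{u}}\setminus S_{\partial_i(\mathbf{u})}}\mathbf{x}^{\mathbf{a}}$ and augmentation the quotient map $\Lambda^{0,*}[\mathbb{P}]\otimes\mathbf{k}[\mathbf{x}]=\mathbf{k}[\mathbf{x}]\to\mathbf{k}(K_{\mathbb{P}})$. The source of $\varphi$ is $R\otimes_{\mathbf{k}[\mathbf{x}]}R$ with the tensor product differential, $d(\mathbf{u}\otimes\mathbf{v})=d(\mathbf{u})\otimes\mathbf{v}+(-1)^q\mathbf{u}\otimes d(\mathbf{v})$ for $\mathbf{u}$ of first degree $q$. Applying $\otimes_{\mathbf{k}[\mathbf{x}]}\mathbf{k}$ to $R$ gives $(\Lambda^{*,*}[\mathbb{P}],d)$ with $d(\mathbf{u})=\sum_i(-1)^i\partial_i(\mathbf{u})\,\delta_{\partial_i(\mathbf{u})}$, $\delta_{\partial_i(\mathbf{u})}=1$ if $S_{\mathbf{u}}=S_{\partial_i(\mathbf{u})}$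 and $0$ otherwise; each $\Lambda^{*,\sigma}[\mathbb{P}]$ is a subcomplex, $H_{q,\sigma}$ denotes homology in bidegree $(q,\sigma)$, and $H_{q,\sigma}(\Lambda^{*,*}[\mathbb{P}],d)\cong\mathrm{Tor}^{\mathbf{k}[\mathbf{x}]}_{q,\sigma}(\mathbf{k}(K_{\mathbb{P}}),\mathbf{k})$, the component of $\mathbb{N}^m$-degree equal to the exponent of $\mathbf{x}_\sigma$. The algebra structure on $\mathrm{Tor}^{\mathbf{k}[\mathbf{x}]}(A,B)$ for $\mathbf{k}[\mathbf{x}]$-algebras $A,B$ is the standard one: take a free resolution $P\to A$, a chain map $P\otimes_{\mathbf{k}[\mathbf{x}]}P\to P$ covering the multiplication $A\otimes_{\mathbf{k}[\mathbf{x}]}A\to A$, combine it with the multiplication of $B$ to get $(P\otimes B)\otimes(P\otimes B)\to P\otimes B$, and compose with the natural map $H_i(P\otimes B)\otimes H_j(P\otimes B)\to H_{i+j}((P\otimes B)\otimes(P\otimes B))$. Here $A=\mathbf{k}(K_{\mathbb{P}})$, $B=\mathbf{k}$. *)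

theory Defs
  imports
    "HOL-Algebra.Algebra"
    "HOL-Algebra.Algebraic_Closure_Type"
    "HOL-Library.Poly_Mapping"
begin

section \<open>Free modules, linear maps and tensor products\<close>

text \<open>
  The free \<^typ>\<open>'r\<close>-module with basis \<^typ>\<open>'b\<close> is \<^typ>\<open>'b \<Rightarrow>\<^sub>0 'r\<close>. A linear map between free modules
  is given by its values \<^term>\<open>f :: 'b \<Rightarrow> 'c \<Rightarrow>\<^sub>0 'r\<close> on the basis; \<open>lin f\<close> is its linear extension.
\<close>

definition scale :: "'r \<Rightarrow> ('b \<Rightarrow>\<^sub>0 'r::comm_ring_1) \<Rightarrow> ('b \<Rightarrow>\<^sub>0 'r)" where
  "scale r x = Poly_Mapping.map (\<lambda>a. r * a) x"

definition lin :: "('b \<Rightarrow> ('c \<Rightarrow>\<^sub>0 'r)) \<Rightarrow> ('b \<Rightarrow>\<^sub>0 'r::comm_ring_1) \<Rightarrow> ('c \<Rightarrow>\<^sub>0 'r)" where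
  "lin f x = (\<Sum>b\<in>Poly_Mapping.keys x. scale (Poly_Mapping.lookup x b) (f b))"

text \<open>The tensor product of free modules is the free module on the pairs of basis elements.\<close>

definition tensor :: "('b \<Rightarrow>\<^sub>0 'r::comm_ring_1) \<Rightarrow> ('c \<Rightarrow>\<^sub>0 'r) \<Rightarrow> (('b \<times> 'c) \<Rightarrow>\<^sub>0 'r)" where
  "tensor x y = (\<Sum>b\<in>Poly_Mapping.keys x. \<Sum>c\<in>Poly_Mapping.keys y.
     Poly_Mapping.single (b, c) (Poly_Mapping.lookup x b * Poly_Mapping.lookup y c))"

section \<open>Complexes of free modules\<close>

text \<open>
  A non-negatively graded complex of free modules with chosen bases: \<open>gens\<close> is the union of the bases
  of all degrees, \<open>hdeg\<close> the homological degree of a basis element, \<open>diff\<close> the differential on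
  basis elements. Values of \<open>hdeg\<close> and \<open>diff\<close> outside \<open>gens\<close> are irrelevant.
\<close>

record (overloaded) ('b, 'r) fcomplex =
  gens :: "'b set"
  hdeg :: "'b \<Rightarrow> nat"
  diff :: "'b \<Rightarrow> ('b \<Rightarrow>\<^sub>0 'r)"

definition chains :: "('b, 'r::comm_ring_1) fcomplex \<Rightarrow> nat \<Rightarrow> ('b \<Rightarrow>\<^sub>0 'r) set" where
  "chains C n = {x. Poly_Mapping.keys x \<subseteq> {b \<in> gens C. hdeg C b = n}}"

definition bd :: "('b, 'r::comm_ring_1) fcomplex \<Rightarrow> ('b \<Rightarrow>\<^sub>0 'r) \<Rightarrow> ('b \<Rightarrow>\<^sub>0 'r)" where
  "bd C = lin (diff C)"

definition is_complex :: "('b, 'r::comm_ring_1) fcomplex \<Rightarrow> bool" where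
  "is_complex C \<longleftrightarrow>
     (\<forall>x\<in>chains C 0. bd C x = 0) \<and>
     (\<forall>n. \<forall>x\<in>chains C (Suc n). bd C x \<in> chains C n \<and> bd C (bd C x) = 0)"

definition chain_map ::
  "('b, 'r::comm_ring_1) fcomplex \<Rightarrow> ('c, 'r) fcomplex \<Rightarrow> ('b \<Rightarrow> ('c \<Rightarrow>\<^sub>0 'r)) \<Rightarrow> bool" where
  "chain_map C D f \<longleftrightarrow>
     (\<forall>n. \<forall>x\<in>chains C n. lin f x \<in> chains D n \<and> bd D (lin f x) = lin f (bd C x))"

definition tensor_complex ::
  "('b, 'r::comm_ring_1) fcomplex \<Rightarrow> ('c, 'r) fcomplex \<Rightarrow> ('b \<times> 'c, 'r) fcomplex" where
  "tensor_complex C D = \<lparr>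
     gens = gens C \<times> gens D,
     hdeg = (\<lambda>(b, c). hdeg C b + hdeg D c),
     diff = (\<lambda>(b, c). tensor (diff C b) (Poly_Mapping.single c 1)
        + scale ((- 1) ^ hdeg C b) (tensor (Poly_Mapping.single b 1) (diff D c)))\<rparr>"

definition restrict_gens :: "('b, 'r) fcomplex \<Rightarrow> 'b set \<Rightarrow> ('b, 'r) fcomplex" where
  "restrict_gens C A = C\<lparr>gens := gens C \<inter> A\<rparr>"

subsection \<open>Homology\<close>

definition cycles :: "('b, 'r::comm_ring_1) fcomplex \<Rightarrow> nat \<Rightarrow> ('b \<Rightarrow>\<^sub>0 'r) set" where
  "cycles C n = {x \<in> chains C n. bd C x = 0}"

definition boundaries :: "('b, 'r::comm_ring_1) fcomplex \<Rightarrow> nat \<Rightarrow> ('b \<Rightarrow>\<^sub>0 'r) set" where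
  "boundaries C n = bd C ` chains C (Suc n)"

definition hclass :: "('b, 'r::comm_ring_1) fcomplex \<Rightarrow> nat \<Rightarrow> ('b \<Rightarrow>\<^sub>0 'r) \<Rightarrow> ('b \<Rightarrow>\<^sub>0 'r) set" where
  "hclass C n z = (\<lambda>y. z + y) ` boundaries C n"

definition homology :: "('b, 'r::comm_ring_1) fcomplex \<Rightarrow> nat \<Rightarrow> ('b \<Rightarrow>\<^sub>0 'r) set set" where
  "homology C n = hclass C n ` cycles C n"

text \<open>
  Operations on homology classes are given as unions over representatives, as in
  \<^const>\<open>rcoset_mult\<close>; the union consists of a single coset whenever the operation is well defined.
\<close>

definition hadd where
  "hadd C n U V = (\<Union>x\<in>U. \<Union>y\<in>V. hclass C n (x + y))"

definition hscale where
  "hscale C n r U = (\<Union>x\<in>U. hclass C n (scale r x))"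

definition induced ::
  "('c, 'r::comm_ring_1) fcomplex \<Rightarrow> nat \<Rightarrow> ('b \<Rightarrow> ('c \<Rightarrow>\<^sub>0 'r)) \<Rightarrow> ('b \<Rightarrow>\<^sub>0 'r) set \<Rightarrow> ('c \<Rightarrow>\<^sub>0 'r) set" where
  "induced D n f U = (\<Union>x\<in>U. hclass D n (lin f x))"

definition homology_iso ::
  "('b, 'r::comm_ring_1) fcomplex \<Rightarrow> ('c, 'r) fcomplex \<Rightarrow> nat
     \<Rightarrow> (('b \<Rightarrow>\<^sub>0 'r) set \<Rightarrow> ('c \<Rightarrow>\<^sub>0 'r) set) \<Rightarrow> bool" where
  "homology_iso C D n \<theta> \<longleftrightarrow>
     bij_betw \<theta> (homology C n) (homology D n) \<and>
     (\<forall>U\<in>homology C n. \<forall>V\<in>homology C n. \<theta> (hadd C n U V) = hadd D n (\<theta> U) (\<theta> V)) \<and>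
     (\<forall>r. \<forall>U\<in>homology C n. \<theta> (hscale C n r U) = hscale D n r (\<theta> U))"

section \<open>Polynomials and face rings\<close>

text \<open>
  \<^typ>\<open>'m \<Rightarrow>\<^sub>0 nat\<close> is the monoid of exponents and \<^typ>\<open>('m \<Rightarrow>\<^sub>0 nat) \<Rightarrow>\<^sub>0 'k\<close> the polynomial ring over
  \<^typ>\<open>'k\<close> with variables indexed by \<^typ>\<open>'m\<close>; the finite type \<^typ>\<open>'m\<close> plays the role of $[m]$.
\<close>

type_synonym ('m, 'k) mpoly = "('m \<Rightarrow>\<^sub>0 nat) \<Rightarrow>\<^sub>0 'k"

definition mexp :: "'m::finite set \<Rightarrow> ('m \<Rightarrow>\<^sub>0 nat)" where
  "mexp \<sigma> = (\<Sum>i\<in>\<sigma>. Poly_Mapping.single i 1)"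

definition monomial :: "('m \<Rightarrow>\<^sub>0 nat) \<Rightarrow> ('m, 'k::comm_ring_1) mpoly" where
  "monomial a = Poly_Mapping.single a 1"

abbreviation xprod :: "'m::finite set \<Rightarrow> ('m, 'k::comm_ring_1) mpoly" where
  "xprod \<sigma> \<equiv> monomial (mexp \<sigma>)"

abbreviation kx :: "('m, 'k::comm_ring_1) mpoly ring" where
  "kx \<equiv> ring_of_type_algebra"

text \<open>The \<open>\<^bold>k[\<^bold>x]\<close>-algebra structure \<open>x\<^sub>i \<mapsto> 0\<close> of \<open>\<^bold>k\<close>: the constant coefficient.\<close>

definition const_coeff :: "('m, 'k::comm_ring_1) mpoly \<Rightarrow> 'k" where
  "const_coeff p = Poly_Mapping.lookup p 0"

definition complex_of :: "'m set list \<Rightarrow> 'm set set" where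
  "complex_of P = {\<tau>. \<not> (\<exists>\<sigma>\<in>set P. \<sigma> \<subseteq> \<tau>)}"

definition sr_ideal :: "'m::finite set set \<Rightarrow> ('m, 'k::comm_ring_1) mpoly set" where
  "sr_ideal K = genideal kx (xprod ` (- K))"

definition face_ring :: "'m::finite set set \<Rightarrow> ('m, 'k::comm_ring_1) mpoly set ring" where
  "face_ring K = kx Quot (sr_ideal K)"

definition to_face_ring ::
  "'m::finite set set \<Rightarrow> ('m, 'k::comm_ring_1) mpoly \<Rightarrow> ('m, 'k) mpoly set" where
  "to_face_ring K p = sr_ideal K +>\<^bsub>kx\<^esub> p"

lemma mexp_union: "mexp (\<sigma> \<union> \<tau>) = mexp \<sigma> + mexp (\<tau> - \<sigma>)"
  unfolding mexp_def by (metis Diff_disjoint Un_Diff_cancel finite sum.union_disjoint)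

text \<open>
  The Stanley--Reisner ideal is defined by all non-faces; for \<open>K\<^sub>P\<close> the members of \<open>P\<close> suffice.
\<close>

lemma sr_ideal_complex_of:
  "sr_ideal (complex_of P) = (genideal kx (xprod ` set P) :: ('m::finite, 'k::comm_ring_1) mpoly set)"
proof -
  interpret ring "kx :: ('m, 'k) mpoly ring" by (rule ring_from_type_algebra)
  have car: "carrier (kx :: ('m, 'k) mpoly ring) = UNIV"
    by (simp add: ring_of_type_algebra_def)
  let ?J = "genideal kx (xprod ` set P) :: ('m, 'k) mpoly set"
  have J: "ideal ?J kx" by (rule genideal_ideal) (simp add: car)
  have sub: "xprod ` set P \<subseteq> ?J" by (rule genideal_self) (simp add: car)
  have "xprod \<tau> \<in> ?J" if "\<tau> \<notin> complex_of P" for \<tau>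
  proof -
    from that obtain \<sigma> where \<sigma>: "\<sigma> \<in> set P" "\<sigma> \<subseteq> \<tau>" by (auto simp: complex_of_def)
    have "mexp \<tau> = mexp \<sigma> + mexp (\<tau> - \<sigma>)" using \<sigma>(2) by (metis mexp_union sup.absorb2)
    then have "(xprod \<tau> :: ('m, 'k) mpoly) = xprod \<sigma> \<otimes>\<^bsub>kx\<^esub> xprod (\<tau> - \<sigma>)"
      by (simp add: monomial_def mult_single ring_of_type_algebra_def)
    moreover have "xprod \<sigma> \<in> ?J" using \<sigma>(1) sub by blast
    ultimately show ?thesis using ideal.I_r_closed[OF J] car by simp
  qed
  then have "genideal kx (xprod ` (- complex_of P)) \<subseteq> ?J"
    by (intro genideal_minimal J) auto
  moreover have "xprod ` set P \<subseteq> (xprod ` (- complex_of P) :: ('m, 'k) mpoly set)"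
    by (auto simp: complex_of_def)
  then have "?J \<subseteq> genideal kx (xprod ` (- complex_of P))"
    by (metis subset_Idl_subset car subset_UNIV)
  ultimately show ?thesis by (simp add: sr_ideal_def)
qed

section \<open>Free resolutions of the face ring and the algebra structure on Tor\<close>

definition free_resolution ::
  "('b, ('m::finite, 'k::comm_ring_1) mpoly) fcomplex
     \<Rightarrow> (('b \<Rightarrow>\<^sub>0 ('m, 'k) mpoly) \<Rightarrow> ('m, 'k) mpoly set) \<Rightarrow> 'm set set \<Rightarrow> bool" where
  "free_resolution Q \<epsilon> K \<longleftrightarrow>
     is_complex Q \<and>
     (\<forall>x\<in>chains Q 0. \<forall>y\<in>chains Q 0. \<epsilon> (x + y) = \<epsilon> x \<oplus>\<^bsub>face_ring K\<^esub> \<epsilon> y) \<and>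
     (\<forall>p. \<forall>x\<in>chains Q 0. \<epsilon> (scale p x) = to_face_ring K p \<otimes>\<^bsub>face_ring K\<^esub> \<epsilon> x) \<and>
     \<epsilon> ` chains Q 0 = carrier (face_ring K) \<and>
     {x \<in> chains Q 0. \<epsilon> x = \<zero>\<^bsub>face_ring K\<^esub>} = boundaries Q 0 \<and>
     (\<forall>n. cycles Q (Suc n) = boundaries Q (Suc n))"

text \<open>\<open>\<mu> : Q \<otimes> Q \<rightarrow> Q\<close> is a chain map covering the multiplication of the face ring.\<close>

definition covers_multiplication ::
  "('b, ('m::finite, 'k::comm_ring_1) mpoly) fcomplex
     \<Rightarrow> (('b \<Rightarrow>\<^sub>0 ('m, 'k) mpoly) \<Rightarrow> ('m, 'k) mpoly set) \<Rightarrow> 'm set set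
     \<Rightarrow> ('b \<times> 'b \<Rightarrow> ('b \<Rightarrow>\<^sub>0 ('m, 'k) mpoly)) \<Rightarrow> bool" where
  "covers_multiplication Q \<epsilon> K \<mu> \<longleftrightarrow>
     chain_map (tensor_complex Q Q) Q \<mu> \<and>
     (\<forall>x\<in>chains Q 0. \<forall>y\<in>chains Q 0. \<epsilon> (lin \<mu> (tensor x y)) = \<epsilon> x \<otimes>\<^bsub>face_ring K\<^esub> \<epsilon> y)"

text \<open>\<open>f : Q \<rightarrow> Q'\<close> is a chain map covering the identity of the face ring.\<close>

definition covers_identity where
  "covers_identity Q \<epsilon> Q' \<epsilon>' f \<longleftrightarrow>
     chain_map Q Q' f \<and> (\<forall>x\<in>chains Q 0. \<epsilon>' (lin f x) = \<epsilon> x)"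

text \<open>
  Applying \<open>\<otimes>\<^bsub>\<^bold>k[\<^bold>x]\<^esub> \<^bold>k\<close>: a free module keeps its basis, and a map has the constant coefficients of
  its matrix entries as new matrix entries.
\<close>

definition reduce :: "('b \<Rightarrow> ('c \<Rightarrow>\<^sub>0 ('m, 'k::comm_ring_1) mpoly)) \<Rightarrow> 'b \<Rightarrow> ('c \<Rightarrow>\<^sub>0 'k)" where
  "reduce f b = Poly_Mapping.map const_coeff (f b)"

definition reduce_complex :: "('b, ('m, 'k::comm_ring_1) mpoly) fcomplex \<Rightarrow> ('b, 'k) fcomplex" where
  "reduce_complex Q = \<lparr>gens = gens Q, hdeg = hdeg Q, diff = reduce (diff Q)\<rparr>"

text \<open>
  For a free resolution \<open>Q\<close> of the face ring, \<open>Tor\<^sub>n\<close> is \<open>homology (reduce_complex Q) n\<close>. The following is the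
  composite of \<open>H\<^sub>i(Q \<otimes> \<^bold>k) \<times> H\<^sub>j(Q \<otimes> \<^bold>k) \<rightarrow> H\<^bsub>i+j\<^esub>((Q \<otimes> \<^bold>k) \<otimes> (Q \<otimes> \<^bold>k))\<close>, \<open>[z], [w] \<mapsto> [z \<otimes> w]\<close>,
  with the map induced by \<open>\<mu>\<close> and the multiplication of \<open>\<^bold>k\<close>.
\<close>

definition tor_mult ::
  "('b, ('m, 'k::comm_ring_1) mpoly) fcomplex \<Rightarrow> ('b \<times> 'b \<Rightarrow> ('b \<Rightarrow>\<^sub>0 ('m, 'k) mpoly))
     \<Rightarrow> nat \<Rightarrow> nat \<Rightarrow> ('b \<Rightarrow>\<^sub>0 'k) set \<Rightarrow> ('b \<Rightarrow>\<^sub>0 'k) set \<Rightarrow> ('b \<Rightarrow>\<^sub>0 'k) set" where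
  "tor_mult Q \<mu> i j U V =
     (\<Union>z\<in>U. \<Union>w\<in>V. hclass (reduce_complex Q) (i + j) (lin (reduce \<mu>) (tensor z w)))"

subsection \<open>The multigrading\<close>

text \<open>
  \<open>md b\<close> is the \<open>\<nat>\<^sup>m\<close>-degree of the basis element \<open>b\<close>; \<open>x\<close> is homogeneous of \<open>\<nat>\<^sup>m\<close>-degree \<open>a\<close> if
  it is a combination of elements \<open>\<^bold>x\<^sup>e b\<close> with \<open>e + md b = a\<close>.
\<close>

definition homogeneous ::
  "('b \<Rightarrow> ('m \<Rightarrow>\<^sub>0 nat)) \<Rightarrow> ('m \<Rightarrow>\<^sub>0 nat) \<Rightarrow> ('b \<Rightarrow>\<^sub>0 ('m, 'k::comm_ring_1) mpoly) \<Rightarrow> bool" where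
  "homogeneous md a x \<longleftrightarrow>
     (\<forall>b\<in>Poly_Mapping.keys x. \<forall>e\<in>Poly_Mapping.keys (Poly_Mapping.lookup x b). e + md b = a)"

definition multigraded ::
  "('b, ('m::finite, 'k::comm_ring_1) mpoly) fcomplex
     \<Rightarrow> (('b \<Rightarrow>\<^sub>0 ('m, 'k) mpoly) \<Rightarrow> ('m, 'k) mpoly set) \<Rightarrow> 'm set set
     \<Rightarrow> ('b \<Rightarrow> ('m \<Rightarrow>\<^sub>0 nat)) \<Rightarrow> bool" where
  "multigraded Q \<epsilon> K md \<longleftrightarrow>
     (\<forall>b\<in>gens Q. homogeneous md (md b) (diff Q b)) \<and>
     (\<forall>b\<in>gens Q. hdeg Q b = 0 \<longrightarrow>
        (\<exists>p. Poly_Mapping.keys p \<subseteq> {md b} \<and> \<epsilon> (Poly_Mapping.single b 1) = to_face_ring K p))"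

definition homogeneous_map ::
  "('b, ('m, 'k::comm_ring_1) mpoly) fcomplex \<Rightarrow> ('b \<Rightarrow> ('m \<Rightarrow>\<^sub>0 nat)) \<Rightarrow> ('c \<Rightarrow> ('m \<Rightarrow>\<^sub>0 nat))
     \<Rightarrow> ('b \<Rightarrow> ('c \<Rightarrow>\<^sub>0 ('m, 'k) mpoly)) \<Rightarrow> bool" where
  "homogeneous_map Q md md' f \<longleftrightarrow> (\<forall>b\<in>gens Q. homogeneous md' (md b) (f b))"

definition degree_part ::
  "('b, ('m, 'k::comm_ring_1) mpoly) fcomplex \<Rightarrow> ('b \<Rightarrow> ('m \<Rightarrow>\<^sub>0 nat)) \<Rightarrow> ('m \<Rightarrow>\<^sub>0 nat) \<Rightarrow> ('b, 'k) fcomplex" where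
  "degree_part Q md a = restrict_gens (reduce_complex Q) {b. md b = a}"

section \<open>The exterior algebra of a simplicial complement and the Taylor resolution\<close>

text \<open>
  A simplicial complement is a list \<open>P\<close> of subsets. The generator \<open>\<sigma>\<^bsub>k\<^sub>1\<^esub> \<cdots> \<sigma>\<^bsub>k\<^sub>q\<^esub>\<close>
  with \<open>k\<^sub>1 < \<cdots> < k\<^sub>q\<close> is represented by its set \<open>{k\<^sub>1, \<dots>, k\<^sub>q}\<close> of positions in \<open>P\<close>, counted
  from \<open>0\<close>; the generator \<open>1\<close> is the empty set.
\<close>

definition total_set :: "'m set list \<Rightarrow> nat set \<Rightarrow> 'm set" where
  "total_set P u = (\<Union>k\<in>u. P ! k)"

definition del :: "nat \<Rightarrow> nat set \<Rightarrow> nat set" where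
  "del i u = u - {sorted_list_of_set u ! (i - 1)}"

text \<open>
  The product of two generators; the exponent counts the transpositions needed to sort the
  concatenation of the two increasing sequences.
\<close>

definition wedge_gen :: "nat set \<times> nat set \<Rightarrow> (nat set \<Rightarrow>\<^sub>0 'r::comm_ring_1)" where
  "wedge_gen = (\<lambda>(u, v). if u \<inter> v = {}
     then Poly_Mapping.single (u \<union> v) ((- 1) ^ card {(k, l) \<in> u \<times> v. l < k})
     else 0)"

definition wedge :: "(nat set \<Rightarrow>\<^sub>0 'r::comm_ring_1) \<Rightarrow> (nat set \<Rightarrow>\<^sub>0 'r) \<Rightarrow> (nat set \<Rightarrow>\<^sub>0 'r)" where
  "wedge x y = lin wedge_gen (tensor x y)"

definition taylor :: "'m::finite set list \<Rightarrow> (nat set, ('m, 'k::comm_ring_1) mpoly) fcomplex" where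
  "taylor P = \<lparr>
     gens = Pow {..<length P},
     hdeg = card,
     diff = (\<lambda>u. \<Sum>i=1..card u. Poly_Mapping.single (del i u)
        ((- 1) ^ i * xprod (total_set P u - total_set P (del i u))))\<rparr>"

definition taylor_aug ::
  "'m::finite set list \<Rightarrow> (nat set \<Rightarrow>\<^sub>0 ('m, 'k::comm_ring_1) mpoly) \<Rightarrow> ('m, 'k) mpoly set" where
  "taylor_aug P x = to_face_ring (complex_of P) (Poly_Mapping.lookup x {})"

definition Lam :: "'m set list \<Rightarrow> (nat set, 'k::comm_ring_1) fcomplex" where
  "Lam P = \<lparr>
     gens = Pow {..<length P},
     hdeg = card,
     diff = (\<lambda>u. \<Sum>i=1..card u. Poly_Mapping.single (del i u)
        ((- 1) ^ i * (if total_set P u = total_set P (del i u) then 1 else 0)))\<rparr>"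

definition Lam_part :: "'m set list \<Rightarrow> 'm set \<Rightarrow> (nat set, 'k::comm_ring_1) fcomplex" where
  "Lam_part P \<sigma> = restrict_gens (Lam P) {u. total_set P u = \<sigma>}"

text \<open>
  The map \<open>\<phi>\<close>. Subtraction of exponents is the division of monomials (it is exact here, since
  \<open>total_set P (u \<union> v) = total_set P u \<union> total_set P v\<close>).
\<close>

definition phi ::
  "'m::finite set list \<Rightarrow> nat set \<times> nat set \<Rightarrow> (nat set \<Rightarrow>\<^sub>0 ('m, 'k::comm_ring_1) mpoly)" where
  "phi P = (\<lambda>(u, v).
     scale (monomial (mexp (total_set P u) + mexp (total_set P v) - mexp (total_set P (u \<union> v))))
       (wedge_gen (u, v)))"

lemma mexp_eq_0_iff: "mexp \<sigma> = 0 \<longleftrightarrow> \<sigma> = {}"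
proof
  assume *: "mexp \<sigma> = 0"
  show "\<sigma> = {}"
  proof (rule ccontr)
    assume "\<sigma> \<noteq> {}"
    then obtain j where "j \<in> \<sigma>" by blast
    then have "Poly_Mapping.lookup (mexp \<sigma>) j \<noteq> 0"
      by (auto simp: mexp_def lookup_sum lookup_single when_def)
    with * show False by simp
  qed
qed (simp add: mexp_def)

lemma reduce_complex_taylor:
  "reduce_complex (taylor P :: (nat set, ('m::finite, 'k::comm_ring_1) mpoly) fcomplex) = Lam P"
proof -
  have cc_add: "const_coeff (\<Sum>i\<in>I. g i) = (\<Sum>i\<in>I. const_coeff (g i))"
    for I :: "nat set" and g :: "nat \<Rightarrow> ('m, 'k) mpoly"
    by (simp add: const_coeff_def lookup_sum)
  have sign: "(- 1) ^ i * (monomial a :: ('m, 'k) mpoly) = Poly_Mapping.single a ((- 1) ^ i)" for i a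
    by (cases "even i") (simp_all add: monomial_def single_uminus)
  have cc_term: "const_coeff (Poly_Mapping.lookup (Poly_Mapping.single w ((- 1) ^ i * xprod \<tau> :: ('m, 'k) mpoly)) v)
      = Poly_Mapping.lookup (Poly_Mapping.single w ((- 1) ^ i * (if \<tau> = {} then 1 else 0))) v"
    for w v :: "nat set" and i \<tau>
    by (auto simp: sign const_coeff_def lookup_single when_def mexp_eq_0_iff)
  have sub: "total_set P u \<subseteq> total_set P (del i u) \<longleftrightarrow> total_set P u = total_set P (del i u)" for u i
    by (auto simp: total_set_def del_def)
  have "reduce (diff (taylor P :: (nat set, ('m, 'k) mpoly) fcomplex)) u = diff (Lam P) u" for u
  proof (rule poly_mapping_eqI)
    fix v
    have "Poly_Mapping.lookup (reduce (diff (taylor P :: (nat set, ('m, 'k) mpoly) fcomplex)) u) v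
        = const_coeff (Poly_Mapping.lookup (diff (taylor P :: (nat set, ('m, 'k) mpoly) fcomplex) u) v)"
      by (simp add: reduce_def map.rep_eq when_def const_coeff_def)
    also have "\<dots> = Poly_Mapping.lookup (diff (Lam P) u) v"
      by (simp add: taylor_def Lam_def lookup_sum cc_add cc_term sub)
    finally show "Poly_Mapping.lookup (reduce (diff (taylor P :: (nat set, ('m, 'k) mpoly) fcomplex)) u) v
        = Poly_Mapping.lookup (diff (Lam P) u) v" .
  qed
  then show ?thesis
    by (auto simp: reduce_complex_def taylor_def Lam_def)
qed

end

theory Submission
  imports Defs
begin

text \<open>
  Everything in the Taylor resolution is the homogenization of the exterior algebra over \<open>\<^bold>k\<close> whose
  differential \<open>ext_diff\<close> deletes one factor at a time, with alternating signs and without monomials.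
  Indeed a generator \<open>u\<close> has the \<open>\<nat>\<^sup>m\<close>-degree of \<open>\<^bold>x\<close> to the total set of \<open>u\<close>, the differential and the
  product \<open>\<phi>\<close> preserve degrees, and so each of their matrix entries is a sign times the only monomial of
  the right degree. In degree \<open>a\<close> the Taylor complex therefore is the span over \<open>\<^bold>k\<close> of those \<open>u\<close> whose
  total set, read as a squarefree monomial, divides \<open>\<^bold>x\<^sup>a\<close>, with the differential \<open>ext_diff\<close>
  (\<open>diff_homogenize\<close>), and identities can be checked with all variables set to \<open>1\<close>. In this way \<open>\<phi>\<close> is a chain map because \<open>ext_diff\<close> satisfies the
  Leibniz rule (\<open>ext_diff_wedge_gen\<close>); when two generators share a factor, the two terms that delete it
  cancel. Exactness holds because multiplication by a generator \<open>\<sigma>\<^sub>k\<close> contracts the complex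
  (\<open>ext_diff_gen_mult\<close>), and this contraction is available in degree \<open>a\<close> as soon as \<open>\<sigma>\<^sub>k\<close> divides \<open>a\<close>. If no
  \<open>\<sigma>\<^sub>k\<close> divides \<open>a\<close>, only the generator \<open>1\<close> is left in degree \<open>a\<close>, and \<open>\<^bold>x\<^sup>a\<close> survives in the face ring.

  An arbitrary free resolution \<open>Q\<close> is related to the Taylor resolution \<open>R\<close> by the comparison theorem. Chain
  maps out of a complex of free modules, and homotopies between them, are built on the generators by
  induction on the degree, since acyclicity of the target lets one solve for the next value
  (\<open>comparison_map\<close>, \<open>null_homotopy\<close>). A comparison map \<open>f : R \<rightarrow> Q\<close> then is a homotopy equivalence and remains
  one after passing to constant coefficients. Moreover \<open>\<mu> \<circ> (f \<otimes> f)\<close> and \<open>f \<circ> \<phi>\<close> are chain maps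
  \<open>R \<otimes> R \<rightarrow> Q\<close> that agree after augmentation, so they are homotopic, whatever multiplication \<open>\<mu>\<close> has been
  chosen on \<open>Q\<close> (\<open>reduce_multiplication\<close>). Hence the product on \<open>Tor\<close> is induced by the constant part of
  \<open>\<phi>\<close>. The monomial in \<open>\<phi>\<close> is \<open>\<^bold>x\<close> to the intersection of the two total sets, so the constant part is the exterior
  product if they are disjoint, and zero otherwise (\<open>reduce_phi\<close>).

  If \<open>Q\<close> is multigraded, then the homogeneous component of a preimage is a preimage of the homogeneous component,
  which lets one choose \<open>f\<close> homogeneous. Over \<open>\<^bold>k\<close> a homogeneous map sends the generators of each degree
  to combinations of generators of the same degree. An isomorphism on homology that is a direct sum of
  maps is an isomorphism on each summand, and this yields the comparison degree by degree.
\<close>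

section \<open>Linear algebra of free modules\<close>

abbreviation coef :: "('b \<Rightarrow>\<^sub>0 'r::zero) \<Rightarrow> 'b \<Rightarrow> 'r" where "coef \<equiv> Poly_Mapping.lookup"
abbreviation supp :: "('b \<Rightarrow>\<^sub>0 'r::zero) \<Rightarrow> 'b set" where "supp \<equiv> Poly_Mapping.keys"
abbreviation sng :: "'b \<Rightarrow> 'r \<Rightarrow> ('b \<Rightarrow>\<^sub>0 'r::zero)" where "sng \<equiv> Poly_Mapping.single"

lemma coef_scale: "coef (scale r x) b = r * coef x b"
  by (simp add: scale_def map.rep_eq when_def)

lemma scale_simps [simp]:
  "scale 0 x = 0" "scale r 0 = 0" "scale 1 x = x"
  "scale r (scale s x) = scale (r * s) x"
  "scale r (sng b s) = sng b (r * s)"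
  by (auto intro!: poly_mapping_eqI simp: coef_scale lookup_single when_def mult.assoc)

lemma scale_add: "scale r (x + y) = scale r x + scale r y"
  and scale_diff: "scale r (x - y) = scale r x - scale r y"
  and scale_add_left: "scale (r + s) x = scale r x + scale s x"
  and scale_minus: "scale r (- x) = - scale r x"
  and scale_minus_left: "scale (- r) x = - scale r x"
  by (auto intro!: poly_mapping_eqI simp: coef_scale lookup_add lookup_minus algebra_simps)

lemma scale_sum: "scale r (sum g I) = (\<Sum>i\<in>I. scale r (g i))"
  by (auto intro!: poly_mapping_eqI simp: coef_scale lookup_sum sum_distrib_left)

lemma supp_scale: "supp (scale r x) \<subseteq> supp x"
  by (auto simp: in_keys_iff coef_scale)

lemma expansion:
  assumes "finite S" "supp x \<subseteq> S"
  shows "(\<Sum>b\<in>S. sng b (coef x b)) = x"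
proof (rule poly_mapping_eqI)
  fix c
  have "(\<Sum>b\<in>S. coef x b when b = c) = coef x c"
    using assms by (cases "c \<in> S") (auto simp: when_def in_keys_iff)
  then show "coef (\<Sum>b\<in>S. sng b (coef x b)) c = coef x c"
    by (simp add: lookup_sum lookup_single)
qed

lemma lin_superset:
  assumes "finite S" "supp x \<subseteq> S"
  shows "lin f x = (\<Sum>b\<in>S. scale (coef x b) (f b))"
  unfolding lin_def using assms
  by (intro sum.mono_neutral_left) (auto simp: in_keys_iff)

lemma lin_add: "lin f (x + y) = lin f x + lin f y"
proof -
  let ?S = "supp x \<union> supp y"
  have "supp (x + y) \<subseteq> ?S" by (rule keys_add)
  then show ?thesis
    using lin_superset[of ?S "x + y" f] lin_superset[of ?S x f] lin_superset[of ?S y f]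
    by (simp add: lookup_add scale_add_left sum.distrib)
qed

lemma lin_scale: "lin f (scale r x) = scale r (lin f x)"
  using lin_superset[of "supp x" "scale r x" f] supp_scale[of r x]
  by (simp add: lin_def coef_scale scale_sum)

lemma lin_zero [simp]: "lin f 0 = 0"
  by (simp add: lin_def)

lemma lin_sng [simp]: "lin f (sng b r) = scale r (f b)"
  by (simp add: lin_def)

lemma lin_minus: "lin f (- x) = - lin f x"
  using lin_add[of f x "- x"] by (simp add: eq_neg_iff_add_eq_0 add.commute)

lemma lin_diff: "lin f (x - y) = lin f x - lin f y"
  using lin_add[of f "x - y" y] by (simp add: algebra_simps)

lemma lin_sum: "lin f (sum g I) = (\<Sum>i\<in>I. lin f (g i))"
  by (induction I rule: infinite_finite_induct) (simp_all add: lin_add)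

lemma lin_cong: "(\<And>b. b \<in> supp x \<Longrightarrow> f b = g b) \<Longrightarrow> lin f x = lin g x"
  by (simp add: lin_def)

lemma lin_lin: "lin f (lin g x) = lin (\<lambda>b. lin f (g b)) x"
  by (simp add: lin_def[of g] lin_sum lin_scale) (simp add: lin_def)

lemma lin_add_fun: "lin (\<lambda>b. f b + g b) x = lin f x + lin g x"
  by (simp add: lin_def scale_add sum.distrib)

lemma lin_diff_fun: "lin (\<lambda>b. f b - g b) x = lin f x - lin g x"
  by (simp add: lin_def scale_diff sum_subtractf)

lemma lin_scale_fun: "lin (\<lambda>b. scale r (f b)) x = scale r (lin f x)"
  by (simp add: lin_def scale_sum mult.commute)

lemma lin_zero_fun: "lin (\<lambda>b. 0) x = 0"
  by (simp add: lin_def)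

lemma lin_id [simp]: "lin (\<lambda>b. sng b 1) x = x"
  by (simp add: lin_def expansion)

lemma supp_lin: "supp (lin f x) \<subseteq> (\<Union>b\<in>supp x. supp (f b))"
  unfolding lin_def using keys_sum supp_scale by fastforce

text \<open>
  This reduces an identity between additive maps to elements with a single term, where linear extensions
  can be evaluated.
\<close>

lemma terms_induct [case_names zero add sng]:
  fixes x :: "'b \<Rightarrow>\<^sub>0 'r::comm_monoid_add"
  assumes "Q 0" "\<And>x y. Q x \<Longrightarrow> Q y \<Longrightarrow> Q (x + y)" "\<And>b r. b \<in> supp x \<Longrightarrow> Q (sng b r)"
  shows "Q x"
proof -
  have "Q (\<Sum>b\<in>B. sng b (coef x b))" if "finite B" "B \<subseteq> supp x" for B
    using that by (induction B rule: finite_induct) (auto intro: assms)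
  from this[of "supp x"] show ?thesis by (simp add: expansion)
qed

lemma coef_tensor: "coef (tensor x y) (b, c) = coef x b * coef y c"
proof -
  have "(\<Sum>b'\<in>supp x. \<Sum>c'\<in>supp y. coef x b' * coef y c' when (b', c') = (b, c))
      = (\<Sum>b'\<in>supp x. (\<Sum>c'\<in>supp y. coef x b' * coef y c' when c' = c) when b' = b)"
    by (intro sum.cong refl) (auto simp: when_def)
  also have "\<dots> = coef x b * coef y c"
    by (auto simp: when_def in_keys_iff if_distrib[of "\<lambda>t. _ * t"])
  finally show ?thesis by (simp add: tensor_def lookup_sum lookup_single)
qed

lemma tensor_eqI: "(\<And>b c. coef t (b, c) = coef t' (b, c)) \<Longrightarrow> t = t'"
  by (rule poly_mapping_eqI) auto

lemma tensor_simps [simp]: "tensor 0 y = 0" "tensor x 0 = 0"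
    "tensor (sng b r) (sng c s) = sng (b, c) (r * s)"
  by (auto intro!: tensor_eqI simp: coef_tensor lookup_single when_def)

lemma tensor_add_left: "tensor (x + x') y = tensor x y + tensor x' y"
  and tensor_add_right: "tensor x (y + y') = tensor x y + tensor x y'"
  and tensor_diff_left: "tensor (x - x') y = tensor x y - tensor x' y"
  and tensor_diff_right: "tensor x (y - y') = tensor x y - tensor x y'"
  and tensor_scale_left: "tensor (scale r x) y = scale r (tensor x y)"
  and tensor_scale_right: "tensor x (scale r y) = scale r (tensor x y)"
  by (auto intro!: tensor_eqI simp: coef_tensor lookup_add lookup_minus coef_scale algebra_simps)

lemma tensor_sum_left: "tensor (sum g I) y = (\<Sum>i\<in>I. tensor (g i) y)"
  and tensor_sum_right: "tensor x (sum g I) = (\<Sum>i\<in>I. tensor x (g i))"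
  by (auto intro!: tensor_eqI simp: coef_tensor lookup_sum sum_distrib_left sum_distrib_right)

lemma supp_tensor: "supp (tensor x y) \<subseteq> supp x \<times> supp y"
proof
  fix t assume "t \<in> supp (tensor x y)"
  then show "t \<in> supp x \<times> supp y" by (cases t) (auto simp: in_keys_iff coef_tensor)
qed

lemma lin_tensor:
  fixes x :: "'a \<Rightarrow>\<^sub>0 'r::comm_ring_1" and y :: "'b \<Rightarrow>\<^sub>0 'r"
  shows "lin f (tensor x y) = lin (\<lambda>b. lin (\<lambda>c. f (b, c)) y) x"
proof -
  have "tensor x y = lin (\<lambda>b. tensor (sng b 1) y) x"
    by (simp add: lin_def tensor_scale_left[symmetric] tensor_sum_left[symmetric] expansion)
  moreover have "tensor (sng b 1) y = lin (\<lambda>c. sng (b, c) 1) y" for b :: 'a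
    by (rule terms_induct[where x = y]) (simp_all add: tensor_add_right lin_add)
  ultimately show ?thesis by (simp add: lin_lin)
qed

lemma tensor_lin: "tensor (lin f x) (lin g y) = lin (\<lambda>(b, c). tensor (f b) (g c)) (tensor x y)"
proof -
  have "tensor (f b) (lin g y) = lin (\<lambda>c. tensor (f b) (g c)) y" for b
    by (simp add: lin_def tensor_sum_right tensor_scale_right)
  moreover have "tensor (lin f x) (lin g y) = lin (\<lambda>b. tensor (f b) (lin g y)) x"
    by (simp add: lin_def tensor_sum_left tensor_scale_left)
  ultimately show ?thesis by (simp add: lin_tensor)
qed

subsection \<open>Projection to a part of the basis\<close>

definition pick :: "'b set \<Rightarrow> ('b \<Rightarrow>\<^sub>0 'r::zero) \<Rightarrow> ('b \<Rightarrow>\<^sub>0 'r)" where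
  "pick S x = Poly_Mapping.mapp (\<lambda>b r. if b \<in> S then r else 0) x"

lemma coef_pick: "coef (pick S x) b = (if b \<in> S then coef x b else 0)"
  by (auto simp: pick_def lookup_mapp when_def in_keys_iff)

lemma supp_pick: "supp (pick S x) = supp x \<inter> S"
  by (auto simp: in_keys_iff coef_pick split: if_splits)

lemma pick_zero [simp]: "pick S 0 = 0"
  by (rule poly_mapping_eqI) (simp add: coef_pick)

lemma pick_add: "pick S (x + y) = pick S x + pick S y"
  and pick_diff: "pick S (x - y) = pick S x - pick S y"
  by (auto intro!: poly_mapping_eqI simp: coef_pick lookup_add lookup_minus)

lemma pick_scale: "pick S (scale r x) = scale r (pick S x)"
  by (auto intro!: poly_mapping_eqI simp: coef_pick coef_scale)

lemma pick_sng: "pick S (sng b r) = (if b \<in> S then sng b r else 0)"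
  by (auto intro!: poly_mapping_eqI simp: coef_pick lookup_single when_def)

lemma pick_id: "supp x \<subseteq> S \<Longrightarrow> pick S x = x"
  by (rule poly_mapping_eqI) (auto simp: coef_pick in_keys_iff)

lemma pick_none: "supp x \<inter> S = {} \<Longrightarrow> pick S x = 0"
  by (rule poly_mapping_eqI) (auto simp: coef_pick in_keys_iff)

lemma pick_lin:
  assumes "\<And>b. b \<in> supp x \<Longrightarrow> b \<in> S \<Longrightarrow> supp (f b) \<subseteq> T"
    and "\<And>b. b \<in> supp x \<Longrightarrow> b \<notin> S \<Longrightarrow> supp (f b) \<inter> T = {}"
  shows "pick T (lin f x) = lin f (pick S x)"
  by (rule terms_induct[where x = x])
    (use assms in \<open>auto simp: pick_add lin_add pick_sng pick_scale pick_id pick_none\<close>)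

section \<open>Complexes of free modules\<close>

lemma chains_zero [simp]: "0 \<in> chains C n"
  by (simp add: chains_def)

lemma chains_add: "x \<in> chains C n \<Longrightarrow> y \<in> chains C n \<Longrightarrow> x + y \<in> chains C n"
  using keys_add[of x y] by (auto simp: chains_def)

lemma chains_diff: "x \<in> chains C n \<Longrightarrow> y \<in> chains C n \<Longrightarrow> x - y \<in> chains C n"
  using keys_diff[of x y] by (auto simp: chains_def)

lemma chains_scale: "x \<in> chains C n \<Longrightarrow> scale r x \<in> chains C n"
  using supp_scale[of r x] by (auto simp: chains_def)

lemma chains_sum: "(\<And>i. i \<in> I \<Longrightarrow> g i \<in> chains C n) \<Longrightarrow> sum g I \<in> chains C n"
  by (induction I rule: infinite_finite_induct) (auto intro: chains_add)

lemma chains_sng: "b \<in> gens C \<Longrightarrow> hdeg C b = n \<Longrightarrow> sng b r \<in> chains C n"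
  by (auto simp: chains_def)

lemma chainsD: "x \<in> chains C n \<Longrightarrow> b \<in> supp x \<Longrightarrow> b \<in> gens C \<and> hdeg C b = n"
  by (auto simp: chains_def)

lemma chains_pick: "x \<in> chains C n \<Longrightarrow> pick S x \<in> chains C n"
  by (auto simp: chains_def supp_pick)

lemma lin_chains:
  "(\<And>b. b \<in> supp x \<Longrightarrow> f b \<in> chains C n) \<Longrightarrow> lin f x \<in> chains C n"
  unfolding lin_def by (intro chains_sum chains_scale)

lemmas bd_simps = bd_def lin_add lin_diff lin_minus lin_scale

lemma bd_zero [simp]: "bd C 0 = 0"
  by (simp add: bd_def)

text \<open>
  The conditions on generators say that boundaries lie one degree lower, so a generator of degree \<open>0\<close> has zero
  boundary.
\<close>

lemma is_complex_iff:
  "is_complex C \<longleftrightarrow> (\<forall>b\<in>gens C.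
     supp (diff C b) \<subseteq> {c \<in> gens C. Suc (hdeg C c) = hdeg C b} \<and> bd C (diff C b) = 0)"
    (is "_ \<longleftrightarrow> ?rhs")
proof
  assume C: "is_complex C"
  show ?rhs
  proof
    fix b assume b: "b \<in> gens C"
    have s: "sng b 1 \<in> chains C (hdeg C b)" using b by (simp add: chains_sng)
    show "supp (diff C b) \<subseteq> {c \<in> gens C. Suc (hdeg C c) = hdeg C b} \<and> bd C (diff C b) = 0"
    proof (cases "hdeg C b")
      case 0
      then have "bd C (sng b 1) = 0" using C s by (auto simp: is_complex_def)
      then show ?thesis by (simp add: bd_def)
    next
      case (Suc n)
      then have "bd C (sng b 1) \<in> chains C n \<and> bd C (bd C (sng b 1)) = 0"
        using C s by (auto simp: is_complex_def)
      then show ?thesis using Suc by (auto simp: bd_def chains_def)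
    qed
  qed
next
  assume r: ?rhs
  have 0: "bd C x = 0" if "x \<in> chains C 0" for x
  proof -
    have "diff C b = 0" if "b \<in> supp x" for b
      using chainsD[OF \<open>x \<in> chains C 0\<close> that] r by (auto simp flip: keys_eq_empty)
    then have "bd C x = lin (\<lambda>b. 0) x" unfolding bd_def by (intro lin_cong)
    then show ?thesis by (simp add: lin_zero_fun)
  qed
  have S: "bd C x \<in> chains C n \<and> bd C (bd C x) = 0" if x: "x \<in> chains C (Suc n)" for n x
  proof
    show "bd C x \<in> chains C n"
      unfolding bd_def by (rule lin_chains) (use chainsD[OF x] r in \<open>fastforce simp: chains_def\<close>)
    have "bd C (bd C x) = lin (\<lambda>b. bd C (diff C b)) x" by (simp add: bd_def lin_lin)
    also have "\<dots> = lin (\<lambda>b. 0) x" by (rule lin_cong) (use chainsD[OF x] r in auto)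
    finally show "bd C (bd C x) = 0" by (simp add: lin_zero_fun)
  qed
  show "is_complex C" unfolding is_complex_def using 0 S by blast
qed

lemma bd_chains_0: "is_complex C \<Longrightarrow> x \<in> chains C 0 \<Longrightarrow> bd C x = 0"
  by (simp add: is_complex_def)

lemma chain_map_iff:
  "chain_map C D f \<longleftrightarrow> (\<forall>b\<in>gens C. f b \<in> chains D (hdeg C b) \<and> bd D (f b) = lin f (diff C b))"
    (is "_ \<longleftrightarrow> ?rhs")
proof
  assume f: "chain_map C D f"
  show ?rhs
  proof
    fix b assume b: "b \<in> gens C"
    then have "sng b 1 \<in> chains C (hdeg C b)" by (simp add: chains_sng)
    then have "lin f (sng b 1) \<in> chains D (hdeg C b) \<and> bd D (lin f (sng b 1)) = lin f (bd C (sng b 1))"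
      using f unfolding chain_map_def by blast
    then show "f b \<in> chains D (hdeg C b) \<and> bd D (f b) = lin f (diff C b)"
      by (simp add: bd_def)
  qed
next
  assume r: ?rhs
  show "chain_map C D f" unfolding chain_map_def
  proof (intro allI ballI conjI)
    fix n x assume x: "x \<in> chains C n"
    show "lin f x \<in> chains D n" by (rule lin_chains) (use chainsD[OF x] r in auto)
    show "bd D (lin f x) = lin f (bd C x)"
      unfolding bd_def lin_lin by (rule lin_cong) (use chainsD[OF x] r in \<open>auto simp: bd_def\<close>)
  qed
qed

lemma chain_map_chains: "chain_map C D f \<Longrightarrow> x \<in> chains C n \<Longrightarrow> lin f x \<in> chains D n"
  and chain_map_bd: "chain_map C D f \<Longrightarrow> x \<in> chains C n \<Longrightarrow> bd D (lin f x) = lin f (bd C x)"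
  by (auto simp: chain_map_def)

lemma chain_map_comp:
  assumes "chain_map C D f" "chain_map D E g"
  shows "chain_map C E (\<lambda>b. lin g (f b))"
  unfolding chain_map_def lin_lin[symmetric]
  using assms by (metis chain_map_bd chain_map_chains)

lemma chain_map_id: "chain_map C C (\<lambda>b. sng b 1)"
  by (simp add: chain_map_def)

lemma chain_map_diff:
  assumes "chain_map C D f" "chain_map C D g"
  shows "chain_map C D (\<lambda>b. f b - g b)"
  using assms by (auto simp: chain_map_iff chains_diff bd_def lin_diff lin_diff_fun)

subsection \<open>Homology\<close>

lemma boundaries_zero [simp]: "0 \<in> boundaries C n"
  unfolding boundaries_def by (rule image_eqI[of _ _ 0]) auto

lemma boundaries_add: "x \<in> boundaries C n \<Longrightarrow> y \<in> boundaries C n \<Longrightarrow> x + y \<in> boundaries C n"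
  unfolding boundaries_def by (auto simp: bd_def simp flip: lin_add intro: chains_add)

lemma boundaries_scale: "x \<in> boundaries C n \<Longrightarrow> scale r x \<in> boundaries C n"
  unfolding boundaries_def by (auto simp: bd_def simp flip: lin_scale intro: chains_scale)

lemma boundaries_minus: "x \<in> boundaries C n \<Longrightarrow> - x \<in> boundaries C n"
  using boundaries_scale[of x C n "- 1"] by (simp add: scale_minus_left)

lemma boundaries_diff: "x \<in> boundaries C n \<Longrightarrow> y \<in> boundaries C n \<Longrightarrow> x - y \<in> boundaries C n"
  using boundaries_add[of x C n "- y"] boundaries_minus[of y C n] by simp

lemma cycles_add: "x \<in> cycles C n \<Longrightarrow> y \<in> cycles C n \<Longrightarrow> x + y \<in> cycles C n"
  by (simp add: cycles_def chains_add bd_simps)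

lemma boundaries_cycles: "is_complex C \<Longrightarrow> boundaries C n \<subseteq> cycles C n"
  by (auto simp: boundaries_def cycles_def is_complex_def)

lemma mem_hclass: "y \<in> hclass C n x \<longleftrightarrow> y - x \<in> boundaries C n"
  by (auto simp: hclass_def image_iff algebra_simps)
    (metis diff_add_cancel)

lemma hclass_eqI:
  assumes "x - y \<in> boundaries C n"
  shows "hclass C n x = hclass C n y"
proof (rule Set.set_eqI)
  fix z
  show "z \<in> hclass C n x \<longleftrightarrow> z \<in> hclass C n y"
    using boundaries_add[of "z - x" C n "x - y"] boundaries_diff[of "z - y" C n "x - y"] assms
    by (auto simp: mem_hclass)
qed

lemma hclass_eq_iff: "hclass C n x = hclass C n y \<longleftrightarrow> x - y \<in> boundaries C n"
proof
  assume "hclass C n x = hclass C n y"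
  moreover have "x \<in> hclass C n x" by (simp add: mem_hclass)
  ultimately show "x - y \<in> boundaries C n" by (simp add: mem_hclass)
qed (rule hclass_eqI)

text \<open>An operation given as a union over representatives is computed by any representative.\<close>

lemma UN_hclass:
  assumes "\<And>y. y - x \<in> boundaries C n \<Longrightarrow> F y = F x"
  shows "(\<Union>y\<in>hclass C n x. F y) = F x"
proof -
  have "F y = F x" if "y \<in> hclass C n x" for y
    by (rule assms) (use that in \<open>simp add: mem_hclass\<close>)
  moreover have "x \<in> hclass C n x" by (simp add: mem_hclass)
  ultimately show ?thesis by blast
qed

lemma hadd_hclass: "hadd C n (hclass C n x) (hclass C n y) = hclass C n (x + y)"
proof -
  have "(\<Union>y'\<in>hclass C n y. hclass C n (x' + y')) = hclass C n (x' + y)" for x'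
    by (rule UN_hclass) (rule hclass_eqI, simp)
  then show ?thesis
    unfolding hadd_def by (simp, intro UN_hclass) (rule hclass_eqI, simp)
qed

lemma hscale_hclass: "hscale C n r (hclass C n x) = hclass C n (scale r x)"
  unfolding hscale_def
  by (rule UN_hclass, rule hclass_eqI) (simp add: boundaries_scale flip: scale_diff)

lemma induced_hclass:
  assumes "\<And>y. y \<in> boundaries C n \<Longrightarrow> lin f y \<in> boundaries D n"
  shows "induced D n f (hclass C n x) = hclass D n (lin f x)"
  unfolding induced_def
  by (rule UN_hclass, rule hclass_eqI) (simp add: assms flip: lin_diff)

lemma chain_map_cycles:
  "is_complex C \<Longrightarrow> chain_map C D f \<Longrightarrow> x \<in> cycles C n \<Longrightarrow> lin f x \<in> cycles D n"
  by (auto simp: cycles_def chain_map_def)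

lemma chain_map_boundaries:
  "chain_map C D f \<Longrightarrow> x \<in> boundaries C n \<Longrightarrow> lin f x \<in> boundaries D n"
  unfolding boundaries_def by (force simp: chain_map_def)

lemma homology_isoI:
  assumes cyc: "\<And>z. z \<in> cycles C n \<Longrightarrow> lin f z \<in> cycles D n"
    and bou: "\<And>z. z \<in> boundaries C n \<Longrightarrow> lin f z \<in> boundaries D n"
    and inj: "\<And>z. z \<in> cycles C n \<Longrightarrow> lin f z \<in> boundaries D n \<Longrightarrow> z \<in> boundaries C n"
    and sur: "\<And>w. w \<in> cycles D n \<Longrightarrow> \<exists>z\<in>cycles C n. w - lin f z \<in> boundaries D n"
  shows "homology_iso C D n (induced D n f)"
proof -
  have ind: "induced D n f (hclass C n z) = hclass D n (lin f z)" for z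
    by (rule induced_hclass) (rule bou)
  have cdiff: "z - z' \<in> cycles C n" if "z \<in> cycles C n" "z' \<in> cycles C n" for z z'
    using that by (simp add: cycles_def chains_diff bd_simps)
  have "inj_on (induced D n f) (homology C n)"
    unfolding homology_def inj_on_def
    by (auto simp: ind hclass_eq_iff simp flip: lin_diff intro: inj cdiff)
  moreover have "induced D n f ` homology C n = homology D n"
  proof
    show "induced D n f ` homology C n \<subseteq> homology D n"
      using cyc by (auto simp: homology_def ind)
    show "homology D n \<subseteq> induced D n f ` homology C n"
    proof
      fix W assume "W \<in> homology D n"
      then obtain w where w: "w \<in> cycles D n" "W = hclass D n w" by (auto simp: homology_def)
      obtain z where z: "z \<in> cycles C n" "w - lin f z \<in> boundaries D n" using sur[OF w(1)] by blast
      then have "W = induced D n f (hclass C n z)" using w by (simp add: ind hclass_eqI)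
      then show "W \<in> induced D n f ` homology C n" using z(1) by (auto simp: homology_def)
    qed
  qed
  ultimately show ?thesis
    unfolding homology_iso_def bij_betw_def
    by (auto simp: homology_def ind hadd_hclass hscale_hclass lin_add lin_scale)
qed

subsection \<open>Tensor products of complexes\<close>

lemma tensor_complex_sel [simp]:
  "gens (tensor_complex C D) = gens C \<times> gens D"
  "hdeg (tensor_complex C D) (b, c) = hdeg C b + hdeg D c"
  "diff (tensor_complex C D) (b, c) = tensor (diff C b) (sng c 1)
     + scale ((- 1) ^ hdeg C b) (tensor (sng b 1) (diff D c))"
  by (simp_all add: tensor_complex_def)

lemma tensor_chains: "x \<in> chains C i \<Longrightarrow> y \<in> chains D j \<Longrightarrow> tensor x y \<in> chains (tensor_complex C D) (i + j)"
  using supp_tensor[of x y] by (fastforce simp: chains_def)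

lemma bd_tensor:
  assumes x: "x \<in> chains C i"
  shows "bd (tensor_complex C D) (tensor x y)
    = tensor (bd C x) y + scale ((- 1) ^ i) (tensor x (bd D y))"
proof -
  have "bd (tensor_complex C D) (tensor x y)
      = lin (\<lambda>b. lin (\<lambda>c. tensor (diff C b) (sng c 1)
          + scale ((- 1) ^ i) (tensor (sng b 1) (diff D c))) y) x"
    unfolding bd_def lin_tensor using chainsD[OF x] by (intro lin_cong) auto
  also have "\<dots> = lin (\<lambda>(b, c). tensor (diff C b) (sng c 1)) (tensor x y)
       + scale ((- 1) ^ i) (lin (\<lambda>(b, c). tensor (sng b 1) (diff D c)) (tensor x y))"
    by (simp add: lin_tensor lin_add_fun lin_scale_fun)
  also have "\<dots> = tensor (bd C x) y + scale ((- 1) ^ i) (tensor x (bd D y))"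
    by (simp flip: tensor_lin add: bd_def)
  finally show ?thesis .
qed

lemma is_complex_tensor:
  assumes C: "is_complex C" and D: "is_complex D"
  shows "is_complex (tensor_complex C D)"
  unfolding is_complex_iff
proof (rule ballI)
  fix t assume "t \<in> gens (tensor_complex C D)"
  then obtain b c where t: "t = (b, c)" and b: "b \<in> gens C" and c: "c \<in> gens D" by auto
  have db: "supp (diff C b) \<subseteq> {c \<in> gens C. Suc (hdeg C c) = hdeg C b}" "bd C (diff C b) = 0"
    using C b by (auto simp: is_complex_iff)
  have dc: "supp (diff D c) \<subseteq> {b \<in> gens D. Suc (hdeg D b) = hdeg D c}" "bd D (diff D c) = 0"
    using D c by (auto simp: is_complex_iff)
  let ?T = "tensor_complex C D"
  have "supp (diff ?T t) \<subseteq> supp (diff C b) \<times> {c} \<union> {b} \<times> supp (diff D c)"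
    unfolding t tensor_complex_sel
    using keys_add supp_scale supp_tensor[of "diff C b" "sng c 1"] supp_tensor[of "sng b 1" "diff D c"]
    by fastforce
  also have "\<dots> \<subseteq> {s \<in> gens ?T. Suc (hdeg ?T s) = hdeg ?T t}"
    using db dc b c by (auto simp: t)
  finally have 1: "supp (diff ?T t) \<subseteq> {s \<in> gens ?T. Suc (hdeg ?T s) = hdeg ?T t}" .
  have 2: "bd ?T (tensor (diff C b) (sng c 1))
      = - scale ((- 1) ^ hdeg C b) (tensor (diff C b) (diff D c))"
  proof (cases "hdeg C b")
    case 0
    then have "diff C b = 0" using db by (auto simp flip: keys_eq_empty)
    then show ?thesis by simp
  next
    case (Suc n)
    then have "diff C b \<in> chains C n" using db by (auto simp: chains_def)
    from bd_tensor[OF this, of D "sng c 1"] show ?thesis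
      by (simp add: db Suc scale_minus_left) (simp add: bd_def)
  qed
  have 3: "bd ?T (tensor (sng b 1) (diff D c)) = tensor (diff C b) (diff D c)"
    using bd_tensor[OF chains_sng[OF b refl, of 1], of D "diff D c"] by (simp add: dc)
      (simp add: bd_def)
  have "bd ?T (diff ?T t) = bd ?T (tensor (diff C b) (sng c 1))
      + scale ((- 1) ^ hdeg C b) (bd ?T (tensor (sng b 1) (diff D c)))"
    by (simp add: t bd_simps)
  then have "bd ?T (diff ?T t) = 0" by (simp add: 2 3)
  with 1 show "supp (diff ?T t) \<subseteq> {s \<in> gens ?T. Suc (hdeg ?T s) = hdeg ?T t} \<and> bd ?T (diff ?T t) = 0"
    by simp
qed

lemma chain_map_tensor:
  assumes f: "chain_map C C' f" and g: "chain_map D D' g"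
  shows "chain_map (tensor_complex C D) (tensor_complex C' D') (\<lambda>(b, c). tensor (f b) (g c))"
  unfolding chain_map_iff
proof (clarsimp simp del: One_nat_def, intro conjI)
  fix b c assume b: "b \<in> gens C" and c: "c \<in> gens D"
  have f': "f b \<in> chains C' (hdeg C b)" "bd C' (f b) = lin f (diff C b)" 
   and g': "g c \<in> chains D' (hdeg D c)" "bd D' (g c) = lin g (diff D c)"
    using f g b c by (auto simp: chain_map_iff)
  show "tensor (f b) (g c) \<in> chains (tensor_complex C' D') (hdeg C b + hdeg D c)"
    by (intro tensor_chains f' g')
  have "lin (\<lambda>(b, c). tensor (f b) (g c)) (tensor (diff C b) (sng c 1)) = tensor (bd C' (f b)) (g c)"
    and "lin (\<lambda>(b, c). tensor (f b) (g c)) (tensor (sng b 1) (diff D c)) = tensor (f b) (bd D' (g c))"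
    by (simp_all flip: tensor_lin add: f' g')
  then show "bd (tensor_complex C' D') (tensor (f b) (g c)) = lin (\<lambda>(b, c). tensor (f b) (g c))
      (tensor (diff C b) (sng c 1) + scale ((- 1) ^ hdeg C b) (tensor (sng b 1) (diff D c)))"
    by (simp add: bd_tensor[OF f'(1)] lin_add lin_scale)
qed

text \<open>
  By the Leibniz rule \<open>bd_tensor\<close>, the class of \<open>z \<otimes> w\<close> depends only on the classes of the cycles \<open>z\<close> and
  \<open>w\<close>.
\<close>

lemma tensor_cycles:
  "x \<in> cycles C i \<Longrightarrow> y \<in> cycles D j \<Longrightarrow> tensor x y \<in> cycles (tensor_complex C D) (i + j)"
  by (auto simp: cycles_def tensor_chains bd_tensor)

lemma tensor_boundaries_left:
  assumes "x \<in> boundaries C i" "y \<in> cycles D j"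
  shows "tensor x y \<in> boundaries (tensor_complex C D) (i + j)"
proof -
  obtain w where w: "w \<in> chains C (Suc i)" "x = bd C w" using assms(1) by (auto simp: boundaries_def)
  then have "bd (tensor_complex C D) (tensor w y) = tensor x y"
    using assms(2) by (simp add: bd_tensor[OF w(1)] cycles_def)
  moreover have "tensor w y \<in> chains (tensor_complex C D) (Suc (i + j))"
    using tensor_chains[OF w(1)] assms(2) by (fastforce simp: cycles_def)
  ultimately show ?thesis unfolding boundaries_def by (metis imageI)
qed

lemma tensor_boundaries_right:
  assumes "x \<in> cycles C i" "y \<in> boundaries D j"
  shows "tensor x y \<in> boundaries (tensor_complex C D) (i + j)"
proof -
  obtain w where w: "w \<in> chains D (Suc j)" "y = bd D w" using assms(2) by (auto simp: boundaries_def)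
  have x: "x \<in> chains C i" "bd C x = 0" using assms(1) by (auto simp: cycles_def)
  have "bd (tensor_complex C D) (scale ((- 1) ^ i) (tensor x w)) = tensor x y"
    \<comment> \<open>The sign compensates the one in the Leibniz rule.\<close>
    using bd_tensor[OF x(1), of D w] x(2) w(2)
    by (simp add: bd_def lin_scale flip: power_mult_distrib)
  moreover have "scale ((- 1) ^ i) (tensor x w) \<in> chains (tensor_complex C D) (Suc (i + j))"
    using tensor_chains[OF x(1) w(1)] by (simp add: chains_scale)
  ultimately show ?thesis unfolding boundaries_def by (metis imageI)
qed

subsection \<open>Direct summands\<close>

lemma restrict_gens_sel [simp]:
  "chains (restrict_gens C S) n = {x \<in> chains C n. supp x \<subseteq> S}"
  "bd (restrict_gens C S) = bd C"
  by (auto simp: restrict_gens_def chains_def bd_def)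

lemma cycles_restrict: "cycles (restrict_gens C S) n = {x \<in> cycles C n. supp x \<subseteq> S}"
  by (auto simp: cycles_def)

lemma boundaries_restrict_subset: "boundaries (restrict_gens C S) n \<subseteq> boundaries C n"
  by (auto simp: boundaries_def)

text \<open>
  The map \<open>f\<close> is block diagonal for the splittings of the generators \<open>G\<close> into \<open>S\<close> and its complement, and of the
  target into \<open>T\<close> and its complement. For a differential and \<open>S = T\<close> this says that \<open>S\<close> spans a direct summand of
  the complex.
\<close>

definition separates :: "'b set \<Rightarrow> 'b set \<Rightarrow> 'c set \<Rightarrow> ('b \<Rightarrow> ('c \<Rightarrow>\<^sub>0 'r::comm_ring_1)) \<Rightarrow> bool" where
  "separates G S T f \<longleftrightarrow> (\<forall>b\<in>G. if b \<in> S then supp (f b) \<subseteq> T else supp (f b) \<inter> T = {})"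

lemma pick_separates:
  "separates (gens C) S T f \<Longrightarrow> x \<in> chains C n \<Longrightarrow> pick T (lin f x) = lin f (pick S x)"
  by (rule pick_lin) (auto simp: separates_def chains_def split: if_splits)

lemma boundaries_restrict:
  assumes "separates (gens C) S S (diff C)"
  shows "boundaries (restrict_gens C S) n = {x \<in> boundaries C n. supp x \<subseteq> S}"
proof (intro equalityI subsetI)
  fix x assume "x \<in> boundaries (restrict_gens C S) n"
  then obtain w where w: "w \<in> chains C (Suc n)" "supp w \<subseteq> S" "x = bd C w"
    by (auto simp: boundaries_def)
  have "pick S x = x" using pick_separates[OF assms w(1)] w by (simp add: bd_def pick_id)
  then have "supp x \<subseteq> S" using supp_pick[of S x] by auto
  then show "x \<in> {x \<in> boundaries C n. supp x \<subseteq> S}" using w by (auto simp: boundaries_def)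
next
  fix x assume x: "x \<in> {x \<in> boundaries C n. supp x \<subseteq> S}"
  then obtain w where w: "w \<in> chains C (Suc n)" "x = bd C w" by (auto simp: boundaries_def)
  have "bd C (pick S w) = pick S x" using pick_separates[OF assms w(1)] w by (simp add: bd_def)
  also have "\<dots> = x" using x by (simp add: pick_id)
  finally have "x = bd C (pick S w)" ..
  then show "x \<in> boundaries (restrict_gens C S) n"
    using w(1) by (auto simp: boundaries_def chains_pick supp_pick)
qed

text \<open>
  If a block diagonal chain map is bijective on homology, so are its blocks: a boundary or a cycle of the
  whole complex that witnesses injectivity or surjectivity can be projected to the summand.
\<close>

lemma homology_iso_restrict:
  assumes complex: "is_complex C" and cm: "chain_map C D f"
    and inj: "\<And>z. z \<in> cycles C n \<Longrightarrow> lin f z \<in> boundaries D n \<Longrightarrow> z \<in> boundaries C n"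
    and sur: "\<And>w. w \<in> cycles D n \<Longrightarrow> \<exists>z\<in>cycles C n. w - lin f z \<in> boundaries D n"
    and C: "separates (gens C) S S (diff C)" and D: "separates (gens D) T T (diff D)"
    and f: "separates (gens C) S T f"
  shows "homology_iso (restrict_gens C S) (restrict_gens D T) n (induced (restrict_gens D T) n f)"
proof (rule homology_isoI)
  have supp_f: "supp (lin f z) \<subseteq> T" if "z \<in> chains C n" "supp z \<subseteq> S" for z
    using supp_lin[of f z] that f by (fastforce simp: separates_def chains_def)
  show "lin f z \<in> cycles (restrict_gens D T) n" if "z \<in> cycles (restrict_gens C S) n" for z
    using that chain_map_cycles[OF complex cm] supp_f
    by (auto simp: cycles_restrict) (auto simp: cycles_def)
  show "lin f z \<in> boundaries (restrict_gens D T) n" if "z \<in> boundaries (restrict_gens C S) n" for z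
    using that chain_map_boundaries[OF cm] supp_f boundaries_cycles[OF complex, of n]
    by (auto simp: boundaries_restrict[OF C] boundaries_restrict[OF D]) (auto simp: cycles_def)
  show "z \<in> boundaries (restrict_gens C S) n"
    if "z \<in> cycles (restrict_gens C S) n" "lin f z \<in> boundaries (restrict_gens D T) n" for z
    using that inj by (auto simp: cycles_restrict boundaries_restrict[OF C] boundaries_restrict[OF D])
  show "\<exists>z\<in>cycles (restrict_gens C S) n. w - lin f z \<in> boundaries (restrict_gens D T) n"
    if w: "w \<in> cycles (restrict_gens D T) n" for w
  proof -
    have wT: "supp w \<subseteq> T" and "w \<in> cycles D n" using w by (auto simp: cycles_restrict)
    then obtain z where z: "z \<in> cycles C n" "w - lin f z \<in> boundaries D n" using sur by blast
    then obtain v where v: "v \<in> chains D (Suc n)" "w - lin f z = bd D v" by (auto simp: boundaries_def)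
    have zc: "z \<in> chains C n" "bd C z = 0" using z(1) by (auto simp: cycles_def)
    have "w - lin f (pick S z) = pick T (w - lin f z)"
      using pick_separates[OF f zc(1)] wT by (simp add: pick_diff pick_id)
    also have "\<dots> = bd D (pick T v)"
      using pick_separates[OF D v(1)] v(2) by (simp add: bd_def)
    finally have "w - lin f (pick S z) \<in> boundaries (restrict_gens D T) n"
      using v(1) by (auto simp: boundaries_def chains_pick supp_pick)
    moreover have "bd C (pick S z) = 0"
      using pick_separates[OF C zc(1)] zc(2) by (simp add: bd_def)
    then have "pick S z \<in> cycles (restrict_gens C S) n"
      using zc(1) by (auto simp: cycles_restrict cycles_def chains_pick supp_pick)
    ultimately show ?thesis by blast
  qed
qed

section \<open>Chain maps and homotopies out of a complex of free modules\<close>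

text \<open>
  Both halves of the comparison theorem choose values on generators subject to a condition \<open>\<Phi>\<close> on the value at
  \<open>b\<close> and on the image of the boundary of \<open>b\<close>. The latter only depends on values in lower degree, so the
  choices can be made by recursion on the degree.
\<close>

lemma degreewise_choice:
  fixes C :: "('b, 'r::comm_ring_1) fcomplex" and \<Phi> :: "'b \<Rightarrow> ('c \<Rightarrow>\<^sub>0 'r) \<Rightarrow> ('c \<Rightarrow>\<^sub>0 'r) \<Rightarrow> bool"
  assumes C: "is_complex C"
    and step: "\<And>f b. b \<in> gens C \<Longrightarrow>
        (\<And>c. c \<in> gens C \<Longrightarrow> hdeg C c < hdeg C b \<Longrightarrow> \<Phi> c (lin f (diff C c)) (f c)) \<Longrightarrow>
        \<exists>y. \<Phi> b (lin f (diff C b)) y"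
  shows "\<exists>f. \<forall>b\<in>gens C. \<Phi> b (lin f (diff C b)) (f b)"
proof -
  let ?P = "\<lambda>(f :: 'b \<Rightarrow> ('c \<Rightarrow>\<^sub>0 'r)) b y. b \<in> gens C \<longrightarrow> \<Phi> b (lin f (diff C b)) y"
  have "\<exists>f. \<forall>b. ?P f b (f b)"
  proof (rule dependent_wf_choice[of "measure (hdeg C)"])
    fix f g :: "'b \<Rightarrow> ('c \<Rightarrow>\<^sub>0 'r)" and b y assume eq: "\<And>c. (c, b) \<in> measure (hdeg C) \<Longrightarrow> f c = g c"
    have "lin f (diff C b) = lin g (diff C b)" if "b \<in> gens C"
      by (rule lin_cong, rule eq) (use C that in \<open>fastforce simp: is_complex_iff\<close>)
    then show "?P f b y = ?P g b y" by simp
  next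
    fix b and f :: "'b \<Rightarrow> ('c \<Rightarrow>\<^sub>0 'r)" assume IH: "\<And>c. (c, b) \<in> measure (hdeg C) \<Longrightarrow> ?P f c (f c)"
    show "\<exists>y. ?P f b y"
    proof (cases "b \<in> gens C")
      case True
      from step[OF this] IH show ?thesis by auto
    qed simp
  qed simp
  then show ?thesis by blast
qed

text \<open>
  The homotopy part of the comparison theorem. If \<open>s\<close> is constructed below the degree of \<open>b\<close>, then
  \<open>h b - s (d b)\<close> is a cycle, since \<open>d s d b = h d b - s d d b = d h b\<close>. By acyclicity it is the boundary
  of some element, which is taken as \<open>s b\<close>. In degree \<open>0\<close> there is no acyclicity, and the hypothesis
  on \<open>h b\<close> takes its place.
\<close>

lemma null_homotopy:
  assumes C: "is_complex C" and h: "chain_map C D h"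
    and acyclic: "\<And>n. cycles D (Suc n) = boundaries D (Suc n)"
    and zero: "\<And>b. b \<in> gens C \<Longrightarrow> hdeg C b = 0 \<Longrightarrow> h b \<in> boundaries D 0"
  shows "\<exists>s. \<forall>b\<in>gens C. s b \<in> chains D (Suc (hdeg C b)) \<and> h b = bd D (s b) + lin s (diff C b)"
proof -
  let ?\<Phi> = "\<lambda>b v y. y \<in> chains D (Suc (hdeg C b)) \<and> bd D y = h b - v"
  have "\<exists>s. \<forall>b\<in>gens C. ?\<Phi> b (lin s (diff C b)) (s b)"
  proof (rule degreewise_choice[OF C])
    fix s b assume b: "b \<in> gens C"
      and IH: "\<And>c. c \<in> gens C \<Longrightarrow> hdeg C c < hdeg C b \<Longrightarrow> ?\<Phi> c (lin s (diff C c)) (s c)"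
    have db: "\<And>c. c \<in> supp (diff C b) \<Longrightarrow> c \<in> gens C \<and> Suc (hdeg C c) = hdeg C b"
      and dd: "bd C (diff C b) = 0"
      using C b by (auto simp: is_complex_iff)
    have hb: "h b \<in> chains D (hdeg C b)" "bd D (h b) = lin h (diff C b)"
      using h b by (auto simp: chain_map_iff)
    have "h b - lin s (diff C b) \<in> boundaries D (hdeg C b)"
    proof (cases "hdeg C b")
      case 0
      then have "diff C b = 0" using db by (auto simp flip: keys_eq_empty)
      then show ?thesis using zero[OF b 0] 0 by simp
    next
      case (Suc n)
      have "bd D (lin s (diff C b)) = lin (\<lambda>c. bd D (s c)) (diff C b)"
        by (simp add: bd_def lin_lin)
      also have "\<dots> = lin (\<lambda>c. h c - lin s (diff C c)) (diff C b)"
        using IH db by (intro lin_cong) (metis lessI)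
      also have "\<dots> = lin h (diff C b) - lin s (bd C (diff C b))"
        by (simp add: lin_diff_fun bd_def lin_lin)
      finally have "bd D (h b - lin s (diff C b)) = 0"
        using hb dd by (simp add: bd_def lin_diff)
      moreover have "lin s (diff C b) \<in> chains D (Suc n)"
        by (rule lin_chains) (use IH db Suc in fastforce)
      ultimately have "h b - lin s (diff C b) \<in> cycles D (Suc n)"
        using hb(1) Suc by (simp add: cycles_def chains_diff)
      then show ?thesis using acyclic Suc by simp
    qed
    then show "\<exists>y. ?\<Phi> b (lin s (diff C b)) y" by (auto simp: boundaries_def)
  qed
  then show ?thesis by (auto simp: algebra_simps)
qed

section \<open>The face ring and augmentations\<close>

lemma kx_sel [simp]:
  "carrier kx = UNIV" "p \<otimes>\<^bsub>kx\<^esub> q = p * q" "p \<oplus>\<^bsub>kx\<^esub> q = p + q" "\<one>\<^bsub>kx\<^esub> = 1" "\<zero>\<^bsub>kx\<^esub> = 0"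
  by (simp_all add: ring_of_type_algebra_def)

lemma kx_minus [simp]: "p \<ominus>\<^bsub>kx\<^esub> q = p - (q :: ('m, 'k::comm_ring_1) mpoly)"
proof -
  interpret ring "kx :: ('m, 'k) mpoly ring" by (rule ring_from_type_algebra)
  have "\<ominus>\<^bsub>kx\<^esub> q = - q" using minus_equality[of "- q" q] by simp
  then show ?thesis by (simp add: a_minus_def)
qed

lemma sr_ideal_ideal: "ideal (sr_ideal K :: ('m::finite, 'k::comm_ring_1) mpoly set) kx"
proof -
  interpret ring "kx :: ('m, 'k) mpoly ring" by (rule ring_from_type_algebra)
  show ?thesis unfolding sr_ideal_def by (rule genideal_ideal) simp
qed

lemma face_ring_cring: "cring (face_ring K :: ('m::finite, 'k::comm_ring_1) mpoly set ring)"
  unfolding face_ring_def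
  by (rule ideal.quotient_is_cring[OF sr_ideal_ideal]) (rule cring_from_type_algebra)

lemma to_face_ring_hom:
  "to_face_ring K \<in> ring_hom (kx :: ('m::finite, 'k::comm_ring_1) mpoly ring) (face_ring K)"
  using ideal.rcos_ring_hom[OF sr_ideal_ideal, of K]
  by (simp add: face_ring_def to_face_ring_def[abs_def])

lemma to_face_ring_simps:
  "to_face_ring K (p + q) = to_face_ring K p \<oplus>\<^bsub>face_ring K\<^esub> to_face_ring K q"
  "to_face_ring K (p * q) = to_face_ring K p \<otimes>\<^bsub>face_ring K\<^esub> to_face_ring K q"
  "to_face_ring K p \<in> carrier (face_ring K)"
  "to_face_ring K 1 = \<one>\<^bsub>face_ring K\<^esub>"
  using ring_hom_add[OF to_face_ring_hom, of p q K] ring_hom_mult[OF to_face_ring_hom, of p q K]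
    ring_hom_closed[OF to_face_ring_hom, of p K] ring_hom_one[OF to_face_ring_hom, of K]
  by simp_all

lemma to_face_ring_eq_iff: "to_face_ring K p = to_face_ring K q \<longleftrightarrow> p - q \<in> sr_ideal K"
proof -
  interpret ring "kx :: ('a, 'b) mpoly ring" by (rule ring_from_type_algebra)
  show ?thesis using quotient_eq_iff_same_a_r_cos[OF sr_ideal_ideal, of p q K]
    by (simp add: to_face_ring_def)
qed

lemma to_face_ring_0: "to_face_ring K 0 = \<zero>\<^bsub>face_ring K\<^esub>"
proof -
  interpret F: cring "face_ring K :: ('a, 'b) mpoly set ring" by (rule face_ring_cring)
  show ?thesis
    using ring_hom_zero[OF to_face_ring_hom ring_from_type_algebra F.ring_axioms] by simp
qed

lemma to_face_ring_surj: "to_face_ring K ` UNIV = carrier (face_ring K)"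
  by (auto simp: to_face_ring_simps(3))
    (auto simp: face_ring_def FactRing_def A_RCOSETS_def' to_face_ring_def)

context
  fixes Q :: "('b, ('m::finite, 'k::comm_ring_1) mpoly) fcomplex" and \<epsilon> K
  assumes res: "free_resolution Q \<epsilon> K"
begin

lemma resolution_complex: "is_complex Q"
  and resolution_acyclic: "cycles Q (Suc n) = boundaries Q (Suc n)"
  and aug_add: "x \<in> chains Q 0 \<Longrightarrow> y \<in> chains Q 0 \<Longrightarrow> \<epsilon> (x + y) = \<epsilon> x \<oplus>\<^bsub>face_ring K\<^esub> \<epsilon> y"
  and aug_scale: "x \<in> chains Q 0 \<Longrightarrow> \<epsilon> (scale p x) = to_face_ring K p \<otimes>\<^bsub>face_ring K\<^esub> \<epsilon> x"
  and aug_surj: "\<epsilon> ` chains Q 0 = carrier (face_ring K)"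
  and aug_kernel: "x \<in> chains Q 0 \<Longrightarrow> \<epsilon> x = \<zero>\<^bsub>face_ring K\<^esub> \<longleftrightarrow> x \<in> boundaries Q 0"
  using res by (auto simp: free_resolution_def)

lemma aug_closed: "x \<in> chains Q 0 \<Longrightarrow> \<epsilon> x \<in> carrier (face_ring K)"
  using aug_surj by blast

lemma aug_zero: "\<epsilon> 0 = \<zero>\<^bsub>face_ring K\<^esub>"
  by (simp add: aug_kernel)

lemma aug_eq_iff:
  assumes "x \<in> chains Q 0" "y \<in> chains Q 0"
  shows "\<epsilon> x = \<epsilon> y \<longleftrightarrow> x - y \<in> boundaries Q 0"
proof -
  interpret F: cring "face_ring K :: ('m, 'k) mpoly set ring" by (rule face_ring_cring)
  have d: "x - y \<in> chains Q 0" using assms by (rule chains_diff)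
  have "\<epsilon> x = \<epsilon> (x - y) \<oplus>\<^bsub>face_ring K\<^esub> \<epsilon> y" using aug_add[OF d assms(2)] by simp
  then have "\<epsilon> x = \<epsilon> y \<longleftrightarrow> \<epsilon> (x - y) = \<zero>\<^bsub>face_ring K\<^esub>"
    using aug_closed[OF d] aug_closed[OF assms(2)] by (metis F.add.l_cancel_one F.add.m_comm)
  then show ?thesis by (simp add: aug_kernel[OF d])
qed

end

text \<open>
  Augmentations are \<open>\<^bold>k[\<^bold>x]\<close>-linear on chains of degree \<open>0\<close>, where \<open>\<^bold>k[\<^bold>x]\<close> acts on the face ring through its
  quotient map. Hence generators suffice.
\<close>

lemma aug_lin:
  assumes C: "free_resolution C \<epsilon> K" and D: "free_resolution D \<epsilon>' K"
    and f: "\<And>b. b \<in> gens C \<Longrightarrow> hdeg C b = 0 \<Longrightarrow> f b \<in> chains D 0 \<and> \<epsilon>' (f b) = \<epsilon> (sng b 1)"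
    and x: "x \<in> chains C 0"
  shows "\<epsilon>' (lin f x) = \<epsilon> x"
proof -
  have "x \<in> chains C 0 \<and> lin f x \<in> chains D 0 \<and> \<epsilon>' (lin f x) = \<epsilon> x"
  proof (rule terms_induct[where x = x])
    fix b r assume "b \<in> supp x"
    then have b: "b \<in> gens C" "hdeg C b = 0" using chainsD[OF x] by auto
    have s: "sng b 1 \<in> chains C 0" using b by (simp add: chains_sng)
    have "\<epsilon> (sng b r) = to_face_ring K r \<otimes>\<^bsub>face_ring K\<^esub> \<epsilon> (sng b 1)"
      using aug_scale[OF C s, of r] by simp
    then show "sng b r \<in> chains C 0 \<and> lin f (sng b r) \<in> chains D 0 \<and> \<epsilon>' (lin f (sng b r)) = \<epsilon> (sng b r)"
      using f[OF b] b by (simp add: chains_sng chains_scale aug_scale[OF D])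
  qed (auto simp: aug_zero[OF C] aug_zero[OF D] aug_add[OF C] aug_add[OF D] lin_add chains_add)
  then show ?thesis by simp
qed

text \<open>
  The existence part of the comparison theorem: \<open>f (d b)\<close> is a cycle, or has augmentation zero if its degree is
  \<open>0\<close>, hence is a boundary, and any preimage serves as \<open>f b\<close>. The predicate \<open>H\<close> records a property, such as
  homogeneity, that preimages can be chosen to have if the values in lower degree have it.
\<close>

lemma comparison_map:
  assumes C: "free_resolution C \<epsilon> K" and D: "free_resolution D \<epsilon>' K"
    and base: "\<And>b. b \<in> gens C \<Longrightarrow> hdeg C b = 0 \<Longrightarrow> \<exists>y\<in>chains D 0. \<epsilon>' y = \<epsilon> (sng b 1) \<and> H b y"
    and step: "\<And>b f n. b \<in> gens C \<Longrightarrow> hdeg C b = Suc n \<Longrightarrow>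
        (\<And>c. c \<in> supp (diff C b) \<Longrightarrow> H c (f c)) \<Longrightarrow> lin f (diff C b) \<in> boundaries D n \<Longrightarrow>
        \<exists>y\<in>chains D (Suc n). bd D y = lin f (diff C b) \<and> H b y"
  shows "\<exists>f. covers_identity C \<epsilon> D \<epsilon>' f \<and> (\<forall>b\<in>gens C. H b (f b))"
proof -
  note Cc = resolution_complex[OF C] and Dc = resolution_complex[OF D]
  let ?\<Phi> = "\<lambda>b v y. y \<in> chains D (hdeg C b) \<and> bd D y = v \<and> H b y
      \<and> (hdeg C b = 0 \<longrightarrow> \<epsilon>' y = \<epsilon> (sng b 1))"
  have "\<exists>f. \<forall>b\<in>gens C. ?\<Phi> b (lin f (diff C b)) (f b)"
  proof (rule degreewise_choice[OF Cc])
    fix f b assume b: "b \<in> gens C"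
      and IH: "\<And>c. c \<in> gens C \<Longrightarrow> hdeg C c < hdeg C b \<Longrightarrow> ?\<Phi> c (lin f (diff C c)) (f c)"
    have db: "c \<in> gens C \<and> Suc (hdeg C c) = hdeg C b" if "c \<in> supp (diff C b)" for c
      using Cc b that by (auto simp: is_complex_iff)
    have dd: "bd C (diff C b) = 0" using Cc b by (auto simp: is_complex_iff)
    show "\<exists>y. ?\<Phi> b (lin f (diff C b)) y"
    proof (cases "hdeg C b")
      case 0
      then have "diff C b = 0" using db by (auto simp flip: keys_eq_empty)
      then show ?thesis using base[OF b 0] 0 bd_chains_0[OF Dc] by auto
    next
      case (Suc n)
      have IH': "?\<Phi> c (lin f (diff C c)) (f c)" if "c \<in> supp (diff C b)" for c
        using IH db[OF that] by auto
      have ch: "lin f (diff C b) \<in> chains D n"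
        by (rule lin_chains) (use IH' db Suc in fastforce)
      have "bd D (lin f (diff C b)) = lin (\<lambda>c. bd D (f c)) (diff C b)"
        by (simp add: bd_def lin_lin)
      also have "\<dots> = lin (\<lambda>c. lin f (diff C c)) (diff C b)"
        using IH' by (intro lin_cong) auto
      also have "\<dots> = lin f (bd C (diff C b))" by (simp add: bd_def lin_lin)
      finally have cyc: "bd D (lin f (diff C b)) = 0" by (simp add: dd)
      have "lin f (diff C b) \<in> boundaries D n"
      proof (cases n)
        case 0
        have d0: "diff C b \<in> chains C 0" using db Suc 0 by (auto simp: chains_def)
        have "bd C (sng b 1) \<in> boundaries C 0"
          unfolding boundaries_def using b Suc 0 by (auto intro!: imageI chains_sng)
        then have "\<epsilon> (diff C b) = \<zero>\<^bsub>face_ring K\<^esub>" using aug_kernel[OF C d0] by (simp add: bd_def)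
        moreover have "\<epsilon>' (lin f (diff C b)) = \<epsilon> (diff C b)"
        proof -
          \<comment> \<open>The values of \<open>f\<close> are only known on \<open>supp (diff C b)\<close>, so \<open>f\<close> is corrected elsewhere.\<close>
          let ?f = "\<lambda>c. if c \<in> supp (diff C b) then f c else SOME y. y \<in> chains D 0 \<and> \<epsilon>' y = \<epsilon> (sng c 1)"
          have "\<epsilon>' (lin ?f (diff C b)) = \<epsilon> (diff C b)"
          proof (rule aug_lin[OF C D _ d0])
            fix c assume c: "c \<in> gens C" "hdeg C c = 0"
            have "\<exists>y. y \<in> chains D 0 \<and> \<epsilon>' y = \<epsilon> (sng c 1)" using base[OF c] by blast
            from someI_ex[OF this] show "?f c \<in> chains D 0 \<and> \<epsilon>' (?f c) = \<epsilon> (sng c 1)"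
              using IH'[of c] c by auto
          qed
          moreover have "lin ?f (diff C b) = lin f (diff C b)" by (rule lin_cong) simp
          ultimately show ?thesis by simp
        qed
        ultimately show ?thesis using aug_kernel[OF D] ch 0 by simp
      next
        case (Suc m)
        then show ?thesis using ch cyc resolution_acyclic[OF D] by (auto simp: cycles_def)
      qed
      from step[OF b Suc _ this] IH' show ?thesis using Suc by auto
    qed
  qed
  then obtain f where f: "\<forall>b\<in>gens C. ?\<Phi> b (lin f (diff C b)) (f b)" ..
  then have "chain_map C D f" by (simp add: chain_map_iff)
  moreover have "\<forall>x\<in>chains C 0. \<epsilon>' (lin f x) = \<epsilon> x"
    using aug_lin[OF C D] f by fastforce
  ultimately show ?thesis using f by (auto simp: covers_identity_def)
qed

lemma comparison_map_exists:
  assumes C: "free_resolution C \<epsilon> K" and D: "free_resolution D \<epsilon>' K"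
  shows "\<exists>f. covers_identity C \<epsilon> D \<epsilon>' f"
proof -
  have "\<exists>f. covers_identity C \<epsilon> D \<epsilon>' f \<and> (\<forall>b\<in>gens C. True)"
  proof (rule comparison_map[OF C D])
    fix b assume "b \<in> gens C" "hdeg C b = 0"
    then have "\<epsilon> (sng b 1) \<in> carrier (face_ring K)" by (intro aug_closed[OF C] chains_sng)
    then show "\<exists>y\<in>chains D 0. \<epsilon>' y = \<epsilon> (sng b 1) \<and> True" unfolding aug_surj[OF D, symmetric] by auto
  qed (auto simp: boundaries_def)
  then show ?thesis by blast
qed

section \<open>Base change\<close>

text \<open>
  A ring homomorphism \<open>\<rho>\<close> acts on the coefficients of free modules and of matrices. It is applied to the
  constant coefficient, to the evaluation with all variables equal to \<open>1\<close>, and to the inclusion of the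
  constants.
\<close>

locale base_change =
  fixes \<rho> :: "'s::comm_ring_1 \<Rightarrow> 'r::comm_ring_1"
  assumes add: "\<rho> (p + q) = \<rho> p + \<rho> q"
    and mult: "\<rho> (p * q) = \<rho> p * \<rho> q"
    and one: "\<rho> 1 = 1"
begin

lemma zero: "\<rho> 0 = 0"
  using add[of 0 0] by simp

lemma coef_map: "coef (Poly_Mapping.map \<rho> x) b = \<rho> (coef x b)"
  by (simp add: map.rep_eq when_def zero)

lemma map_zero: "Poly_Mapping.map \<rho> 0 = 0"
  by (rule poly_mapping_eqI) (simp add: coef_map zero)

lemma map_add: "Poly_Mapping.map \<rho> (x + y) = Poly_Mapping.map \<rho> x + Poly_Mapping.map \<rho> y"
  by (rule poly_mapping_eqI) (simp add: coef_map lookup_add add)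

lemma map_scale: "Poly_Mapping.map \<rho> (scale r x) = scale (\<rho> r) (Poly_Mapping.map \<rho> x)"
  by (rule poly_mapping_eqI) (simp add: coef_map coef_scale mult)

lemma map_sng: "Poly_Mapping.map \<rho> (sng b r) = sng b (\<rho> r)"
  by (rule poly_mapping_eqI) (simp add: coef_map lookup_single when_def zero)

lemma map_lin: "Poly_Mapping.map \<rho> (lin f x) = lin (\<lambda>b. Poly_Mapping.map \<rho> (f b)) (Poly_Mapping.map \<rho> x)"
  by (rule terms_induct[where x = x]) (simp_all add: map_zero map_add lin_add map_scale map_sng)

lemma map_tensor: "Poly_Mapping.map \<rho> (tensor x y) = tensor (Poly_Mapping.map \<rho> x) (Poly_Mapping.map \<rho> y)"
  by (rule tensor_eqI) (simp add: coef_map coef_tensor mult)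

lemma supp_map: "supp (Poly_Mapping.map \<rho> x) \<subseteq> supp x"
  by (auto simp: in_keys_iff coef_map zero)

lemma minus: "\<rho> (- p) = - \<rho> p"
  using add[of "- p" p] zero by (simp add: eq_neg_iff_add_eq_0)

lemma map_diff: "Poly_Mapping.map \<rho> (x - y) = Poly_Mapping.map \<rho> x - Poly_Mapping.map \<rho> y"
  using map_add[of "x - y" y] by (simp add: algebra_simps)

lemma power_minus_one: "\<rho> ((- 1) ^ n) = (- 1) ^ n"
  by (induction n) (simp_all add: one mult minus)

end

text \<open>
  A multiplicative function \<open>\<chi>\<close> of the exponents extends to a ring homomorphism. The constant coefficient is
  the case where \<open>\<chi>\<close> is \<open>1\<close> at \<open>0\<close> and \<open>0\<close> elsewhere. To inherit additivity from \<open>lin\<close>, the value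
  is computed as a linear map to a free module of rank one.
\<close>

definition evaluate :: "(('m \<Rightarrow>\<^sub>0 nat) \<Rightarrow> 'k) \<Rightarrow> ('m, 'k::comm_ring_1) mpoly \<Rightarrow> 'k" where
  "evaluate \<chi> p = coef (lin (\<lambda>e. sng () (\<chi> e)) p) ()"

lemma evaluate_sng: "evaluate \<chi> (sng e r) = r * \<chi> e"
  by (simp add: evaluate_def)

lemma base_change_evaluate:
  fixes \<chi> :: "('m \<Rightarrow>\<^sub>0 nat) \<Rightarrow> 'k::comm_ring_1"
  assumes "\<chi> 0 = 1" "\<And>a b. \<chi> (a + b) = \<chi> a * \<chi> b"
  shows "base_change (evaluate \<chi>)"
proof
  have add: "evaluate \<chi> (p + q) = evaluate \<chi> p + evaluate \<chi> q" for p q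
    by (simp add: evaluate_def lin_add lookup_add)
  then show "evaluate \<chi> (p + q) = evaluate \<chi> p + evaluate \<chi> q" for p q .
  have zero: "evaluate \<chi> 0 = 0" by (simp add: evaluate_def)
  have sng: "evaluate \<chi> (sng a r * q) = evaluate \<chi> (sng a r) * evaluate \<chi> q" for a r q
    by (rule terms_induct[where x = q])
      (simp_all add: zero add distrib_left mult_single evaluate_sng assms mult.assoc mult.left_commute)
  show "evaluate \<chi> (p * q) = evaluate \<chi> p * evaluate \<chi> q" for p q
    by (rule terms_induct[where x = p]) (simp_all add: zero add distrib_right sng)
  show "evaluate \<chi> 1 = 1"
    using evaluate_sng[of \<chi> 0 1] by (simp add: assms)
qed

lemma const_coeff_evaluate:
  fixes p :: "('m, 'k::comm_ring_1) mpoly"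
  shows "const_coeff p = evaluate (\<lambda>e. if e = 0 then 1 else 0) p"
proof -
  have add: "const_coeff (p + q) = const_coeff p + const_coeff q" for p q :: "('m, 'k) mpoly"
    by (simp add: const_coeff_def lookup_add)
  show ?thesis
    by (rule terms_induct[where x = p])
      (simp_all add: add, simp_all add: const_coeff_def evaluate_def lin_add lookup_add lookup_single when_def)
qed

interpretation const_coeff: base_change "const_coeff :: ('m, 'k::comm_ring_1) mpoly \<Rightarrow> 'k"
proof -
  have zero: "a + b = 0 \<longleftrightarrow> a = 0 \<and> b = 0" for a b :: "'m \<Rightarrow>\<^sub>0 nat"
    by (auto simp: poly_mapping_eq_iff fun_eq_iff lookup_add)
  show "base_change (const_coeff :: ('m, 'k) mpoly \<Rightarrow> 'k)"
    unfolding const_coeff_evaluate[abs_def]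
    by (rule base_change_evaluate) (auto simp: zero)
qed

interpretation evaluate_one: base_change "evaluate (\<lambda>_. 1) :: ('m, 'k::comm_ring_1) mpoly \<Rightarrow> 'k"
  by (rule base_change_evaluate) simp_all

subsection \<open>Reduction to the constant coefficients\<close>

lemma reduce_lin: "reduce (\<lambda>b. lin g (f b)) = (\<lambda>b. lin (reduce g) (reduce f b))"
  by (simp add: reduce_def[abs_def] const_coeff.map_lin)

lemma reduce_add: "reduce (\<lambda>b. f b + g b) = (\<lambda>b. reduce f b + reduce g b)"
  by (simp add: reduce_def[abs_def] const_coeff.map_add)

lemma reduce_diff: "reduce (\<lambda>b. f b - g b) = (\<lambda>b. reduce f b - reduce g b)"
  by (simp add: reduce_def[abs_def] const_coeff.map_diff)

lemma reduce_tensor: "reduce (\<lambda>(b, c). tensor (f b) (g c)) = (\<lambda>(b, c). tensor (reduce f b) (reduce g c))"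
  by (auto simp: reduce_def[abs_def] const_coeff.map_tensor fun_eq_iff)

lemma reduce_sng: "reduce (\<lambda>b. sng b 1) = (\<lambda>b. sng b 1)"
  by (simp add: reduce_def[abs_def] const_coeff.map_sng const_coeff.one)

lemma reduce_complex_sel [simp]:
  "gens (reduce_complex C) = gens C" "hdeg (reduce_complex C) = hdeg C"
  "diff (reduce_complex C) = reduce (diff C)"
  by (simp_all add: reduce_complex_def)

lemma reduce_eq: "f b = g b \<Longrightarrow> reduce f b = reduce g b"
  by (simp add: reduce_def)

lemma supp_reduce: "supp (reduce f b) \<subseteq> supp (f b)"
  unfolding reduce_def by (rule const_coeff.supp_map)

lemma reduce_chains: "f b \<in> chains C n \<Longrightarrow> reduce f b \<in> chains (reduce_complex C) n"
  using supp_reduce[of f b] by (auto simp: chains_def)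

lemma is_complex_reduce:
  assumes "is_complex C"
  shows "is_complex (reduce_complex C)"
proof -
  have "bd (reduce_complex C) (reduce (diff C) b) = reduce (\<lambda>b. bd C (diff C b)) b" for b
    by (simp add: bd_def reduce_lin)
  then show ?thesis
    using assms supp_reduce[of "diff C"] by (fastforce simp: is_complex_iff reduce_def const_coeff.map_zero)
qed

lemma chain_map_reduce:
  assumes "chain_map C D f"
  shows "chain_map (reduce_complex C) (reduce_complex D) (reduce f)"
proof -
  have "bd (reduce_complex D) (reduce f b) = reduce (\<lambda>b. bd D (f b)) b" for b
    by (simp add: bd_def reduce_lin)
  moreover have "lin (reduce f) (reduce (diff C) b) = reduce (\<lambda>b. lin f (diff C b)) b" for b
    by (simp add: reduce_lin)
  ultimately show ?thesis
    using assms by (auto simp: chain_map_iff intro: reduce_chains reduce_eq)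
qed

lemma reduce_tensor_complex:
  "reduce_complex (tensor_complex C D) = tensor_complex (reduce_complex C) (reduce_complex D)"
  unfolding reduce_complex_def tensor_complex_def
  by (auto simp: reduce_def fun_eq_iff const_coeff.map_add const_coeff.map_tensor const_coeff.map_scale
      const_coeff.map_sng const_coeff.one const_coeff.power_minus_one)

text \<open>The constant coefficients of the null-homotopy \<open>s\<close> form a null-homotopy over \<open>\<^bold>k\<close>.\<close>

lemma reduce_null_homotopic:
  assumes s: "\<forall>b\<in>gens C. s b \<in> chains D (Suc (hdeg C b)) \<and> h b = bd D (s b) + lin s (diff C b)"
    and z: "z \<in> cycles (reduce_complex C) n"
  shows "lin (reduce h) z \<in> boundaries (reduce_complex D) n"
proof -
  have zc: "z \<in> chains (reduce_complex C) n" "bd (reduce_complex C) z = 0"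
    using z by (auto simp: cycles_def)
  have zg: "b \<in> gens C \<and> hdeg C b = n" if "b \<in> supp z" for b
    using chainsD[OF zc(1) that] by simp
  have "lin (reduce h) z = lin (reduce (\<lambda>b. bd D (s b) + lin s (diff C b))) z"
    using s zg by (intro lin_cong reduce_eq) auto
  also have "\<dots> = bd (reduce_complex D) (lin (reduce s) z) + lin (reduce s) (bd (reduce_complex C) z)"
    by (simp add: bd_def reduce_add reduce_lin lin_add_fun lin_lin)
  finally have "lin (reduce h) z = bd (reduce_complex D) (lin (reduce s) z)" by (simp add: zc)
  moreover have "lin (reduce s) z \<in> chains (reduce_complex D) (Suc n)"
    by (rule lin_chains, rule reduce_chains) (use s zg in auto)
  ultimately show ?thesis by (auto simp: boundaries_def)
qed

text \<open>
  The difference of the two chain maps is null-homotopic by \<open>null_homotopy\<close>.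
\<close>

lemma reduce_homotopic:
  assumes "is_complex C" and f: "chain_map C D f" and g: "chain_map C D g"
    and "\<And>n. cycles D (Suc n) = boundaries D (Suc n)"
    and "\<And>b. b \<in> gens C \<Longrightarrow> hdeg C b = 0 \<Longrightarrow> f b - g b \<in> boundaries D 0"
    and z: "z \<in> cycles (reduce_complex C) n"
  shows "lin (reduce f) z - lin (reduce g) z \<in> boundaries (reduce_complex D) n"
proof -
  obtain s where s: "\<forall>b\<in>gens C. s b \<in> chains D (Suc (hdeg C b)) \<and>
      f b - g b = bd D (s b) + lin s (diff C b)"
    using null_homotopy[OF assms(1) chain_map_diff[OF f g] assms(4,5)] by blast
  then show ?thesis
    using reduce_null_homotopic[OF s z] by (simp add: reduce_diff lin_diff_fun)
qed

section \<open>Independence of the resolution\<close>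

lemma covers_identityD:
  "covers_identity C \<epsilon> D \<epsilon>' f \<Longrightarrow> chain_map C D f"
  "covers_identity C \<epsilon> D \<epsilon>' f \<Longrightarrow> x \<in> chains C 0 \<Longrightarrow> \<epsilon>' (lin f x) = \<epsilon> x"
  by (auto simp: covers_identity_def)

lemma covers_identity_comp:
  assumes "covers_identity C \<epsilon> D \<epsilon>' f" "covers_identity D \<epsilon>' E \<epsilon>'' g"
  shows "covers_identity C \<epsilon> E \<epsilon>'' (\<lambda>b. lin g (f b))"
  using assms unfolding covers_identity_def lin_lin[symmetric]
  by (metis chain_map_chains chain_map_comp)

text \<open>
  Both the composite \<open>g \<circ> f\<close> and the identity are chain maps of \<open>C\<close> over the identity of the face ring.
\<close>

lemma reduce_covers_identity:
  fixes C :: "('b, ('m::finite, 'k::comm_ring_1) mpoly) fcomplex"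
  assumes C: "free_resolution C \<epsilon> K" and D: "free_resolution D \<epsilon>' K"
    and f: "covers_identity C \<epsilon> D \<epsilon>' f" and g: "covers_identity D \<epsilon>' C \<epsilon> g"
    and z: "z \<in> cycles (reduce_complex C) n"
  shows "lin (reduce g) (lin (reduce f) z) - z \<in> boundaries (reduce_complex C) n"
proof -
  have gf: "covers_identity C \<epsilon> C \<epsilon> (\<lambda>b. lin g (f b))" by (rule covers_identity_comp[OF f g])
  note 1 = covers_identityD(1)[OF gf] and 2 = chain_map_id[of C]
  have "lin (reduce (\<lambda>b. lin g (f b))) z - lin (reduce (\<lambda>b. sng b (1 :: ('m, 'k) mpoly))) z \<in> boundaries (reduce_complex C) n"
  proof (rule reduce_homotopic[OF resolution_complex[OF C] 1 2 resolution_acyclic[OF C] _ z])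
    fix b assume b: "b \<in> gens C" "hdeg C b = 0"
    then have s: "sng b 1 \<in> chains C 0" by (simp add: chains_sng)
    have "\<epsilon> (lin g (f b)) = \<epsilon> (sng b 1)" using covers_identityD(2)[OF gf s] by simp
    moreover have "lin g (f b) \<in> chains C 0"
      using chain_map_chains[OF covers_identityD(1)[OF gf] s] by simp
    ultimately show "lin g (f b) - sng b 1 \<in> boundaries C 0"
      using aug_eq_iff[OF C _ s] by simp
  qed
  then show ?thesis by (simp add: reduce_lin lin_lin reduce_sng)
qed

text \<open>
  A comparison map in the other direction is an inverse up to homotopy.
\<close>

lemma reduce_comparison:
  assumes C: "free_resolution C \<epsilon> K" and D: "free_resolution D \<epsilon>' K"
    and f: "covers_identity C \<epsilon> D \<epsilon>' f"
  shows "z \<in> cycles (reduce_complex C) n \<Longrightarrow> lin (reduce f) z \<in> boundaries (reduce_complex D) n \<Longrightarrow>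
      z \<in> boundaries (reduce_complex C) n"
    and "w \<in> cycles (reduce_complex D) n \<Longrightarrow>
      \<exists>z\<in>cycles (reduce_complex C) n. w - lin (reduce f) z \<in> boundaries (reduce_complex D) n"
proof -
  obtain g where g: "covers_identity D \<epsilon>' C \<epsilon> g" using comparison_map_exists[OF D C] by blast
  note g' = chain_map_reduce[OF covers_identityD(1)[OF g]]
  show "z \<in> boundaries (reduce_complex C) n"
    if "z \<in> cycles (reduce_complex C) n" "lin (reduce f) z \<in> boundaries (reduce_complex D) n"
    using boundaries_diff[OF chain_map_boundaries[OF g' that(2)] reduce_covers_identity[OF C D f g that(1)]]
    by simp
  show "\<exists>z\<in>cycles (reduce_complex C) n. w - lin (reduce f) z \<in> boundaries (reduce_complex D) n"
    if w: "w \<in> cycles (reduce_complex D) n"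
  proof
    show "lin (reduce g) w \<in> cycles (reduce_complex C) n"
      by (rule chain_map_cycles[OF is_complex_reduce[OF resolution_complex[OF D]] g' w])
    show "w - lin (reduce f) (lin (reduce g) w) \<in> boundaries (reduce_complex D) n"
      using boundaries_minus[OF reduce_covers_identity[OF D C g f w]] by simp
  qed
qed

lemma homology_iso_comparison:
  assumes C: "free_resolution C \<epsilon> K" and D: "free_resolution D \<epsilon>' K"
    and f: "covers_identity C \<epsilon> D \<epsilon>' f"
  shows "homology_iso (reduce_complex C) (reduce_complex D) n (induced (reduce_complex D) n (reduce f))"
proof (rule homology_isoI)
  note f' = chain_map_reduce[OF covers_identityD(1)[OF f]]
  show "lin (reduce f) z \<in> cycles (reduce_complex D) n" if "z \<in> cycles (reduce_complex C) n" for z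
    using chain_map_cycles[OF is_complex_reduce[OF resolution_complex[OF C]] f' that] .
  show "lin (reduce f) z \<in> boundaries (reduce_complex D) n" if "z \<in> boundaries (reduce_complex C) n" for z
    using chain_map_boundaries[OF f' that] .
qed (fact reduce_comparison[OF C D f])+

text \<open>
  Changing \<open>z\<close> or \<open>w\<close> by a boundary changes \<open>z \<otimes> w\<close> by a boundary, so the union in \<open>tor_mult\<close> is a single
  coset.
\<close>

lemma tor_mult_hclass:
  assumes \<mu>: "chain_map (tensor_complex Q Q) Q \<mu>" and Q: "is_complex Q"
    and z: "z \<in> cycles (reduce_complex Q) i" and w: "w \<in> cycles (reduce_complex Q) j"
  shows "tor_mult Q \<mu> i j (hclass (reduce_complex Q) i z) (hclass (reduce_complex Q) j w)
    = hclass (reduce_complex Q) (i + j) (lin (reduce \<mu>) (tensor z w))"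
proof -
  let ?Q = "reduce_complex Q"
  have \<mu>': "lin (reduce \<mu>) t \<in> boundaries ?Q n" if "t \<in> boundaries (tensor_complex ?Q ?Q) n" for t n
    using chain_map_boundaries[OF chain_map_reduce[OF \<mu>]] that by (simp add: reduce_tensor_complex)
  have bc: "boundaries ?Q n \<subseteq> cycles ?Q n" for n
    by (rule boundaries_cycles) (rule is_complex_reduce[OF Q])
  have right: "(\<Union>w'\<in>hclass ?Q j w. hclass ?Q (i + j) (lin (reduce \<mu>) (tensor z' w')))
      = hclass ?Q (i + j) (lin (reduce \<mu>) (tensor z' w))" if "z' \<in> cycles ?Q i" for z'
    by (rule UN_hclass, rule hclass_eqI)
      (auto simp flip: lin_diff tensor_diff_right intro!: \<mu>' tensor_boundaries_right that)
  have cyc: "z' \<in> cycles ?Q i" if "z' \<in> hclass ?Q i z" for z'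
    using cycles_add[OF z, of "z' - z"] that bc by (auto simp: mem_hclass)
  have "tor_mult Q \<mu> i j (hclass ?Q i z) (hclass ?Q j w)
      = (\<Union>z'\<in>hclass ?Q i z. hclass ?Q (i + j) (lin (reduce \<mu>) (tensor z' w)))"
    unfolding tor_mult_def using right cyc by simp
  also have "\<dots> = hclass ?Q (i + j) (lin (reduce \<mu>) (tensor z w))"
    by (rule UN_hclass, rule hclass_eqI)
      (auto simp flip: lin_diff tensor_diff_left intro!: \<mu>' tensor_boundaries_left w)
  finally show ?thesis .
qed

text \<open>
  The two products come from the chain maps \<open>\<mu> \<circ> (f \<otimes> f)\<close> and \<open>f \<circ> \<nu>\<close> from \<open>C \<otimes> C\<close> to \<open>D\<close>. In degree \<open>0\<close> both
  cover the multiplication of the face ring, and \<open>C \<otimes> C\<close> is a complex of free modules, so they are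
  homotopic.
\<close>

lemma reduce_multiplication:
  assumes C: "free_resolution C \<epsilon> K" and D: "free_resolution D \<epsilon>' K"
    and f: "covers_identity C \<epsilon> D \<epsilon>' f"
    and \<nu>: "covers_multiplication C \<epsilon> K \<nu>" and \<mu>: "covers_multiplication D \<epsilon>' K \<mu>"
    and z: "z \<in> cycles (reduce_complex C) i" and w: "w \<in> cycles (reduce_complex C) j"
  shows "lin (reduce \<mu>) (tensor (lin (reduce f) z) (lin (reduce f) w))
    - lin (reduce f) (lin (reduce \<nu>) (tensor z w)) \<in> boundaries (reduce_complex D) (i + j)"
proof -
  let ?T = "tensor_complex C C"
  have f': "chain_map C D f" by (rule covers_identityD(1)[OF f])
  have \<mu>': "chain_map (tensor_complex D D) D \<mu>" and \<nu>': "chain_map ?T C \<nu>"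
    using \<mu> \<nu> by (auto simp: covers_multiplication_def)
  have 1: "chain_map ?T D (\<lambda>t. lin \<mu> (case t of (b, c) \<Rightarrow> tensor (f b) (f c)))"
    by (rule chain_map_comp[OF chain_map_tensor[OF f' f'] \<mu>'])
  have 2: "chain_map ?T D (\<lambda>t. lin f (\<nu> t))" by (rule chain_map_comp[OF \<nu>' f'])
  have "lin (reduce (\<lambda>t. lin \<mu> (case t of (b, c) \<Rightarrow> tensor (f b) (f c)))) (tensor z w)
      - lin (reduce (\<lambda>t. lin f (\<nu> t))) (tensor z w) \<in> boundaries (reduce_complex D) (i + j)"
  proof (rule reduce_homotopic[OF _ 1 2 resolution_acyclic[OF D]])
    show "is_complex ?T" by (intro is_complex_tensor resolution_complex[OF C])
    show "tensor z w \<in> cycles (reduce_complex ?T) (i + j)"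
      unfolding reduce_tensor_complex by (rule tensor_cycles[OF z w])
    fix t assume t: "t \<in> gens ?T" "hdeg ?T t = 0"
    obtain b c where bc: "t = (b, c)" by (cases t)
    have s: "sng b 1 \<in> chains C 0" "sng c 1 \<in> chains C 0" using t bc by (auto intro!: chains_sng)
    have fs: "f b \<in> chains D 0" "f c \<in> chains D 0" using chain_map_chains[OF f'] s by fastforce+
    have "\<epsilon>' (lin \<mu> (tensor (f b) (f c))) = \<epsilon>' (f b) \<otimes>\<^bsub>face_ring K\<^esub> \<epsilon>' (f c)"
      using \<mu> fs by (auto simp: covers_multiplication_def)
    also have "\<dots> = \<epsilon> (sng b 1) \<otimes>\<^bsub>face_ring K\<^esub> \<epsilon> (sng c 1)"
      using covers_identityD(2)[OF f s(1)] covers_identityD(2)[OF f s(2)] by simp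
    also have "\<dots> = \<epsilon> (lin \<nu> (tensor (sng b 1) (sng c 1)))"
      using \<nu> s unfolding covers_multiplication_def by metis
    also have "\<dots> = \<epsilon>' (lin f (lin \<nu> (tensor (sng b 1) (sng c 1))))"
      using covers_identityD(2)[OF f] chain_map_chains[OF \<nu>' tensor_chains[OF s]] by simp
    finally have eq: "\<epsilon>' (lin \<mu> (tensor (f b) (f c))) = \<epsilon>' (lin f (\<nu> t))" by (simp add: bc)
    have "sng t 1 \<in> chains ?T 0" by (rule chains_sng) (use t in auto)
    from chain_map_chains[OF 1 this] chain_map_chains[OF 2 this]
    have "lin \<mu> (tensor (f b) (f c)) \<in> chains D 0" "lin f (\<nu> t) \<in> chains D 0" by (simp_all add: bc)
    from aug_eq_iff[OF D this] eq
    show "lin \<mu> (case t of (b, c) \<Rightarrow> tensor (f b) (f c)) - lin f (\<nu> t) \<in> boundaries D 0"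
      by (simp add: bc)
  qed
  then show ?thesis
    unfolding reduce_lin reduce_tensor by (simp add: tensor_lin lin_lin)
qed

section \<open>Multigradings\<close>

definition component ::
  "('b \<Rightarrow> ('m \<Rightarrow>\<^sub>0 nat)) \<Rightarrow> ('m \<Rightarrow>\<^sub>0 nat) \<Rightarrow> ('b \<Rightarrow>\<^sub>0 ('m, 'k::comm_ring_1) mpoly) \<Rightarrow> ('b \<Rightarrow>\<^sub>0 ('m, 'k) mpoly)" where
  "component md a x = Poly_Mapping.mapp (\<lambda>b p. pick {e. e + md b = a} p) x"

lemma coef_component: "coef (component md a x) b = pick {e. e + md b = a} (coef x b)"
  by (auto simp: component_def lookup_mapp when_def in_keys_iff)

lemma component_zero [simp]: "component md a 0 = 0"
  by (rule poly_mapping_eqI) (simp add: coef_component)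

lemma component_add: "component md a (x + y) = component md a x + component md a y"
  by (rule poly_mapping_eqI) (simp add: coef_component lookup_add pick_add)

lemma supp_component: "supp (component md a x) \<subseteq> supp x"
  by (auto simp: in_keys_iff coef_component)

lemma component_chains: "x \<in> chains C n \<Longrightarrow> component md a x \<in> chains C n"
  using supp_component[of md a x] by (auto simp: chains_def)

lemma homogeneous_component: "homogeneous md a (component md a x)"
  by (auto simp: homogeneous_def coef_component supp_pick)

lemma component_homogeneous:
  assumes "homogeneous md a' x"
  shows "component md a x = (if a = a' then x else 0)"
proof (rule poly_mapping_eqI)
  fix b
  have "supp (coef x b) \<subseteq> {e. e + md b = a'}"
    using assms by (cases "b \<in> supp x") (auto simp: homogeneous_def in_keys_iff)
  then show "coef (component md a x) b = coef (if a = a' then x else 0) b"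
    by (auto simp: coef_component intro!: pick_id pick_none)
qed

lemma homogeneous_zero [simp]: "homogeneous md a 0"
  by (simp add: homogeneous_def)

lemma homogeneous_add: "homogeneous md a x \<Longrightarrow> homogeneous md a y \<Longrightarrow> homogeneous md a (x + y)"
  using homogeneous_component[of md a "x + y"]
  by (simp add: component_add component_homogeneous)

lemma homogeneous_sum: "(\<And>i. i \<in> I \<Longrightarrow> homogeneous md a (g i)) \<Longrightarrow> homogeneous md a (sum g I)"
  by (induction I rule: infinite_finite_induct) (auto intro: homogeneous_add)

lemma homogeneous_scale:
  assumes "\<And>e. e \<in> supp p \<Longrightarrow> e + a' = a" "homogeneous md a' x"
  shows "homogeneous md a (scale p x)"
  unfolding homogeneous_def
proof (intro ballI)
  fix b e assume b: "b \<in> supp (scale p x)" and e: "e \<in> supp (coef (scale p x) b)"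
  have "e \<in> supp (p * coef x b)" using e by (simp add: coef_scale)
  from subsetD[OF keys_mult this] obtain e1 e2
    where e: "e = e1 + e2" "e1 \<in> supp p" "e2 \<in> supp (coef x b)" by blast
  have "b \<in> supp x" by (rule subsetD[OF supp_scale b])
  then have "e2 + md b = a'" using assms(2) e(3) by (simp add: homogeneous_def)
  then show "e + md b = a" using assms(1)[OF e(2)] e(1) by (simp add: add.assoc)
qed

lemma homogeneous_lin:
  assumes "homogeneous md a x" and "\<And>b. b \<in> supp x \<Longrightarrow> homogeneous md' (md b) (f b)"
  shows "homogeneous md' a (lin f x)"
  unfolding lin_def
  by (intro homogeneous_sum homogeneous_scale[of _ "md b" for b])
    (use assms in \<open>auto simp: homogeneous_def\<close>)

text \<open>
  Both sides are additive in \<open>x\<close>. On a single term \<open>c \<^bold>x\<^sup>e b\<close>, whose image has the degree of the term, both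
  sides are the image if this degree is \<open>a\<close> and zero otherwise.
\<close>

lemma component_lin:
  fixes x :: "'b \<Rightarrow>\<^sub>0 ('m, 'k::comm_ring_1) mpoly"
  assumes f: "\<And>b. b \<in> supp x \<Longrightarrow> homogeneous md' (md b) (f b)"
  shows "component md' a (lin f x) = lin f (component md a x)"
proof (rule terms_induct[where x = x])
  fix b and r :: "('m, 'k) mpoly" assume b: "b \<in> supp x"
  show "component md' a (lin f (sng b r)) = lin f (component md a (sng b r))"
  proof (rule terms_induct[where x = r])
    fix e and c :: 'k
    have "homogeneous md (e + md b) (sng b (sng e c))" by (auto simp: homogeneous_def)
    moreover have "homogeneous md' (e + md b) (lin f (sng b (sng e c)))"
      using f[OF b] by (auto intro: homogeneous_scale split: if_splits)
    ultimately show "component md' a (lin f (sng b (sng e c))) = lin f (component md a (sng b (sng e c)))"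
      by (auto simp: component_homogeneous simp del: lin_sng)
  qed (simp_all add: single_add scale_add_left component_add lin_add del: lin_sng)
qed (simp_all add: component_add lin_add)

text \<open>
  An element is the sum of its finitely many nonzero components.
\<close>

lemma sum_components:
  assumes "\<And>a. component md a x \<in> Z" "0 \<in> Z" "\<And>x y. x \<in> Z \<Longrightarrow> y \<in> Z \<Longrightarrow> x + y \<in> Z"
  shows "x \<in> Z"
proof -
  let ?A = "\<Union>b\<in>supp x. (\<lambda>e. e + md b) ` supp (coef x b)"
  have A: "finite ?A" by auto
  have eq: "(\<Sum>a\<in>?A. component md a x) = x"
  proof (intro poly_mapping_eqI)
    fix b e
    have "(\<Sum>a\<in>?A. if e + md b = a then coef (coef x b) e else 0) = coef (coef x b) e"
    proof (cases "e \<in> supp (coef x b)")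
      case True
      then have "b \<in> supp x" by (auto simp: in_keys_iff)
      with True have "e + md b \<in> ?A" by blast
      then show ?thesis using A by simp
    qed (simp add: in_keys_iff)
    then show "coef (coef (\<Sum>a\<in>?A. component md a x) b) e = coef (coef x b) e"
      by (simp add: lookup_sum coef_component coef_pick)
  qed
  have "(\<Sum>a\<in>B. component md a x) \<in> Z" for B
    using assms by (induction B rule: infinite_finite_induct) auto
  from this[of ?A] show ?thesis unfolding eq .
qed

text \<open>
  The component of degree \<open>a\<close> of any preimage is again a preimage.
\<close>

lemma homogeneous_boundary:
  assumes "\<And>b. b \<in> gens Q \<Longrightarrow> homogeneous md (md b) (diff Q b)"
    and "x \<in> boundaries Q n" "homogeneous md a x"
  shows "\<exists>y\<in>chains Q (Suc n). bd Q y = x \<and> homogeneous md a y"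
proof -
  obtain y where y: "y \<in> chains Q (Suc n)" "x = bd Q y" using assms(2) by (auto simp: boundaries_def)
  have "bd Q (component md a y) = component md a x"
    unfolding y(2) bd_def
    by (rule component_lin[symmetric]) (use assms(1) y(1) in \<open>auto simp: chains_def\<close>)
  also have "\<dots> = x" using component_homogeneous[OF assms(3), of a] by simp
  finally show ?thesis using y(1) homogeneous_component component_chains by blast
qed

text \<open>
  The entry of \<open>f b\<close> at \<open>c\<close> is a multiple of the monomial whose degree is \<open>a\<close> minus that of \<open>c\<close>, and it has a
  constant coefficient only if this difference is \<open>0\<close>.
\<close>

lemma supp_reduce_homogeneous:
  assumes "homogeneous md a (f b)" "c \<in> supp (reduce f b)"
  shows "md c = a"
proof -
  have "const_coeff (coef (f b) c) \<noteq> 0"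
    using assms(2) by (simp add: reduce_def in_keys_iff const_coeff.coef_map)
  then have "0 \<in> supp (coef (f b) c)" by (simp add: const_coeff_def in_keys_iff)
  moreover have "c \<in> supp (f b)" using assms(2) supp_reduce by fast
  ultimately show ?thesis using assms(1) by (fastforce simp: homogeneous_def)
qed

section \<open>Squarefree monomials and the Stanley--Reisner ideal\<close>

lemma coef_mexp: "coef (mexp \<sigma>) i = (if i \<in> \<sigma> then 1 else 0)"
  by (simp add: mexp_def lookup_sum lookup_single when_def)

lemma supp_mexp [simp]: "supp (mexp \<sigma>) = \<sigma>"
  by (auto simp: in_keys_iff coef_mexp split: if_splits)

lemma mexp_eq_iff [simp]: "mexp \<sigma> = mexp \<tau> \<longleftrightarrow> \<sigma> = \<tau>"
  by (metis supp_mexp)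

lemma diff_mexp: "\<sigma> \<subseteq> supp a \<Longrightarrow> a - mexp \<sigma> + mexp \<sigma> = a"
  by (rule poly_mapping_eqI) (auto simp: lookup_add lookup_minus coef_mexp in_keys_iff)

lemma add_mexp: "e + mexp \<sigma> = a \<Longrightarrow> \<sigma> \<subseteq> supp a"
  by (auto simp: in_keys_iff lookup_add coef_mexp)

lemma supp_add_exponents: "supp (a + b) = supp a \<union> supp (b :: 'm \<Rightarrow>\<^sub>0 nat)"
  by (auto simp: in_keys_iff lookup_add)

text \<open>
  The polynomials on the right form an ideal, because multiplication only enlarges the support of an
  exponent, and this ideal contains the generators. Conversely each of their terms is a multiple of some generator.
  In particular the ideal is closed under taking single terms, which makes the face ring
  multigraded.
\<close>

lemma mem_sr_ideal:
  fixes p :: "('m::finite, 'k::comm_ring_1) mpoly"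
  shows "p \<in> sr_ideal (complex_of P) \<longleftrightarrow> (\<forall>e\<in>supp p. \<exists>\<sigma>\<in>set P. \<sigma> \<subseteq> supp e)"
proof -
  interpret ring "kx :: ('m, 'k) mpoly ring" by (rule ring_from_type_algebra)
  let ?I = "sr_ideal (complex_of P) :: ('m, 'k) mpoly set"
  define J where "J = {p :: ('m, 'k) mpoly. \<forall>e\<in>supp p. \<exists>\<sigma>\<in>set P. \<sigma> \<subseteq> supp e}"
  have add: "p + q \<in> J" if "p \<in> J" "q \<in> J" for p q
    using that keys_add[of p q] unfolding J_def by blast
  have mult: "q * p \<in> J" if p: "p \<in> J" for p q
    unfolding J_def mem_Collect_eq
  proof
    fix e assume "e \<in> supp (q * p)"
    from subsetD[OF keys_mult this] obtain a b where e: "e = a + b" "b \<in> supp p" by blast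
    then obtain \<sigma> where "\<sigma> \<in> set P" "\<sigma> \<subseteq> supp b" using p by (auto simp: J_def)
    then show "\<exists>\<sigma>\<in>set P. \<sigma> \<subseteq> supp e" unfolding e supp_add_exponents by blast
  qed
  have "ideal J kx"
  proof (rule idealI)
    have neg: "- p \<in> J" if "p \<in> J" for p using mult[OF that, of "- 1"] by simp
    have inv: "inv\<^bsub>add_monoid kx\<^esub> p = - p" for p :: "('m, 'k) mpoly"
      using minus_equality[of "- p" p] by (simp add: a_inv_def)
    show "subgroup J (add_monoid kx)"
    proof
      show "inv\<^bsub>add_monoid kx\<^esub> p \<in> J" if "p \<in> J" for p using inv neg[OF that] by metis
      show "\<one>\<^bsub>add_monoid kx\<^esub> \<in> J" by (simp add: J_def)
    qed (simp_all add: add)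
  qed (auto simp: ring_axioms mult, metis mult mult.commute)
  moreover have "xprod ` set P \<subseteq> J" by (auto simp: J_def monomial_def)
  ultimately have "?I \<subseteq> J" unfolding sr_ideal_complex_of by (rule genideal_minimal)
  moreover have "p \<in> ?I" if "p \<in> J"
  proof (rule terms_induct[where x = p])
    interpret I: ideal ?I kx by (rule sr_ideal_ideal)
    show "0 \<in> ?I" using I.zero_closed by simp
    show "x + y \<in> ?I" if "x \<in> ?I" "y \<in> ?I" for x y using I.a_closed[OF that] by simp
    fix e c assume "e \<in> supp p"
    then obtain \<sigma> where \<sigma>: "\<sigma> \<in> set P" "\<sigma> \<subseteq> supp e" using \<open>p \<in> J\<close> by (auto simp: J_def)
    have "xprod \<sigma> \<in> ?I"
      unfolding sr_ideal_complex_of using genideal_self[of "xprod ` set P"] \<sigma>(1) by auto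
    then have "sng (e - mexp \<sigma>) c * xprod \<sigma> \<in> ?I" using I.I_l_closed by simp
    then show "sng e c \<in> ?I" using diff_mexp[OF \<sigma>(2)] by (simp add: monomial_def mult_single)
  qed
  ultimately show ?thesis by (auto simp: J_def)
qed

text \<open>
  Over a multigraded \<open>Q\<close> the augmentation lifts to a homogeneous map \<open>aug\<close> to \<open>\<^bold>k[\<^bold>x]\<close>. For any preimage \<open>y\<close> of \<open>1\<close>
  this lift sends \<open>y\<close> to some \<open>q\<close> with \<open>q - 1\<close> in the ideal, and it sends the component of \<open>y\<close> of degree \<open>0\<close> to the
  constant term of \<open>q\<close>. As the ideal contains the terms of its members, this constant term also represents
  \<open>1\<close>.
\<close>

lemma homogeneous_aug_one:
  fixes Q :: "('b, ('m::finite, 'k::comm_ring_1) mpoly) fcomplex"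
  assumes Q: "free_resolution Q \<epsilon> (complex_of P)" and md: "multigraded Q \<epsilon> (complex_of P) md"
  shows "\<exists>y\<in>chains Q 0. \<epsilon> y = to_face_ring (complex_of P) 1 \<and> homogeneous md 0 y"
proof -
  let ?K = "complex_of P"
  have "\<forall>b\<in>{b \<in> gens Q. hdeg Q b = 0}. \<exists>p. supp p \<subseteq> {md b} \<and> \<epsilon> (sng b 1) = to_face_ring ?K p"
    using md by (auto simp: multigraded_def)
  then obtain \<pi> where \<pi>: "\<And>b. b \<in> gens Q \<Longrightarrow> hdeg Q b = 0 \<Longrightarrow>
      supp (\<pi> b) \<subseteq> {md b} \<and> \<epsilon> (sng b 1) = to_face_ring ?K (\<pi> b)"
    by (metis (mono_tags, lifting) mem_Collect_eq)
  define aug where "aug = (\<lambda>b. sng () (\<pi> b))"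
  have eps: "x \<in> chains Q 0 \<and> \<epsilon> x = to_face_ring ?K (coef (lin aug x) ())" if x: "x \<in> chains Q 0" for x
  proof (rule terms_induct[where x = x])
    fix b r assume "b \<in> supp x"
    then have b: "b \<in> gens Q" "hdeg Q b = 0" using chainsD[OF x] by auto
    then have "\<epsilon> (scale r (sng b 1)) = to_face_ring ?K r \<otimes>\<^bsub>face_ring ?K\<^esub> \<epsilon> (sng b 1)"
      by (intro aug_scale[OF Q] chains_sng)
    then show "sng b r \<in> chains Q 0 \<and> \<epsilon> (sng b r) = to_face_ring ?K (coef (lin aug (sng b r)) ())"
      using b \<pi>[OF b] by (simp add: chains_sng aug_def to_face_ring_simps)
  qed (auto simp: aug_zero[OF Q] to_face_ring_0 chains_add aug_add[OF Q] lin_add lookup_add to_face_ring_simps)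
  have "to_face_ring ?K 1 \<in> \<epsilon> ` chains Q 0"
    unfolding aug_surj[OF Q] by (rule to_face_ring_simps)
  then obtain y where y: "y \<in> chains Q 0" "\<epsilon> y = to_face_ring ?K 1" by auto
  let ?y = "component md 0 y"
  define q where "q = coef (lin aug y) ()"
  have q: "q - 1 \<in> sr_ideal ?K"
    using eps[OF y(1)] y(2) by (simp add: q_def flip: to_face_ring_eq_iff)
  have "lin aug ?y = component (\<lambda>_. 0) 0 (lin aug y)"
  proof (rule component_lin[symmetric])
    fix b assume "b \<in> supp y"
    then have "supp (\<pi> b) \<subseteq> {md b}" using \<pi> chainsD[OF y(1)] by blast
    then show "homogeneous (\<lambda>_. 0) (md b) (aug b)" by (auto simp: homogeneous_def aug_def split: if_splits)
  qed
  then have "coef (lin aug ?y) () = pick {0} q" by (simp add: coef_component q_def)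
  moreover have "pick {0} q - 1 = pick {0} (q - 1)"
    using pick_id[of "1 :: ('m, 'k) mpoly" "{0}"] by (simp add: pick_diff)
  moreover have "pick {0} (q - 1) \<in> sr_ideal ?K"
    using q by (auto simp: mem_sr_ideal supp_pick)
  ultimately have "\<epsilon> ?y = to_face_ring ?K 1"
    using eps[OF component_chains[OF y(1)]] by (simp add: to_face_ring_eq_iff)
  then show ?thesis using component_chains[OF y(1)] homogeneous_component by blast
qed

section \<open>The exterior algebra with the differential that deletes one factor\<close>

definition pos :: "nat \<Rightarrow> nat set \<Rightarrow> nat" where
  "pos k u = card {l \<in> u. l < k}"

definition inversions :: "nat set \<Rightarrow> nat set \<Rightarrow> nat" where
  "inversions u v = card {(k, l) \<in> u \<times> v. l < k}"

definition ext_diff :: "nat set \<Rightarrow> (nat set \<Rightarrow>\<^sub>0 'r::comm_ring_1)" where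
  "ext_diff u = (\<Sum>k\<in>u. sng (u - {k}) ((- 1) ^ Suc (pos k u)))"

lemma wedge_gen_eq:
  "wedge_gen (u, v) = (if u \<inter> v = {} then sng (u \<union> v) ((- 1) ^ inversions u v) else 0)"
  by (simp add: wedge_gen_def inversions_def)

lemma pos_insert: "finite u \<Longrightarrow> k \<notin> u \<Longrightarrow> pos j (insert k u) = (if k < j then 1 else 0) + pos j u"
proof -
  assume u: "finite u" "k \<notin> u"
  have "{l \<in> insert k u. l < j} = (if k < j then insert k {l \<in> u. l < j} else {l \<in> u. l < j})" by auto
  then show ?thesis using u by (simp add: pos_def)
qed

lemma pos_union:
  assumes "finite u" "finite v" "u \<inter> v = {}"
  shows "pos k (u \<union> v) = pos k u + pos k v"
proof -
  have "{l \<in> u \<union> v. l < k} = {l \<in> u. l < k} \<union> {l \<in> v. l < k}" by auto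
  then show ?thesis using assms unfolding pos_def by (simp, intro card_Un_disjoint) auto
qed

lemma inversions_insert_left:
  assumes "finite u" "finite v" "k \<notin> u"
  shows "inversions (insert k u) v = pos k v + inversions u v"
proof -
  have "{(j, l) \<in> insert k u \<times> v. l < j} = Pair k ` {l \<in> v. l < k} \<union> {(j, l) \<in> u \<times> v. l < j}" by auto
  moreover have "finite {(j, l) \<in> u \<times> v. l < j}"
    by (rule finite_subset[of _ "u \<times> v"]) (use assms in auto)
  ultimately show ?thesis
    using assms unfolding inversions_def pos_def
    by (simp, subst card_Un_disjoint) (auto simp: card_image inj_on_def)
qed

text \<open>
  The new inversions come from the elements of \<open>u\<close> above \<open>k\<close>, which together with those below \<open>k\<close> are all
  of \<open>u\<close>. Adding \<open>pos k u\<close> on the left avoids a subtraction.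
\<close>

lemma inversions_insert_right:
  assumes "finite u" "finite v" "k \<notin> v" "k \<notin> u"
  shows "inversions u (insert k v) + pos k u = card u + inversions u v"
proof -
  have "{(j, l) \<in> u \<times> insert k v. l < j} = (\<lambda>j. (j, k)) ` {j \<in> u. k < j} \<union> {(j, l) \<in> u \<times> v. l < j}" by auto
  moreover have "finite {(j, l) \<in> u \<times> v. l < j}"
    by (rule finite_subset[of _ "u \<times> v"]) (use assms in auto)
  ultimately have 1: "inversions u (insert k v) = card {j \<in> u. k < j} + inversions u v"
    using assms unfolding inversions_def
    by (simp, subst card_Un_disjoint) (auto simp: card_image inj_on_def)
  have "card ({j \<in> u. k < j} \<union> {l \<in> u. l < k}) = card {j \<in> u. k < j} + pos k u"
    unfolding pos_def
  proof (rule card_Un_disjoint)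
    show "{j \<in> u. k < j} \<inter> {l \<in> u. l < k} = {}" by force
  qed (simp_all add: assms(1))
  moreover have "{j \<in> u. k < j} \<union> {l \<in> u. l < k} = u"
    using assms(4) by (auto simp: not_less_iff_gr_or_eq)
  ultimately have "card u = card {j \<in> u. k < j} + pos k u" by simp
  then show ?thesis using 1 by simp
qed

lemma sign_eqI: "even (a + b) \<Longrightarrow> (- 1) ^ a = ((- 1) ^ b :: 'r::comm_ring_1)"
  by (cases "even a"; cases "even b") simp_all

text \<open>
  The elements of \<open>v\<close> below \<open>k\<close> count twice on the left: they are inversions with \<open>k\<close>, and they precede \<open>k\<close> in the
  product. So they do not affect the sign.
\<close>

lemma leibniz_sign_left:
  assumes "finite u" "finite v" "k \<in> u" "u \<inter> v = {}"
  shows "(- 1) ^ inversions u v * (- 1) ^ Suc (pos k (u \<union> v))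
    = ((- 1) ^ Suc (pos k u) * (- 1) ^ inversions (u - {k}) v :: 'r::comm_ring_1)"
proof -
  have "inversions u v = pos k v + inversions (u - {k}) v"
    using inversions_insert_left[of "u - {k}" v k] assms by (simp add: insert_absorb)
  then show ?thesis
    unfolding power_add[symmetric] by (intro sign_eqI) (simp add: pos_union assms, blast)
qed

text \<open>
  Moving the deletion past \<open>u\<close> costs one sign for each element of \<open>u\<close>: those above \<open>k\<close> are inversions with
  \<open>k\<close>, and those below precede \<open>k\<close> in the product.
\<close>

lemma leibniz_sign_right:
  assumes "finite u" "finite v" "k \<in> v" "u \<inter> v = {}"
  shows "(- 1) ^ inversions u v * (- 1) ^ Suc (pos k (u \<union> v))
    = ((- 1) ^ card u * ((- 1) ^ Suc (pos k v) * (- 1) ^ inversions u (v - {k})) :: 'r::comm_ring_1)"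
proof -
  have "inversions u v + pos k u = card u + inversions u (v - {k})"
    using inversions_insert_right[of u "v - {k}" k] assms by (auto simp: insert_absorb)
  then have "even (inversions u v + Suc (pos k (u \<union> v)) + (card u + (Suc (pos k v) + inversions u (v - {k}))))"
    by (simp add: pos_union assms) presburger
  then show ?thesis unfolding power_add[symmetric] by (intro sign_eqI) 
qed

text \<open>
  If \<open>k\<close> divides both \<open>u\<close> and \<open>v\<close>, deleting it from \<open>u\<close> and deleting it from \<open>v\<close> leave the same
  product with opposite signs, as it must be since the product of \<open>u\<close> and \<open>v\<close> is zero.
\<close>

lemma leibniz_sign_common:
  assumes "finite u" "finite v" "k \<in> u" "k \<in> v"
  shows "(- 1) ^ Suc (pos k u) * (- 1) ^ inversions (u - {k}) v
    + (- 1) ^ card u * ((- 1) ^ Suc (pos k v) * (- 1) ^ inversions u (v - {k})) = (0 :: 'r::comm_ring_1)"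
proof -
  define u' v' where "u' = u - {k}" and "v' = v - {k}"
  have uv: "u = insert k u'" "v = insert k v'" "k \<notin> u'" "k \<notin> v'" "finite u'" "finite v'"
    using assms by (auto simp: u'_def v'_def)
  have "inversions u' v + pos k u' = card u' + inversions u' v'"
    using inversions_insert_right[of u' v' k] uv by simp
  moreover have "inversions u v' = pos k v' + inversions u' v'"
    using inversions_insert_left[of u' v' k] uv by simp
  moreover have "pos k u = pos k u'" "pos k v = pos k v'" "card u = Suc (card u')"
    using uv by (simp_all add: pos_insert)
  ultimately have "even (Suc (Suc (pos k u) + inversions u' v) + (card u + (Suc (pos k v) + inversions u v')))"
    by simp presburger
  from sign_eqI[OF this, where 'r = 'r] show ?thesis
    unfolding power_add[symmetric] u'_def[symmetric] v'_def[symmetric] by simp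
qed

text \<open>
  For disjoint \<open>u\<close> and \<open>v\<close>, each factor of the product is deleted on both sides exactly once, and only the signs have
  to be compared. If \<open>u\<close> and \<open>v\<close> have a common factor, the left-hand side is zero. On the right a term can be
  nonzero only if it deletes the only common factor.
\<close>

lemma ext_diff_wedge_gen:
  assumes "finite u" "finite v"
  shows "lin ext_diff (wedge_gen (u, v)) = lin wedge_gen (tensor (ext_diff u) (sng v 1))
    + scale ((- 1) ^ card u) (lin wedge_gen (tensor (sng u 1) (ext_diff v)) :: nat set \<Rightarrow>\<^sub>0 'r::comm_ring_1)"
    (is "?l = ?a + ?b")
proof -
  have a: "?a = (\<Sum>k\<in>u. scale ((- 1) ^ Suc (pos k u)) (wedge_gen (u - {k}, v)))"
    by (simp add: ext_diff_def tensor_sum_left lin_sum)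
  have b: "?b = (\<Sum>k\<in>v. scale ((- 1) ^ card u * (- 1) ^ Suc (pos k v)) (wedge_gen (u, v - {k})))"
    by (simp add: ext_diff_def tensor_sum_right lin_sum scale_sum)
  show ?thesis
  proof (cases "u \<inter> v = {}")
    case True
    have "?l = (\<Sum>k\<in>u \<union> v. sng (u \<union> v - {k}) ((- 1) ^ inversions u v * (- 1) ^ Suc (pos k (u \<union> v))))"
      using True by (simp add: wedge_gen_eq ext_diff_def scale_sum)
    also have "\<dots> = (\<Sum>k\<in>u. sng (u \<union> v - {k}) ((- 1) ^ inversions u v * (- 1) ^ Suc (pos k (u \<union> v))))
        + (\<Sum>k\<in>v. sng (u \<union> v - {k}) ((- 1) ^ inversions u v * (- 1) ^ Suc (pos k (u \<union> v))))"
      using assms True by (rule sum.union_disjoint)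
    also have "\<dots> = ?a + ?b"
      unfolding a b
    proof (intro arg_cong2[of _ _ _ _ "(+)"] sum.cong refl)
      fix k assume k: "k \<in> u"
      have "u \<union> v - {k} = (u - {k}) \<union> v" "(u - {k}) \<inter> v = {}" using k True by auto
      then show "sng (u \<union> v - {k}) ((- 1) ^ inversions u v * (- 1) ^ Suc (pos k (u \<union> v)))
          = scale ((- 1) ^ Suc (pos k u)) (wedge_gen (u - {k}, v) :: nat set \<Rightarrow>\<^sub>0 'r)"
        using leibniz_sign_left[OF assms k True, where 'r = 'r]
        by (simp add: wedge_gen_eq del: power_Suc)
    next
      fix k assume k: "k \<in> v"
      have "u \<union> v - {k} = u \<union> (v - {k})" "u \<inter> (v - {k}) = {}" using k True by auto
      then show "sng (u \<union> v - {k}) ((- 1) ^ inversions u v * (- 1) ^ Suc (pos k (u \<union> v)))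
          = scale ((- 1) ^ card u * (- 1) ^ Suc (pos k v)) (wedge_gen (u, v - {k}) :: nat set \<Rightarrow>\<^sub>0 'r)"
        using leibniz_sign_right[OF assms k True, where 'r = 'r]
        by (simp add: wedge_gen_eq mult.assoc del: power_Suc)
    qed
    finally show ?thesis .
  next
    case False
    then obtain k where k: "k \<in> u" "k \<in> v" by blast
    have "?a = (\<Sum>j\<in>{k}. scale ((- 1) ^ Suc (pos j u)) (wedge_gen (u - {j}, v)))"
      unfolding a by (rule sum.mono_neutral_right) (use k assms in \<open>auto simp: wedge_gen_eq\<close>)
    moreover have "?b = (\<Sum>j\<in>{k}. scale ((- 1) ^ card u * (- 1) ^ Suc (pos j v)) (wedge_gen (u, v - {j})))"
      unfolding b by (rule sum.mono_neutral_right) (use k assms in \<open>auto simp: wedge_gen_eq\<close>)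
    moreover have "(u - {k}) \<union> v = u \<union> (v - {k})" "(u - {k}) \<inter> v = {} \<longleftrightarrow> u \<inter> (v - {k}) = {}"
      using k by auto
    ultimately have "?a + ?b = 0"
      using leibniz_sign_common[OF assms k, where 'r = 'r]
      by (simp add: wedge_gen_eq mult.assoc del: power_Suc flip: single_add)
    then show ?thesis using False by (simp add: wedge_gen_eq)
  qed
qed

definition gen_mult :: "nat \<Rightarrow> (nat set \<Rightarrow>\<^sub>0 'r::comm_ring_1) \<Rightarrow> (nat set \<Rightarrow>\<^sub>0 'r)" where
  "gen_mult k = lin (\<lambda>u. wedge_gen ({k}, u))"

lemma pos_self: "pos k {k} = 0"
  by (auto simp: pos_def intro: less_irrefl)

lemma wedge_gen_empty: "wedge_gen ({}, v) = sng v 1"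
  by (simp add: wedge_gen_def)

text \<open>
  The Leibniz rule for the product with \<open>\<sigma>\<^sub>k\<close>, whose boundary is \<open>- 1\<close>. For a cycle \<open>z\<close> it exhibits \<open>z\<close>
  as the boundary of \<open>- \<sigma>\<^sub>k z\<close>.
\<close>

lemma ext_diff_gen_mult:
  fixes z :: "nat set \<Rightarrow>\<^sub>0 'r::comm_ring_1"
  assumes "\<And>u. u \<in> supp z \<Longrightarrow> finite u"
  shows "lin ext_diff (gen_mult k z) = - z - gen_mult k (lin ext_diff z)"
proof (rule terms_induct[where x = z])
  fix u and r :: 'r assume "u \<in> supp z"
  then have "lin ext_diff (wedge_gen ({k}, u)) = - sng u 1 - gen_mult k (ext_diff u :: nat set \<Rightarrow>\<^sub>0 'r)"
    using ext_diff_wedge_gen[of "{k}" u] assms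
    by (simp add: ext_diff_def[of "{k}"] pos_self single_uminus wedge_gen_empty lin_tensor gen_mult_def
        scale_minus_left lin_minus)
  then show "lin ext_diff (gen_mult k (sng u r)) = - sng u r - gen_mult k (lin ext_diff (sng u r))"
    by (simp add: gen_mult_def lin_scale scale_diff scale_minus)
qed (simp_all add: gen_mult_def lin_add)

lemma supp_ext_diff: "supp (ext_diff u) \<subseteq> (\<lambda>k. u - {k}) ` u"
  unfolding ext_diff_def by (rule subset_trans[OF keys_sum]) (auto split: if_splits)

lemma ext_diff_finite: "finite u \<Longrightarrow> v \<in> supp (ext_diff u) \<Longrightarrow> finite v"
  using subsetD[OF supp_ext_diff] by fastforce

text \<open>
  Write \<open>u = \<sigma>\<^sub>k v\<close> with the least factor first, so that no sign appears. Then \<open>d u = - v - \<sigma>\<^sub>k d v\<close>, and by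
  \<open>ext_diff_gen_mult\<close> applying \<open>d\<close> again leaves \<open>\<sigma>\<^sub>k d d v\<close>.
\<close>

lemma ext_diff_ext_diff: "finite u \<Longrightarrow> lin ext_diff (ext_diff u) = (0 :: nat set \<Rightarrow>\<^sub>0 'r::comm_ring_1)"
proof (induction "card u" arbitrary: u)
  case 0
  then show ?case by (simp add: ext_diff_def)
next
  case (Suc n)
  then have u: "u \<noteq> {}" "finite u" by auto
  define k where "k = Min u"
  define v where "v = u - {k}"
  have k: "k \<in> u" using u by (simp add: k_def)
  have "{(a, b) \<in> {k} \<times> v. b < a} = {}" using u by (auto simp: k_def v_def)
  then have "inversions {k} v = 0" by (simp only: inversions_def card.empty)
  then have gen: "(sng u 1 :: nat set \<Rightarrow>\<^sub>0 'r) = gen_mult k (sng v 1)"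
    using k by (auto simp: gen_mult_def wedge_gen_eq v_def insert_absorb)
  have v: "finite v" "n = card v" using u k Suc.hyps(2) by (auto simp: v_def)
  have rec: "lin ext_diff (gen_mult k (ext_diff v)) = - (ext_diff v :: nat set \<Rightarrow>\<^sub>0 'r) - gen_mult k (lin ext_diff (ext_diff v))"
    by (rule ext_diff_gen_mult) (rule ext_diff_finite[OF v(1)])
  have "(ext_diff u :: nat set \<Rightarrow>\<^sub>0 'r) = lin ext_diff (gen_mult k (sng v 1))" by (simp flip: gen)
  also have "\<dots> = - sng v 1 - gen_mult k (ext_diff v)" using ext_diff_gen_mult[of "sng v 1" k] v by simp
  finally have "lin ext_diff (ext_diff u :: nat set \<Rightarrow>\<^sub>0 'r) = - ext_diff v - lin ext_diff (gen_mult k (ext_diff v))"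
    by (simp add: lin_diff lin_minus)
  also have "\<dots> = gen_mult k (lin ext_diff (ext_diff v))"
    using rec by simp
  also have "\<dots> = 0" using Suc.hyps(1)[OF v(2,1)] by (simp add: gen_mult_def)
  finally show ?case .
qed

text \<open>
  The factor number \<open>i\<close> of \<open>u\<close>, counted from \<open>1\<close>, is the one with \<open>i - 1\<close> factors below it. This replaces the
  index \<open>i\<close> in the differentials by the deleted factor itself.
\<close>

lemma sum_del:
  assumes "finite u"
  shows "(\<Sum>i=1..card u. F i (del i u)) = (\<Sum>k\<in>u. F (Suc (pos k u)) (u - {k}))"
proof -
  let ?l = "sorted_list_of_set u"
  have l: "length ?l = card u" "set ?l = u" "sorted ?l" "distinct ?l" using assms by auto
  have strict: "?l ! a < ?l ! b \<longleftrightarrow> a < b" if "a < card u" "b < card u" for a b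
    using l that by (metis linorder_neq_iff nth_eq_iff_index_eq order_less_le sorted_nth_mono not_less)
  have bij: "bij_betw ((!) ?l) {..<card u} u"
    using bij_betw_nth[OF l(4), of "{..<card u}" u] l by simp
  have pos: "pos (?l ! n) u = n" if n: "n < card u" for n
  proof -
    have "{x \<in> u. x < ?l ! n} = (!) ?l ` {..<n}"
    proof (intro equalityI subsetI)
      fix x assume x: "x \<in> {x \<in> u. x < ?l ! n}"
      then have "x \<in> set ?l" using l(2) by blast
      then obtain m where "m < card u" "x = ?l ! m" using l(1) by (metis in_set_conv_nth)
      then show "x \<in> (!) ?l ` {..<n}" using x strict[of m n] n by auto
    next
      fix x assume "x \<in> (!) ?l ` {..<n}"
      then obtain m where m: "m < n" "x = ?l ! m" by auto
      then have "x \<in> set ?l" using l(1) n by simp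
      then show "x \<in> {x \<in> u. x < ?l ! n}" using m strict[of m n] n l(2) by simp
    qed
    moreover have "inj_on ((!) ?l) {..<n}"
      using bij n unfolding bij_betw_def by (auto intro: inj_on_subset)
    ultimately show ?thesis by (simp add: pos_def card_image)
  qed
  have "(\<Sum>k\<in>u. F (Suc (pos k u)) (u - {k})) = (\<Sum>n<card u. F (Suc (pos (?l ! n) u)) (u - {?l ! n}))"
    using sum.reindex_bij_betw[OF bij, of "\<lambda>k. F (Suc (pos k u)) (u - {k})"] by simp
  also have "\<dots> = (\<Sum>n<card u. F (Suc n) (del (Suc n) u))"
    by (intro sum.cong) (simp_all add: pos del_def)
  also have "\<dots> = (\<Sum>i=1..card u. F i (del i u))"
    by (simp add: sum.atLeast1_atMost_eq)
  finally show ?thesis by simp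
qed

section \<open>The Taylor resolution\<close>

lemma total_set_simps [simp]: "total_set P {} = {}" "total_set P {k} = P ! k"
  by (simp_all add: total_set_def)

lemma total_set_union: "total_set P (u \<union> v) = total_set P u \<union> total_set P v"
  by (simp add: total_set_def)

lemma total_set_mono: "u \<subseteq> v \<Longrightarrow> total_set P u \<subseteq> total_set P v"
  by (auto simp: total_set_def)

lemma mexp_diff_add: "\<tau> \<subseteq> \<sigma> \<Longrightarrow> mexp (\<sigma> - \<tau>) + mexp \<tau> = mexp \<sigma>"
  using mexp_union[of \<tau> "\<sigma> - \<tau>"] by (simp add: Un_absorb1 add.commute Diff_Int_distrib)

lemma sign_monomial: "(- 1) ^ n * monomial a = (sng a ((- 1) ^ n) :: ('m, 'k::comm_ring_1) mpoly)"
  by (cases "even n") (simp_all add: monomial_def single_uminus)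

lemma taylor_sel [simp]:
  "gens (taylor P) = Pow {..<length P}" "hdeg (taylor P) = card"
  by (simp_all add: taylor_def)

lemma diff_taylor:
  assumes "finite u"
  shows "(diff (taylor P) u :: nat set \<Rightarrow>\<^sub>0 ('m::finite, 'k::comm_ring_1) mpoly)
    = (\<Sum>k\<in>u. sng (u - {k}) (sng (mexp (total_set P u - total_set P (u - {k}))) ((- 1) ^ Suc (pos k u))))"
  using sum_del[OF assms, of "\<lambda>i w. sng w (sng (mexp (total_set P u - total_set P w)) ((- 1) ^ i :: 'k))"]
  by (simp add: taylor_def sign_monomial)

text \<open>
  Multiplies the coefficient of \<open>u\<close> by the monomial that makes the degree equal to \<open>a\<close>. There is such a
  monomial exactly if the total set of \<open>u\<close> is contained in the support of \<open>a\<close>, in which case the subtraction of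
  exponents is not truncated. The lemmas below assume this for all \<open>u\<close> in the support of \<open>z\<close>.
\<close>

definition homogenize ::
  "'m::finite set list \<Rightarrow> ('m \<Rightarrow>\<^sub>0 nat) \<Rightarrow> (nat set \<Rightarrow>\<^sub>0 'k::comm_ring_1) \<Rightarrow> (nat set \<Rightarrow>\<^sub>0 ('m, 'k) mpoly)" where
  "homogenize P a z = lin (\<lambda>u. sng u (monomial (a - mexp (total_set P u)))) (Poly_Mapping.map (\<lambda>c. sng 0 c) z)"

interpretation constants: base_change "sng 0 :: 'k::comm_ring_1 \<Rightarrow> ('m, 'k) mpoly"
  by unfold_locales (simp_all add: single_add mult_single)

lemma homogenize_zero [simp]: "homogenize P a 0 = 0"
  by (simp add: homogenize_def constants.map_zero)

lemma homogenize_add: "homogenize P a (x + y) = homogenize P a x + homogenize P a y"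
  by (simp add: homogenize_def constants.map_add lin_add)

lemma homogenize_scale: "homogenize P a (scale r x) = scale (sng 0 r) (homogenize P a x)"
  by (simp add: homogenize_def constants.map_scale lin_scale)

lemma homogenize_sum: "homogenize P a (sum g I) = (\<Sum>i\<in>I. homogenize P a (g i))"
  by (induction I rule: infinite_finite_induct) (simp_all add: homogenize_add)

lemma homogenize_sng: "homogenize P a (sng u c) = sng u (sng (a - mexp (total_set P u)) c)"
  by (simp add: homogenize_def constants.map_sng monomial_def mult_single)

lemma coef_homogenize: "coef (homogenize P a z) u = sng (a - mexp (total_set P u)) (coef z u)"
  by (rule terms_induct[where x = z])
    (auto simp: homogenize_add lookup_add single_add homogenize_sng lookup_single when_def)

lemma supp_homogenize: "supp (homogenize P a z) \<subseteq> supp z"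
  by (auto simp: in_keys_iff coef_homogenize)

lemma scale_homogenize:
  assumes "\<And>u. u \<in> supp z \<Longrightarrow> total_set P u \<subseteq> supp a"
  shows "scale (sng e r) (homogenize P a z) = homogenize P (e + a) (scale r z)"
proof -
  have "e + (a - mexp (total_set P u)) = e + a - mexp (total_set P u)" if "total_set P u \<subseteq> supp a" for u
    using diff_mexp[OF that] by (metis add.assoc add_diff_cancel_right')
  then show ?thesis
    by (intro terms_induct[of _ z, where Q = "\<lambda>z. scale (sng e r) (homogenize P a z) = homogenize P (e + a) (scale r z)"])
      (simp_all add: homogenize_add scale_add homogenize_sng mult_single assms)
qed

text \<open>
  In degree \<open>a\<close> the Taylor complex is a subcomplex of the exterior algebra over \<open>\<^bold>k\<close>: the monomial in the
  differential makes up exactly for the change of the total set.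
\<close>

lemma diff_homogenize:
  fixes z :: "nat set \<Rightarrow>\<^sub>0 'k::comm_ring_1"
  assumes "\<And>u. u \<in> supp z \<Longrightarrow> finite u \<and> total_set P u \<subseteq> supp a"
  shows "bd (taylor P) (homogenize P a z) = homogenize P a (lin ext_diff z)"
proof (rule terms_induct[where x = z])
  fix u and c :: 'k assume "u \<in> supp z"
  then have u: "finite u" "total_set P u \<subseteq> supp a" using assms by auto
  have "a - mexp (total_set P u) + mexp (total_set P u - total_set P (u - {k})) = a - mexp (total_set P (u - {k}))" for k
  proof -
    have "total_set P (u - {k}) \<subseteq> total_set P u" by (rule total_set_mono) auto
    from mexp_diff_add[OF this]
    have "a - mexp (total_set P u) + mexp (total_set P u - total_set P (u - {k}))
        + mexp (total_set P (u - {k})) = a"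
      using diff_mexp[OF u(2)] by (simp add: add.assoc)
    then show ?thesis by (metis add_diff_cancel_right')
  qed
  then show "bd (taylor P) (homogenize P a (sng u c)) = homogenize P a (lin ext_diff (sng u c))"
    by (simp add: bd_def homogenize_sng diff_taylor[OF u(1)] scale_sum ext_diff_def homogenize_sum
        mult_single del: power_Suc)
qed (simp_all add: homogenize_add lin_add bd_def)

lemma diff_taylor_homogenize:
  assumes "finite u"
  shows "diff (taylor P) u = homogenize P (mexp (total_set P u)) (ext_diff u)"
  using diff_homogenize[of "sng u 1" P "mexp (total_set P u)"] assms
  by (simp add: homogenize_sng bd_def)

lemma homogeneous_homogenize:
  assumes "\<And>u. u \<in> supp z \<Longrightarrow> total_set P u \<subseteq> supp a"
  shows "homogeneous (mexp \<circ> total_set P) a (homogenize P a z)"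
  unfolding homogeneous_def
proof (intro ballI)
  fix u e assume u: "u \<in> supp (homogenize P a z)" and e: "e \<in> supp (coef (homogenize P a z) u)"
  have "total_set P u \<subseteq> supp a" by (rule assms) (rule subsetD[OF supp_homogenize u])
  then show "e + (mexp \<circ> total_set P) u = a"
    using e by (simp add: coef_homogenize diff_mexp split: if_splits)
qed

lemma supp_ext_diff_total: "w \<in> supp (ext_diff u) \<Longrightarrow> total_set P w \<subseteq> total_set P u"
  using subsetD[OF supp_ext_diff] total_set_mono[of w u P] by blast

lemma homogeneous_diff_taylor:
  "finite u \<Longrightarrow> homogeneous (mexp \<circ> total_set P) (mexp (total_set P u)) (diff (taylor P) u)"
  unfolding diff_taylor_homogenize
  by (rule homogeneous_homogenize) (simp add: supp_ext_diff_total)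

lemma is_complex_taylor: "is_complex (taylor P :: (nat set, ('m::finite, 'k::comm_ring_1) mpoly) fcomplex)"
    (is "is_complex ?R")
  unfolding is_complex_iff
proof (intro ballI conjI)
  fix u assume "u \<in> gens ?R"
  then have u: "u \<subseteq> {..<length P}" "finite u" by (auto intro: finite_subset)
  show "supp (diff ?R u) \<subseteq> {c \<in> gens ?R. Suc (hdeg ?R c) = hdeg ?R u}"
    unfolding diff_taylor_homogenize[OF u(2)]
  proof (rule subset_trans[OF subset_trans[OF supp_homogenize supp_ext_diff]], rule image_subsetI)
    fix k assume "k \<in> u"
    from card_Suc_Diff1[OF u(2) this] show "u - {k} \<in> {c \<in> gens ?R. Suc (hdeg ?R c) = hdeg ?R u}"
      using u(1) by auto
  qed
  have "bd ?R (diff ?R u) = homogenize P (mexp (total_set P u)) (lin ext_diff (ext_diff u))"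
    unfolding diff_taylor_homogenize[OF u(2)]
  proof (rule diff_homogenize)
    fix w assume w: "w \<in> supp (ext_diff u :: nat set \<Rightarrow>\<^sub>0 'k)"
    show "finite w \<and> total_set P w \<subseteq> supp (mexp (total_set P u))"
      using ext_diff_finite[OF u(2) w] supp_ext_diff_total[OF w] by simp
  qed
  then show "bd ?R (diff ?R u) = 0" by (simp add: ext_diff_ext_diff u)
qed

subsection \<open>The product\<close>

text \<open>
  The monomial in \<open>\<phi>\<close> is the one forced by the degree.
\<close>

lemma phi_homogenize:
  "phi P (u, v) = homogenize P (mexp (total_set P u) + mexp (total_set P v)) (wedge_gen (u, v))"
  by (simp add: phi_def wedge_gen_eq homogenize_sng sign_monomial mult.commute)

lemma fits_wedge_gen:
  "w \<in> supp (wedge_gen (u, v)) \<Longrightarrow>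
    total_set P w \<subseteq> supp (mexp (total_set P u) + mexp (total_set P v))"
  by (auto simp: wedge_gen_eq supp_add_exponents total_set_union split: if_splits)

lemma phi_diff_left:
  assumes "finite u"
  shows "lin (phi P) (tensor (diff (taylor P) u) (sng v 1))
    = homogenize P (mexp (total_set P u) + mexp (total_set P v)) (lin wedge_gen (tensor (ext_diff u) (sng v 1)))"
proof -
  have "mexp (total_set P u - total_set P (u - {k})) + (mexp (total_set P (u - {k})) + mexp (total_set P v))
      = mexp (total_set P u) + mexp (total_set P v)" for k
    using mexp_diff_add[OF total_set_mono[of "u - {k}" u P]] by (simp flip: add.assoc)
  then show ?thesis
    by (simp add: diff_taylor[OF assms] ext_diff_def tensor_sum_left lin_sum homogenize_sum
        phi_homogenize scale_homogenize fits_wedge_gen del: power_Suc)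
qed

lemma phi_diff_right:
  assumes "finite v"
  shows "lin (phi P) (tensor (sng u 1) (diff (taylor P) v))
    = homogenize P (mexp (total_set P u) + mexp (total_set P v)) (lin wedge_gen (tensor (sng u 1) (ext_diff v)))"
proof -
  have "mexp (total_set P v - total_set P (v - {k})) + (mexp (total_set P u) + mexp (total_set P (v - {k})))
      = mexp (total_set P u) + mexp (total_set P v)" for k
    using mexp_diff_add[OF total_set_mono[of "v - {k}" v P]] by (simp add: add.left_commute)
  then show ?thesis
    by (simp add: diff_taylor[OF assms] ext_diff_def tensor_sum_right lin_sum homogenize_sum
        phi_homogenize scale_homogenize fits_wedge_gen del: power_Suc)
qed

text \<open>
  All terms are homogenizations in the same degree, so the claim is the Leibniz rule for
  \<open>ext_diff\<close>.
\<close>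

lemma chain_map_phi:
  "chain_map (tensor_complex (taylor P) (taylor P))
     (taylor P :: (nat set, ('m::finite, 'k::comm_ring_1) mpoly) fcomplex) (phi P)"
    (is "chain_map _ ?R _")
  unfolding chain_map_iff
proof (rule ballI)
  fix t assume "t \<in> gens (tensor_complex ?R ?R)"
  then obtain u v where t: "t = (u, v)" and uv: "u \<subseteq> {..<length P}" "v \<subseteq> {..<length P}"
    by auto
  then have fin: "finite u" "finite v" by (auto intro: finite_subset)
  let ?a = "mexp (total_set P u) + mexp (total_set P v)"
  have "phi P (u, v) \<in> chains ?R (card u + card v)"
    using uv fin by (auto simp: phi_homogenize wedge_gen_eq homogenize_sng card_Un_disjoint intro!: chains_sng)
  moreover have "bd ?R (phi P (u, v)) = homogenize P ?a (lin ext_diff (wedge_gen (u, v)))"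
    unfolding phi_homogenize
  proof (rule diff_homogenize)
    fix w assume w: "w \<in> supp (wedge_gen (u, v) :: nat set \<Rightarrow>\<^sub>0 'k)"
    then have "finite w" using fin by (auto simp: wedge_gen_eq split: if_splits)
    then show "finite w \<and> total_set P w \<subseteq> supp ?a" using fits_wedge_gen[OF w] by simp
  qed
  ultimately show "phi P t \<in> chains ?R (hdeg (tensor_complex ?R ?R) t) \<and>
      bd ?R (phi P t) = lin (phi P) (diff (tensor_complex ?R ?R) t)"
    by (simp add: t ext_diff_wedge_gen[OF fin] homogenize_add homogenize_scale lin_add lin_scale
        phi_diff_left[OF fin(1)] phi_diff_right[OF fin(2)] constants.power_minus_one)
qed

subsection \<open>Exactness\<close>

text \<open>
  If \<open>\<sigma>\<^sub>k\<close> divides \<open>a\<close>, the product of \<open>\<sigma>\<^sub>k\<close> with any generator of the part of degree \<open>a\<close> lies in this part again, so the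
  contraction \<open>- \<sigma>\<^sub>k z\<close> can be homogenized.
\<close>

lemma homogenize_boundary:
  fixes z :: "nat set \<Rightarrow>\<^sub>0 'k::comm_ring_1"
  assumes z: "\<And>u. u \<in> supp z \<Longrightarrow> u \<subseteq> {..<length P} \<and> card u = n \<and> total_set P u \<subseteq> supp a"
    and cycle: "lin ext_diff z = 0" and k: "k < length P" "P ! k \<subseteq> supp a"
  shows "homogenize P a z \<in> boundaries (taylor P) n"
proof -
  have fin: "finite u" if "u \<in> supp z" for u using z[OF that] by (auto intro: finite_subset)
  have supp: "w \<subseteq> {..<length P} \<and> card w = Suc n \<and> total_set P w \<subseteq> supp a"
    if w: "w \<in> supp (gen_mult k z)" for w
  proof -
    from subsetD[OF supp_lin w[unfolded gen_mult_def]]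
    obtain u where u: "u \<in> supp z" "w \<in> supp (wedge_gen ({k}, u) :: nat set \<Rightarrow>\<^sub>0 'k)" by blast
    then have "k \<notin> u" "w = insert k u" by (auto simp: wedge_gen_eq split: if_splits)
    then show ?thesis using z[OF u(1)] fin[OF u(1)] k by (auto simp: total_set_def)
  qed
  have "bd (taylor P) (homogenize P a (- gen_mult k z)) = homogenize P a (lin ext_diff (- gen_mult k z))"
    by (rule diff_homogenize) (use supp in \<open>auto intro: finite_subset\<close>)
  also have "lin ext_diff (- gen_mult k z) = z"
    using ext_diff_gen_mult[of z k] fin by (simp add: lin_minus cycle) (simp add: gen_mult_def)
  finally have "homogenize P a z = bd (taylor P) (homogenize P a (- gen_mult k z))" ..
  moreover have "homogenize P a (- gen_mult k z) \<in> chains (taylor P) (Suc n)"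
    using supp subsetD[OF supp_homogenize, of _ P a "- gen_mult k z"] by (auto simp: chains_def)
  ultimately show ?thesis by (auto simp: boundaries_def)
qed

text \<open>
  In degree \<open>a\<close> the coefficient of \<open>u\<close> has a single term, and setting all variables to \<open>1\<close> extracts its scalar.
\<close>

lemma homogeneous_eq_homogenize:
  assumes "homogeneous (mexp \<circ> total_set P) a x"
  shows "x = homogenize P a (Poly_Mapping.map (evaluate (\<lambda>_. 1)) x)"
proof (rule poly_mapping_eqI)
  fix u
  have sup: "supp (coef x u) \<subseteq> {a - mexp (total_set P u)}"
  proof
    fix e assume e: "e \<in> supp (coef x u)"
    then have "u \<in> supp x" by (auto simp: in_keys_iff)
    then have "e + mexp (total_set P u) = a" using assms e by (auto simp: homogeneous_def)
    then show "e \<in> {a - mexp (total_set P u)}" by auto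
  qed
  have "coef x u = sng (a - mexp (total_set P u)) (coef (coef x u) (a - mexp (total_set P u)))"
    using expansion[OF _ sup] by simp
  then show "coef x u = coef (homogenize P a (Poly_Mapping.map (evaluate (\<lambda>_. 1)) x)) u"
    by (simp add: coef_homogenize evaluate_one.coef_map) (metis evaluate_sng mult_1_right)
qed

lemma evaluate_one_diff:
  fixes x :: "nat set \<Rightarrow>\<^sub>0 ('m::finite, 'k::comm_ring_1) mpoly"
  assumes "\<And>u. u \<in> supp x \<Longrightarrow> finite u"
  shows "Poly_Mapping.map (evaluate (\<lambda>_. 1)) (bd (taylor P) x)
    = lin ext_diff (Poly_Mapping.map (evaluate (\<lambda>_. 1)) x)"
proof -
  have sum: "Poly_Mapping.map (evaluate (\<lambda>_. 1)) (sum g I) = (\<Sum>i\<in>I. Poly_Mapping.map (evaluate (\<lambda>_. 1)) (g i))"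
    for g :: "nat \<Rightarrow> nat set \<Rightarrow>\<^sub>0 ('m, 'k) mpoly" and I
    by (induction I rule: infinite_finite_induct) (simp_all add: evaluate_one.map_zero evaluate_one.map_add)
  have gen: "Poly_Mapping.map (evaluate (\<lambda>_. 1)) (diff (taylor P :: (nat set, ('m, 'k) mpoly) fcomplex) u) = ext_diff u"
    if "finite u" for u
    by (simp add: diff_taylor[OF that] ext_diff_def sum evaluate_one.map_sng evaluate_sng)
  show ?thesis
    unfolding bd_def evaluate_one.map_lin
    by (rule lin_cong, rule gen, rule assms, erule subsetD[OF evaluate_one.supp_map])
qed

lemma ex_exponent:
  fixes x :: "'b \<Rightarrow>\<^sub>0 ('m, 'k::zero) mpoly"
  assumes "u \<in> supp x"
  obtains e where "e \<in> supp (coef x u)"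
proof -
  have "supp (coef x u) \<noteq> {}" using assms by (simp add: in_keys_iff)
  then show ?thesis using that by blast
qed

lemma boundaries_taylor_homogeneous:
  fixes x :: "nat set \<Rightarrow>\<^sub>0 ('m::finite, 'k::comm_ring_1) mpoly"
  assumes x: "x \<in> cycles (taylor P) n" and hom: "homogeneous (mexp \<circ> total_set P) a x"
    and k: "x \<noteq> 0 \<Longrightarrow> \<exists>k<length P. P ! k \<subseteq> supp a"
  shows "x \<in> boundaries (taylor P) n"
proof (cases "x = 0")
  case False
  then obtain k where k: "k < length P" "P ! k \<subseteq> supp a" using assms(3) by blast
  let ?z = "Poly_Mapping.map (evaluate (\<lambda>_. 1)) x"
  have xc: "x \<in> chains (taylor P) n" "bd (taylor P) x = 0" using x by (auto simp: cycles_def)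
  have supp: "u \<subseteq> {..<length P} \<and> card u = n \<and> total_set P u \<subseteq> supp a" if u: "u \<in> supp x" for u
  proof -
    obtain e where "e \<in> supp (coef x u)" using ex_exponent[OF u] .
    then have "e + mexp (total_set P u) = a" using hom u by (auto simp: homogeneous_def)
    then show ?thesis using chainsD[OF xc(1) u] add_mexp by auto
  qed
  have "lin ext_diff ?z = Poly_Mapping.map (evaluate (\<lambda>_. 1)) (bd (taylor P) x)"
    by (rule evaluate_one_diff[symmetric]) (use supp finite_subset in fastforce)
  also have "\<dots> = 0" by (simp add: xc evaluate_one.map_zero)
  finally have "homogenize P a ?z \<in> boundaries (taylor P) n"
    by (intro homogenize_boundary[OF _ _ k] supp) (erule subsetD[OF evaluate_one.supp_map])
  then show ?thesis using homogeneous_eq_homogenize[OF hom] by simp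
qed simp

lemma component_taylor:
  fixes x :: "nat set \<Rightarrow>\<^sub>0 ('m::finite, 'k::comm_ring_1) mpoly"
  assumes "x \<in> cycles (taylor P) n"
  shows "component (mexp \<circ> total_set P) a x \<in> cycles (taylor P) n"
proof -
  have x: "x \<in> chains (taylor P) n" "bd (taylor P) x = 0" using assms by (auto simp: cycles_def)
  have "component (mexp \<circ> total_set P) a (bd (taylor P) x)
      = bd (taylor P) (component (mexp \<circ> total_set P) a x)"
    unfolding bd_def
    by (rule component_lin)
      (use chainsD[OF x(1)] in \<open>auto intro!: homogeneous_diff_taylor intro: finite_subset\<close>)
  then show ?thesis using x by (simp add: cycles_def component_chains)
qed

text \<open>
  By the multigrading it suffices to treat a homogeneous cycle. In positive degree it involves some generator
  with at least one factor \<open>\<sigma>\<^sub>k\<close>, which divides the multidegree, so \<open>boundaries_taylor_homogeneous\<close>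
  applies.
\<close>

lemma acyclic_taylor:
  "cycles (taylor P) (Suc n) = boundaries (taylor P :: (nat set, ('m::finite, 'k::comm_ring_1) mpoly) fcomplex) (Suc n)"
proof
  show "cycles (taylor P) (Suc n)
      \<subseteq> boundaries (taylor P :: (nat set, ('m, 'k) mpoly) fcomplex) (Suc n)"
  proof
    fix x :: "nat set \<Rightarrow>\<^sub>0 ('m, 'k) mpoly"
    assume x: "x \<in> cycles (taylor P) (Suc n)"
    show "x \<in> boundaries (taylor P) (Suc n)"
    proof (rule sum_components[where md = "mexp \<circ> total_set P"])
      fix a
      let ?x = "component (mexp \<circ> total_set P) a x"
      have "\<exists>k<length P. P ! k \<subseteq> supp a" if "?x \<noteq> 0"
      proof -
        have "supp ?x \<noteq> {}" using that by simp
        then obtain u where u: "u \<in> supp ?x" by blast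
        obtain e where ue: "e \<in> supp (coef ?x u)" using ex_exponent[OF u] .
        have "card u = Suc n" "u \<subseteq> {..<length P}"
          using chainsD[OF _ u, of "taylor P" "Suc n"] component_taylor[OF x, of a] by (auto simp: cycles_def)
        then obtain k where k: "k \<in> u" "k < length P" by (cases "u = {}") auto
        have "e + mexp (total_set P u) = a"
          using homogeneous_component[of "mexp \<circ> total_set P" a x] u ue by (auto simp: homogeneous_def)
        from add_mexp[OF this] k show ?thesis by (auto simp: total_set_def)
      qed
      then show "?x \<in> boundaries (taylor P) (Suc n)"
        by (rule boundaries_taylor_homogeneous[OF component_taylor[OF x] homogeneous_component])
    qed (auto intro: boundaries_add)
  qed
qed (rule boundaries_cycles[OF is_complex_taylor])

lemma chains_taylor_0: "x \<in> chains (taylor P) 0 \<longleftrightarrow> (\<exists>p. x = sng {} p)"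
proof
  assume x: "x \<in> chains (taylor P) 0"
  have "supp x \<subseteq> {{}}"
  proof
    fix u assume "u \<in> supp x"
    from chainsD[OF x this] have "card u = 0" "finite u" by (auto intro: finite_subset)
    then show "u \<in> {{}}" by simp
  qed
  from expansion[OF _ this] have "x = sng {} (coef x {})" by simp
  then show "\<exists>p. x = sng {} p" ..
qed (auto intro: chains_sng)

lemma sr_ideal_closed:
  assumes "p \<in> sr_ideal K" shows "q \<in> sr_ideal K \<Longrightarrow> p + q \<in> sr_ideal K" "r * p \<in> sr_ideal K"
  using additive_subgroup.a_closed[OF ideal.axioms(1)[OF sr_ideal_ideal], of p K q]
    ideal.I_l_closed[OF sr_ideal_ideal, of p K r] assms by simp_all

text \<open>
  The boundary of the generator \<open>{k}\<close> is \<open>- xprod (P ! k)\<close>, a member of the ideal. Conversely every term of a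
  member of the ideal has a degree divisible by some \<open>P ! k\<close>, where the contraction is available.
\<close>

lemma boundaries_taylor_0:
  fixes p :: "('m::finite, 'k::comm_ring_1) mpoly"
  shows "sng {} p \<in> boundaries (taylor P) 0 \<longleftrightarrow> p \<in> sr_ideal (complex_of P)"
proof
  assume "sng {} p \<in> boundaries (taylor P) 0"
  then obtain w where w: "w \<in> chains (taylor P) (Suc 0)" "sng {} p = bd (taylor P) w"
    by (auto simp: boundaries_def)
  have zero: "(0 :: ('m, 'k) mpoly) \<in> sr_ideal (complex_of P)" by (simp add: mem_sr_ideal)
  have "coef (bd (taylor P) w) {} \<in> sr_ideal (complex_of P)"
  proof (rule terms_induct[where x = w])
    fix u and r :: "('m, 'k) mpoly" assume "u \<in> supp w"
    from chainsD[OF w(1) this] obtain k where u: "u = {k}" "k < length P"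
      by (auto simp: card_Suc_eq)
    have "P ! k \<in> set P" using u by simp
    then have "sng (mexp (P ! k)) (- 1) \<in> (sr_ideal (complex_of P) :: ('m, 'k) mpoly set)"
      by (auto simp: mem_sr_ideal)
    from sr_ideal_closed(2)[OF this, of r]
    show "coef (bd (taylor P) (sng u r)) {} \<in> sr_ideal (complex_of P)"
      by (simp add: u bd_def diff_taylor pos_self coef_scale)
  qed (simp_all add: zero bd_def lin_add lookup_add sr_ideal_closed(1))
  then show "p \<in> sr_ideal (complex_of P)" by (simp flip: w(2))
next
  assume p: "p \<in> sr_ideal (complex_of P)"
  show "sng {} p \<in> boundaries (taylor P) 0"
  proof (rule terms_induct[where x = p])
    fix e and c :: 'k assume "e \<in> supp p"
    then obtain \<sigma> where "\<sigma> \<in> set P" "\<sigma> \<subseteq> supp e" using p by (auto simp: mem_sr_ideal)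
    then obtain k where k: "k < length P" "P ! k \<subseteq> supp e" by (auto simp: in_set_conv_nth)
    have "homogenize P e (sng {} c) \<in> boundaries (taylor P) 0"
      by (rule homogenize_boundary[OF _ _ k]) (auto simp: ext_diff_def split: if_splits)
    then show "sng {} (sng e c) \<in> boundaries (taylor P) 0" by (simp add: homogenize_sng mexp_def)
  qed (auto simp: single_add intro: boundaries_add)
qed

lemma free_resolution_taylor:
  "free_resolution (taylor P) (taylor_aug P :: _ \<Rightarrow> ('m::finite, 'k::comm_ring_1) mpoly set) (complex_of P)"
  unfolding free_resolution_def
proof (intro conjI)
  show "taylor_aug P ` chains (taylor P) 0
      = carrier (face_ring (complex_of P) :: ('m, 'k) mpoly set ring)"
    unfolding to_face_ring_surj[symmetric]
    by (force simp: taylor_aug_def image_iff intro: chains_sng)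
  show "{x \<in> chains (taylor P) 0. taylor_aug P x = \<zero>\<^bsub>face_ring (complex_of P)\<^esub>}
      = boundaries (taylor P :: (nat set, ('m, 'k) mpoly) fcomplex) 0"
  proof (intro equalityI subsetI)
    fix x :: "nat set \<Rightarrow>\<^sub>0 ('m, 'k) mpoly"
    assume "x \<in> {x \<in> chains (taylor P) 0. taylor_aug P x = \<zero>\<^bsub>face_ring (complex_of P)\<^esub>}"
    then show "x \<in> boundaries (taylor P) 0"
      by (auto simp: chains_taylor_0 taylor_aug_def boundaries_taylor_0 to_face_ring_eq_iff
          simp flip: to_face_ring_0)
  next
    fix x :: "nat set \<Rightarrow>\<^sub>0 ('m, 'k) mpoly"
    assume x: "x \<in> boundaries (taylor P) 0"
    then have "x \<in> chains (taylor P) 0"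
      using boundaries_cycles[OF is_complex_taylor] by (auto simp: cycles_def)
    then show "x \<in> {x \<in> chains (taylor P) 0. taylor_aug P x = \<zero>\<^bsub>face_ring (complex_of P)\<^esub>}"
      using x by (auto simp: chains_taylor_0 taylor_aug_def boundaries_taylor_0 to_face_ring_eq_iff
          simp flip: to_face_ring_0)
  qed
qed (auto simp: is_complex_taylor acyclic_taylor taylor_aug_def lookup_add coef_scale to_face_ring_simps)

lemma covers_multiplication_phi:
  "covers_multiplication (taylor P) (taylor_aug P :: _ \<Rightarrow> ('m::finite, 'k::comm_ring_1) mpoly set) (complex_of P) (phi P)"
proof -
  have "phi P ({}, {}) = (sng {} 1 :: nat set \<Rightarrow>\<^sub>0 ('m, 'k) mpoly)"
    by (simp add: phi_homogenize wedge_gen_empty homogenize_sng mexp_def)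
  then show ?thesis
    unfolding covers_multiplication_def
    by (auto simp: chain_map_phi chains_taylor_0 taylor_aug_def to_face_ring_simps)
qed

section \<open>The algebra structure on Tor\<close>

lemma Lam_part_cycles: "cycles (Lam_part P \<sigma>) q = {c \<in> cycles (Lam P) q. supp c \<subseteq> {u. total_set P u = \<sigma>}}"
  by (simp add: Lam_part_def cycles_restrict)

lemma Lam_part_boundaries: "boundaries (Lam_part P \<sigma>) q \<subseteq> boundaries (Lam P) q"
  unfolding Lam_part_def by (rule boundaries_restrict_subset)

text \<open>
  The monomial in \<open>\<phi>\<close> is \<open>xprod (total_set P u \<inter> total_set P v)\<close>, whose constant coefficient is zero unless the
  total sets are disjoint.
\<close>

lemma reduce_phi:
  fixes P :: "'m::finite set list"
  shows "reduce (phi P :: _ \<Rightarrow> nat set \<Rightarrow>\<^sub>0 ('m, 'k::comm_ring_1) mpoly) (u, v)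
    = (if total_set P u \<inter> total_set P v = {} then wedge_gen (u, v) else 0)"
proof -
  let ?S = "total_set P u" and ?T = "total_set P v"
  have "mexp ?S + mexp ?T - mexp (?S \<union> ?T) = mexp (?S \<inter> ?T)"
    by (rule poly_mapping_eqI) (auto simp: lookup_add lookup_minus coef_mexp)
  then have phi: "(phi P (u, v) :: nat set \<Rightarrow>\<^sub>0 ('m, 'k) mpoly) = scale (xprod (?S \<inter> ?T)) (wedge_gen (u, v))"
    by (simp add: phi_def total_set_union)
  have "const_coeff (xprod \<tau> :: ('m, 'k) mpoly) = (if \<tau> = {} then 1 else 0)" for \<tau>
    by (simp add: const_coeff_def monomial_def lookup_single when_def mexp_eq_0_iff)
  moreover have "Poly_Mapping.map const_coeff (wedge_gen (u, v) :: nat set \<Rightarrow>\<^sub>0 ('m, 'k) mpoly) = wedge_gen (u, v)"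
    by (simp add: wedge_gen_eq const_coeff.map_zero const_coeff.map_sng const_coeff.power_minus_one)
  ultimately show ?thesis by (simp add: reduce_def phi const_coeff.map_scale)
qed

lemma reduce_phi_tensor:
  fixes c :: "nat set \<Rightarrow>\<^sub>0 'k::comm_ring_1" and P :: "'m::finite set list"
  assumes "supp c \<subseteq> {u. total_set P u = \<sigma>}" "supp c' \<subseteq> {u. total_set P u = \<sigma>'}"
  shows "lin (reduce (phi P :: _ \<Rightarrow> nat set \<Rightarrow>\<^sub>0 ('m, 'k) mpoly)) (tensor c c')
    = (if \<sigma> \<inter> \<sigma>' = {} then wedge c c' else 0)"
proof -
  have "lin (reduce (phi P :: _ \<Rightarrow> nat set \<Rightarrow>\<^sub>0 ('m, 'k) mpoly)) (tensor c c')
      = lin (\<lambda>u. lin (\<lambda>v. if \<sigma> \<inter> \<sigma>' = {} then wedge_gen (u, v) else 0) c') c"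
    unfolding lin_tensor by (intro lin_cong) (use assms in \<open>auto simp: reduce_phi\<close>)
  then show ?thesis by (simp add: wedge_def lin_tensor lin_zero_fun)
qed

lemma is_complex_Lam:
  fixes P :: "'m::finite set list"
  shows "is_complex (Lam P :: (nat set, 'k::comm_ring_1) fcomplex)"
  using is_complex_reduce[OF is_complex_taylor, of P] by (simp add: reduce_complex_taylor)

text \<open>
  For disjoint total sets the exterior product is the constant part of \<open>\<phi>\<close>, which is a chain map.
\<close>

lemma wedge_cycles:
  fixes c c' :: "nat set \<Rightarrow>\<^sub>0 'k::comm_ring_1" and P :: "'m::finite set list"
  assumes c: "c \<in> cycles (Lam_part P \<sigma>) q" and c': "c' \<in> cycles (Lam_part P \<sigma>') j"
    and disj: "\<sigma> \<inter> \<sigma>' = {}"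
  shows "wedge c c' \<in> cycles (Lam_part P (\<sigma> \<union> \<sigma>')) (q + j)"
proof -
  let ?R = "taylor P :: (nat set, ('m, 'k) mpoly) fcomplex"
  have 1: "c \<in> cycles (Lam P) q" "c' \<in> cycles (Lam P) j"
    and 2: "supp c \<subseteq> {u. total_set P u = \<sigma>}" "supp c' \<subseteq> {u. total_set P u = \<sigma>'}"
    using c c' by (auto simp: Lam_part_cycles)
  have cm: "chain_map (tensor_complex (Lam P) (Lam P)) (Lam P) (reduce (phi P :: _ \<Rightarrow> nat set \<Rightarrow>\<^sub>0 ('m, 'k) mpoly))"
    using chain_map_reduce[OF chain_map_phi[of P, where 'k = 'k]]
    by (simp add: reduce_tensor_complex reduce_complex_taylor)
  have "lin (reduce (phi P :: _ \<Rightarrow> nat set \<Rightarrow>\<^sub>0 ('m, 'k) mpoly)) (tensor c c') \<in> cycles (Lam P) (q + j)"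
    by (rule chain_map_cycles[OF is_complex_tensor[OF is_complex_Lam is_complex_Lam] cm tensor_cycles[OF 1]])
  moreover have "supp (wedge c c') \<subseteq> {u. total_set P u = \<sigma> \<union> \<sigma>'}"
  proof
    fix w assume "w \<in> supp (wedge c c')"
    from subsetD[OF supp_lin this[unfolded wedge_def]]
    obtain t where t: "t \<in> supp (tensor c c')" "w \<in> supp (wedge_gen t :: nat set \<Rightarrow>\<^sub>0 'k)" by blast
    obtain u v where uv: "t = (u, v)" by (cases t)
    have "u \<in> supp c" "v \<in> supp c'" using subsetD[OF supp_tensor t(1)] uv by auto
    moreover have "w = u \<union> v" using t(2) by (auto simp: uv wedge_gen_eq split: if_splits)
    ultimately show "w \<in> {u. total_set P u = \<sigma> \<union> \<sigma>'}" using 2 by (auto simp: total_set_union)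
  qed
  ultimately show ?thesis using reduce_phi_tensor[OF 2] disj by (simp add: Lam_part_cycles)
qed

text \<open>
  Apply \<open>reduce_multiplication\<close> to the two products \<open>\<phi>\<close> and \<open>\<mu>\<close> and evaluate the constant part of
  \<open>\<phi>\<close>.
\<close>

lemma tor_mult_taylor:
  fixes Q :: "('b, ('m::finite, 'k::comm_ring_1) mpoly) fcomplex"
  assumes Q: "free_resolution Q \<epsilon> (complex_of P)"
    and f: "covers_identity (taylor P) (taylor_aug P) Q \<epsilon> f"
    and \<mu>: "covers_multiplication Q \<epsilon> (complex_of P) \<mu>"
    and c: "c \<in> cycles (Lam_part P \<sigma>) q" and c': "c' \<in> cycles (Lam_part P \<sigma>') j"
  shows "tor_mult Q \<mu> q j
      (induced (reduce_complex Q) q (reduce f) (hclass (Lam_part P \<sigma>) q c))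
      (induced (reduce_complex Q) j (reduce f) (hclass (Lam_part P \<sigma>') j c'))
    = induced (reduce_complex Q) (q + j) (reduce f)
        (hclass (Lam_part P (\<sigma> \<union> \<sigma>')) (q + j) (if \<sigma> \<inter> \<sigma>' = {} then wedge c c' else 0))"
proof -
  let ?R = "taylor P :: (nat set, ('m, 'k) mpoly) fcomplex"
  note R = free_resolution_taylor[of P, where 'k = 'k]
  have 1: "c \<in> cycles (reduce_complex ?R) q" "c' \<in> cycles (reduce_complex ?R) j"
    and 2: "supp c \<subseteq> {u. total_set P u = \<sigma>}" "supp c' \<subseteq> {u. total_set P u = \<sigma>'}"
    using c c' by (auto simp: Lam_part_cycles reduce_complex_taylor)
  note f' = chain_map_reduce[OF covers_identityD(1)[OF f]]
  have ind: "induced (reduce_complex Q) n (reduce f) (hclass (Lam_part P \<tau>) n z)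
      = hclass (reduce_complex Q) n (lin (reduce f) z)" for n \<tau> z
    by (rule induced_hclass, rule chain_map_boundaries[OF f'])
      (simp add: reduce_complex_taylor subsetD[OF Lam_part_boundaries])
  have fc: "lin (reduce f) z \<in> cycles (reduce_complex Q) n" if "z \<in> cycles (reduce_complex ?R) n" for n z
    by (rule chain_map_cycles[OF is_complex_reduce[OF resolution_complex[OF R]] f' that])
  have \<mu>': "chain_map (tensor_complex Q Q) Q \<mu>" using \<mu> by (simp add: covers_multiplication_def)
  show ?thesis
    unfolding ind tor_mult_hclass[OF \<mu>' resolution_complex[OF Q] fc[OF 1(1)] fc[OF 1(2)]]
    using reduce_multiplication[OF R Q f covers_multiplication_phi \<mu> 1] reduce_phi_tensor[OF 2]
    by (intro hclass_eqI) simp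
qed

section \<open>The multigraded comparison\<close>

text \<open>
  The comparison theorem with homogeneity as the property \<open>H\<close>. The start is a preimage of \<open>1\<close> of degree
  \<open>0\<close>, and the steps are \<open>homogeneous_boundary\<close>.
\<close>

lemma homogeneous_comparison_exists:
  fixes Q :: "('b, ('m::finite, 'k::comm_ring_1) mpoly) fcomplex"
  assumes Q: "free_resolution Q \<epsilon> (complex_of P)" and md: "multigraded Q \<epsilon> (complex_of P) md"
  shows "\<exists>f. covers_identity (taylor P) (taylor_aug P) Q \<epsilon> f \<and>
    homogeneous_map (taylor P :: (nat set, ('m, 'k) mpoly) fcomplex) (mexp \<circ> total_set P) md f"
proof -
  let ?R = "taylor P :: (nat set, ('m, 'k) mpoly) fcomplex"
  have hQ: "\<And>b. b \<in> gens Q \<Longrightarrow> homogeneous md (md b) (diff Q b)"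
    using md by (simp add: multigraded_def)
  have "\<exists>f. covers_identity ?R (taylor_aug P) Q \<epsilon> f \<and>
      (\<forall>u\<in>gens ?R. homogeneous md (mexp (total_set P u)) (f u))"
  proof (rule comparison_map[OF free_resolution_taylor Q])
    fix u assume "u \<in> gens ?R" "hdeg ?R u = 0"
    then have "u = {}" by (auto dest: finite_subset)
    then show "\<exists>y\<in>chains Q 0. \<epsilon> y = taylor_aug P (sng u 1) \<and> homogeneous md (mexp (total_set P u)) y"
      using homogeneous_aug_one[OF Q md] by (simp add: taylor_aug_def mexp_def)
  next
    fix u f n assume u: "u \<in> gens ?R"
      and hom: "\<And>v. v \<in> supp (diff ?R u) \<Longrightarrow> homogeneous md (mexp (total_set P v)) (f v)"
      and bound: "lin f (diff ?R u) \<in> boundaries Q n"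
    have "finite u" using u by (auto intro: finite_subset)
    then have "homogeneous md (mexp (total_set P u)) (lin f (diff ?R u))"
      by (intro homogeneous_lin[OF homogeneous_diff_taylor]) (simp_all add: hom)
    from homogeneous_boundary[OF hQ bound this]
    show "\<exists>y\<in>chains Q (Suc n). bd Q y = lin f (diff ?R u) \<and> homogeneous md (mexp (total_set P u)) y" .
  qed
  then show ?thesis by (simp add: homogeneous_map_def)
qed

text \<open>
  Over \<open>\<^bold>k\<close> the differentials of both complexes and the map \<open>f\<close> are block diagonal for the multidegree,
  and \<open>f\<close> is bijective on the total homology.
\<close>

lemma homology_iso_degree_part:
  fixes Q :: "('b, ('m::finite, 'k::comm_ring_1) mpoly) fcomplex"
  assumes Q: "free_resolution Q \<epsilon> (complex_of P)" and md: "multigraded Q \<epsilon> (complex_of P) md"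
    and f: "covers_identity (taylor P) (taylor_aug P) Q \<epsilon> f"
    and hom: "homogeneous_map (taylor P) (mexp \<circ> total_set P) md f"
  shows "homology_iso (Lam_part P \<sigma>) (degree_part Q md (mexp \<sigma>)) q
    (induced (degree_part Q md (mexp \<sigma>)) q (reduce f))"
proof -
  let ?R = "taylor P :: (nat set, ('m, 'k) mpoly) fcomplex"
  let ?S = "{u. total_set P u = \<sigma>}" and ?T = "{b. md b = mexp \<sigma>}"
  note R = free_resolution_taylor[of P, where 'k = 'k]
  have sep_R: "separates (gens (reduce_complex ?R)) ?S ?S (diff (reduce_complex ?R))"
  proof -
    have "total_set P v = total_set P u" if u: "u \<in> gens ?R" and v: "v \<in> supp (reduce (diff ?R) u)" for u v
    proof -
      have "finite u" using u by (auto intro: finite_subset)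
      from supp_reduce_homogeneous[of _ _ "diff ?R", OF homogeneous_diff_taylor[OF this] v]
      show ?thesis by simp
    qed
    then show ?thesis unfolding separates_def by auto
  qed
  have sep_Q: "separates (gens (reduce_complex Q)) ?T ?T (diff (reduce_complex Q))"
    using md supp_reduce_homogeneous[of md _ "diff Q"] by (auto simp: separates_def multigraded_def)
  have sep_f: "separates (gens (reduce_complex ?R)) ?S ?T (reduce f)"
  proof -
    have "md b = mexp (total_set P u)" if "u \<in> gens ?R" "b \<in> supp (reduce f u)" for u b
      by (rule supp_reduce_homogeneous[of _ _ f u]) (use hom that in \<open>simp_all add: homogeneous_map_def\<close>)
    then show ?thesis unfolding separates_def by auto
  qed
  have "homology_iso (restrict_gens (reduce_complex ?R) ?S) (restrict_gens (reduce_complex Q) ?T) q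
      (induced (restrict_gens (reduce_complex Q) ?T) q (reduce f))"
    by (rule homology_iso_restrict[OF is_complex_reduce[OF resolution_complex[OF R]]
          chain_map_reduce[OF covers_identityD(1)[OF f]] reduce_comparison[OF R Q f] sep_R sep_Q sep_f])
  then show ?thesis by (simp add: Lam_part_def degree_part_def reduce_complex_taylor)
qed

theorem theorem3p6:
  fixes P :: "'m::finite set list"
    and R :: "(nat set, ('m, 'k::comm_ring_1) mpoly) fcomplex"
    and K :: "'m set set"
  assumes "principal_domain (ring_of_type_algebra :: 'k ring)"
  defines "R \<equiv> taylor P"
    and "K \<equiv> complex_of P"
  shows
    "chain_map (tensor_complex R R) R (phi P) \<and>
     free_resolution R (taylor_aug P) K \<and>
     covers_multiplication R (taylor_aug P) K (phi P) \<and>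
     (\<forall>(Q :: ('b, ('m, 'k) mpoly) fcomplex) \<epsilon>. free_resolution Q \<epsilon> K \<longrightarrow>
        (\<exists>f. covers_identity R (taylor_aug P) Q \<epsilon> f) \<and>
        (\<forall>f. covers_identity R (taylor_aug P) Q \<epsilon> f \<longrightarrow>
           (\<forall>q. homology_iso (Lam P) (reduce_complex Q) q
                  (induced (reduce_complex Q) q (reduce f))) \<and>
           (\<forall>\<mu> q j \<sigma> \<sigma>' c c'.
              covers_multiplication Q \<epsilon> K \<mu> \<longrightarrow>
              c \<in> cycles (Lam_part P \<sigma>) q \<longrightarrow> c' \<in> cycles (Lam_part P \<sigma>') j \<longrightarrow>
              tor_mult Q \<mu> q j
                (induced (reduce_complex Q) q (reduce f) (hclass (Lam_part P \<sigma>) q c))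
                (induced (reduce_complex Q) j (reduce f) (hclass (Lam_part P \<sigma>') j c'))
              = induced (reduce_complex Q) (q + j) (reduce f)
                  (hclass (Lam_part P (\<sigma> \<union> \<sigma>')) (q + j)
                     (if \<sigma> \<inter> \<sigma>' = {} then wedge c c' else 0)))) \<and>
        (\<forall>md. multigraded Q \<epsilon> K md \<longrightarrow>
           (\<exists>f. covers_identity R (taylor_aug P) Q \<epsilon> f \<and>
                homogeneous_map R (mexp \<circ> total_set P) md f) \<and>
           (\<forall>f q \<sigma>.
              covers_identity R (taylor_aug P) Q \<epsilon> f \<longrightarrow>
              homogeneous_map R (mexp \<circ> total_set P) md f \<longrightarrow>
              homology_iso (Lam_part P \<sigma>) (degree_part Q md (mexp \<sigma>)) q
                (induced (degree_part Q md (mexp \<sigma>)) q (reduce f))))) \<and>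
     (\<forall>q j \<sigma> \<sigma>' (c :: nat set \<Rightarrow>\<^sub>0 'k) c'.
        c \<in> cycles (Lam_part P \<sigma>) q \<longrightarrow> c' \<in> cycles (Lam_part P \<sigma>') j \<longrightarrow> \<sigma> \<inter> \<sigma>' = {} \<longrightarrow>
        wedge c c' \<in> cycles (Lam_part P (\<sigma> \<union> \<sigma>')) (q + j))"
  unfolding R_def K_def
proof (intro conjI allI impI)
  show "chain_map (tensor_complex (taylor P) (taylor P))
      (taylor P :: (nat set, ('m, 'k) mpoly) fcomplex) (phi P)"
    by (rule chain_map_phi)
  show free: "free_resolution (taylor P) (taylor_aug P :: _ \<Rightarrow> ('m, 'k) mpoly set) (complex_of P)"
    by (rule free_resolution_taylor)
  show "covers_multiplication (taylor P) (taylor_aug P :: _ \<Rightarrow> ('m, 'k) mpoly set) (complex_of P) (phi P)"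
    by (rule covers_multiplication_phi)
  fix Q :: "('b, ('m, 'k) mpoly) fcomplex" and \<epsilon>
  assume Q: "free_resolution Q \<epsilon> (complex_of P)"
  show "\<exists>f. covers_identity (taylor P) (taylor_aug P) Q \<epsilon> f"
    by (rule comparison_map_exists[OF free Q])
  show "homology_iso (Lam P) (reduce_complex Q) q (induced (reduce_complex Q) q (reduce f))"
    if "covers_identity (taylor P) (taylor_aug P) Q \<epsilon> f" for f q
    using homology_iso_comparison[OF free Q that] by (simp add: reduce_complex_taylor)
qed (fact tor_mult_taylor homogeneous_comparison_exists homology_iso_degree_part wedge_cycles)+

end
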